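(* Let $G$ be a finite simple graph, let $\pi=\{W_1,\ldots,W_r\}$ be a clique partition of $G$, let $n_1,\ldots,n_r$ be positive integers, and let $\Gamma=G^\pi[n_1,\ldots,n_r]$ be the multi-clique-whiskered graph of $G$ with respect to $\pi$. Then $$\mathrm{pd}\big(\Bbbk[V(\Gamma)]/I(\Gamma)\big)=\mathrm{bight}\,I(\Gamma).$$
   Context: $\Bbbk$ is an arbitrary field. A clique partition $\pi=\{W_1,\ldots,W_r\}$ of $G$ is a family of cliques (vertex sets inducing complete subgraphs) whose disjoint union is $V(G)$. The multi-clique-whiskered graph $G^\pi[n_1,\ldots,n_r]$ has vertex set $V(G)\cup\{w_{i,k}:1\le i\le r,\ 1\le k\le n_i\}$ (new vertices $w_{i,k}$) and edge set $E(G)\cup\bigcup_{i=1}^r\{\{x,w_{i,k}\}: x\in W_i,\ 1\le k\le n_i\}$. The edge ideal $I(\Gamma)\subseteq\Bbbk[V(\Gamma)]$ is generated by $uv$, $\{u,v\}\in E(\Gamma)$. $\mathrm{pd}$ is projective dimension over $\Bbbk[V(\Gamma)]$; $\mathrm{bight}$ (big height) of an ideal is the maximal height of its minimal primes. *)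

theory Defs
  imports "HOL-Algebra.QuotRing" "HOL-Algebra.Module" "HOL-Library.Poly_Mapping" "HOL-Library.Extended_Nat"
    "HOL-Library.Disjoint_Sets"
begin

section \<open>Projective modules and projective dimension\<close>

definition mod_hom ::
    "('r, 'k) ring_scheme \<Rightarrow> ('r, 'a, 'l) module_scheme \<Rightarrow> ('r, 'b, 'm) module_scheme \<Rightarrow> ('a \<Rightarrow> 'b) set"
  where "mod_hom R M N = {f \<in> carrier M \<rightarrow> carrier N.
     (\<forall>x\<in>carrier M. \<forall>y\<in>carrier M. f (x \<oplus>\<^bsub>M\<^esub> y) = f x \<oplus>\<^bsub>N\<^esub> f y) \<and>
     (\<forall>r\<in>carrier R. \<forall>x\<in>carrier M. f (r \<odot>\<^bsub>M\<^esub> x) = r \<odot>\<^bsub>N\<^esub> f x)}"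

definition mod_ker :: "('r, 'a, 'l) module_scheme \<Rightarrow> ('r, 'b, 'm) module_scheme \<Rightarrow> ('a \<Rightarrow> 'b) \<Rightarrow> 'a set"
  where "mod_ker M N f = {x \<in> carrier M. f x = \<zero>\<^bsub>N\<^esub>}"

text \<open>The free module with basis \<open>S\<close>: finitely supported functions \<open>S \<rightarrow> R\<close>, extended by zero.
  The fields \<^const>\<open>mult\<close> and \<^const>\<open>one\<close> of a module record play no role.\<close>

definition free_module :: "('r, 'k) ring_scheme \<Rightarrow> 'x set \<Rightarrow> ('r, 'x \<Rightarrow> 'r) module"
  where "free_module R S =
    \<lparr>carrier = {f. (\<forall>x\<in>S. f x \<in> carrier R) \<and> (\<forall>x. x \<notin> S \<longrightarrow> f x = \<zero>\<^bsub>R\<^esub>) \<and> finite {x. f x \<noteq> \<zero>\<^bsub>R\<^esub>}},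
     mult = (\<lambda>f g x. f x \<otimes>\<^bsub>R\<^esub> g x),
     one = (\<lambda>x. if x \<in> S then \<one>\<^bsub>R\<^esub> else \<zero>\<^bsub>R\<^esub>),
     zero = (\<lambda>x. \<zero>\<^bsub>R\<^esub>),
     add = (\<lambda>f g x. f x \<oplus>\<^bsub>R\<^esub> g x),
     smult = (\<lambda>r f x. r \<otimes>\<^bsub>R\<^esub> f x)\<rparr>"

text \<open>\<open>P\<close> is projective if it is isomorphic to a direct summand of a free module. Taking the basis
  to be a set of elements of the type of \<open>P\<close> loses nothing: a projective \<open>P\<close> is a direct summand of
  the free module on the set \<^term>\<open>carrier P\<close>.\<close>

definition projective_module :: "('r, 'k) ring_scheme \<Rightarrow> ('r, 'p, 'l) module_scheme \<Rightarrow> bool"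
  where "projective_module R P \<longleftrightarrow> Module.module R P \<and>
    (\<exists>(S :: 'p set) A B. let F = free_module R S in
       submodule A R F \<and> submodule B R F \<and>
       A <+>\<^bsub>F\<^esub> B = carrier F \<and> A \<inter> B = {\<zero>\<^bsub>F\<^esub>} \<and>
       (\<exists>\<phi> \<in> mod_hom R P (F\<lparr>carrier := A\<rparr>). bij_betw \<phi> (carrier P) A))"

text \<open>\<open>\<dots> \<rightarrow> P 2 \<rightarrow> P 1 \<rightarrow> P 0 \<rightarrow> M \<rightarrow> 0\<close>, with augmentation \<open>e\<close> and differentials
  \<open>d i : P (i + 1) \<rightarrow> P i\<close>.\<close>

definition projective_resolution ::
    "('r, 'k) ring_scheme \<Rightarrow> ('r, 'm, 'l) module_scheme \<Rightarrow>
     (nat \<Rightarrow> ('r, 'p) module) \<Rightarrow> (nat \<Rightarrow> 'p \<Rightarrow> 'p) \<Rightarrow> ('p \<Rightarrow> 'm) \<Rightarrow> bool"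
  where "projective_resolution R M P d e \<longleftrightarrow>
     (\<forall>i. projective_module R (P i)) \<and>
     e \<in> mod_hom R (P 0) M \<and> (\<forall>i. d i \<in> mod_hom R (P (Suc i)) (P i)) \<and>
     e ` carrier (P 0) = carrier M \<and>
     d 0 ` carrier (P 1) = mod_ker (P 0) M e \<and>
     (\<forall>i. d (Suc i) ` carrier (P (Suc (Suc i))) = mod_ker (P (Suc i)) (P i) (d i))"

text \<open>The infimum of the lengths of projective resolutions (\<open>\<infinity>\<close> if none is finite). The terms have
  carriers in the type \<open>('r + 'm) list\<close>, whose cardinality is the maximum of \<open>\<aleph>\<^sub>0\<close>, \<open>|'r|\<close> and \<open>|'m|\<close>.
  The free cover of \<open>M\<close> on all of its elements, the kernel of this cover, the free cover of that
  kernel, and so on all have isomorphic copies in this type, so a resolution of minimal length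
  exists there and the restriction does not change the value.\<close>

definition projective_dimension ::
    "('r, 'k) ring_scheme \<Rightarrow> ('r, 'm, 'l) module_scheme \<Rightarrow> enat"
  where "projective_dimension R M = Inf {enat l | l.
     \<exists>(P :: nat \<Rightarrow> ('r, ('r + 'm) list) module) d e.
       projective_resolution R M P d e \<and> (\<forall>i>l. carrier (P i) = {\<zero>\<^bsub>P i\<^esub>})}"

definition quotient_module :: "('r, 'k) ring_scheme \<Rightarrow> 'r set \<Rightarrow> ('r, 'r set) module"
  where "quotient_module R I =
    \<lparr>carrier = carrier (R Quot I), mult = mult (R Quot I), one = one (R Quot I),
     zero = zero (R Quot I), add = add (R Quot I),
     smult = (\<lambda>r C. (I +>\<^bsub>R\<^esub> r) \<otimes>\<^bsub>R Quot I\<^esub> C)\<rparr>"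


section \<open>Height and big height\<close>

definition prime_height :: "('r, 'k) ring_scheme \<Rightarrow> 'r set \<Rightarrow> enat"
  where "prime_height R p = Sup {enat l | l. \<exists>q :: nat \<Rightarrow> 'r set.
     (\<forall>i\<le>l. primeideal (q i) R) \<and> (\<forall>i<l. q i \<subset> q (Suc i)) \<and> q l = p}"

definition minimal_primes :: "('r, 'k) ring_scheme \<Rightarrow> 'r set \<Rightarrow> 'r set set"
  where "minimal_primes R I =
    {p. primeideal p R \<and> I \<subseteq> p \<and> (\<forall>q. primeideal q R \<and> I \<subseteq> q \<and> q \<subseteq> p \<longrightarrow> q = p)}"

text \<open>The supremum is a maximum for a proper ideal of a Noetherian ring, which has finitely many
  minimal primes and at least one.\<close>

definition bight :: "('r, 'k) ring_scheme \<Rightarrow> 'r set \<Rightarrow> enat"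
  where "bight R I = (SUP p \<in> minimal_primes R I. prime_height R p)"


section \<open>Polynomial rings and edge ideals\<close>

type_synonym ('v, 'k) mpoly = "('v \<Rightarrow>\<^sub>0 nat) \<Rightarrow>\<^sub>0 'k"

definition mvar :: "'v \<Rightarrow> ('v, 'k::field) mpoly"
  where "mvar v = Poly_Mapping.single (Poly_Mapping.single v 1) 1"

text \<open>\<open>k[V]\<close>, as the subring of the polynomials over all of the type \<open>'v\<close> in which only variables
  indexed by \<open>V\<close> occur.\<close>

definition poly_ring :: "'k itself \<Rightarrow> 'v set \<Rightarrow> ('v, 'k::field) mpoly ring"
  where "poly_ring _ V =
    \<lparr>carrier = {p. \<forall>m \<in> Poly_Mapping.keys p. Poly_Mapping.keys m \<subseteq> V},
     mult = (*), one = 1, zero = 0, add = (+)\<rparr>"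

type_synonym 'v graph = "'v set \<times> 'v set set"

abbreviation verts :: "'v graph \<Rightarrow> 'v set" where "verts \<equiv> fst"
abbreviation edges :: "'v graph \<Rightarrow> 'v set set" where "edges \<equiv> snd"

definition edge_ideal :: "'k itself \<Rightarrow> 'v graph \<Rightarrow> ('v, 'k::field) mpoly set"
  where "edge_ideal k G =
    genideal (poly_ring k (verts G)) {mvar u * mvar v | u v. {u, v} \<in> edges G}"


section \<open>Multi-clique-whiskered graphs\<close>

definition finite_simple_graph :: "'v graph \<Rightarrow> bool"
  where "finite_simple_graph G \<longleftrightarrow>
    finite (verts G) \<and> (\<forall>e \<in> edges G. e \<subseteq> verts G \<and> card e = 2)"

definition clique :: "'v graph \<Rightarrow> 'v set \<Rightarrow> bool"
  where "clique G C \<longleftrightarrow>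
    C \<subseteq> verts G \<and> (\<forall>x\<in>C. \<forall>y\<in>C. x \<noteq> y \<longrightarrow> {x, y} \<in> edges G)"

text \<open>The partition is the indexed family \<open>W 1, \<dots>, W r\<close>; empty cliques are allowed.\<close>

definition clique_partition :: "'v graph \<Rightarrow> nat \<Rightarrow> (nat \<Rightarrow> 'v set) \<Rightarrow> bool"
  where "clique_partition G r W \<longleftrightarrow>
    (\<forall>i\<in>{1..r}. clique G (W i)) \<and> disjoint_family_on W {1..r} \<and> (\<Union>i\<in>{1..r}. W i) = verts G"

text \<open>\<^term>\<open>Inl x\<close> is the vertex \<open>x\<close> of \<open>G\<close>, and \<^term>\<open>Inr (i, k)\<close> is the new vertex \<open>w\<^sub>i\<^sub>,\<^sub>k\<close>.\<close>

definition multi_clique_whiskered ::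
    "'v graph \<Rightarrow> nat \<Rightarrow> (nat \<Rightarrow> 'v set) \<Rightarrow> (nat \<Rightarrow> nat) \<Rightarrow> ('v + nat \<times> nat) graph"
  where "multi_clique_whiskered G r W n =
    (Inl ` verts G \<union> {Inr (i, k) | i k. i \<in> {1..r} \<and> k \<in> {1..n i}},
     (`) Inl ` edges G \<union> {{Inl x, Inr (i, k)} | x i k. i \<in> {1..r} \<and> x \<in> W i \<and> k \<in> {1..n i}})"

end

theory Submission
  imports Defs "HOL-Library.Function_Algebras"
begin

text \<open>
Let \<open>V\<close> be the vertex set of the graph \<open>\<Gamma>\<close>, let \<open>S = k[V]\<close>, and let \<open>I\<close> be the edge ideal. The minimal primes
of \<open>I\<close> are the ideals generated by the complements \<open>V - A\<close> of the maximal independent sets \<open>A\<close>, and an ideal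
generated by \<open>c\<close> variables has height \<open>c\<close>. Hence the big height is the maximum of \<open>card (V - A)\<close> over all
these \<open>A\<close>; it remains to show that this is the projective dimension of \<open>S / I\<close>.

Lower bound (\<open>projective_resolution_length\<close>). For a maximal independent set \<open>A\<close>, the product \<open>u\<close> of the variables in \<open>A\<close>
is not in \<open>I\<close>, but every variable outside \<open>A\<close> multiplies it into \<open>I\<close>. So \<open>S / I\<close> has a nonzero
element killed by \<open>c = card (V - A)\<close> variables. The Koszul cohomology of these variables with coefficients in a
projective module vanishes below degree \<open>c\<close>; along a resolution of length \<open>l\<close> one degree is lost at each
syzygy, so that with coefficients in \<open>S / I\<close> it vanishes below degree \<open>c - l\<close>. As it does not vanish in degree \<open>0\<close>, this
gives \<open>c \<le> l\<close>.

Upper bound (\<open>pd_less_shedding\<close>). For a set \<open>D\<close> of vertices let \<open>J(D)\<close> be \<open>I\<close> plus the ideal generated by the variables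
in \<open>D\<close>. For a vertex \<open>x\<close> outside \<open>D\<close> with neighbourhood \<open>N(x)\<close>, the colon ideal \<open>J(D) : x\<close> is \<open>J(D \<union> N(x))\<close>, and
\<open>J(D) + (x)\<close> is \<open>J(D \<union> {x})\<close>. The exact sequence \<open>0 \<rightarrow> S / (J : x) \<rightarrow> S / J \<rightarrow> S / (J + (x)) \<rightarrow> 0\<close> and the
horseshoe lemma (\<open>pd_less_extension\<close>) bound the projective dimension of \<open>S / J(D)\<close> by those for the two larger sets. In a
multi-clique-whiskered graph, the neighbours of a new vertex \<open>w\<close> at the clique of an old vertex \<open>x\<close> are \<open>x\<close> and neighbours
of \<open>x\<close>. This makes \<open>x\<close> a shedding vertex: maximal independent sets stay maximal when \<open>x\<close> or its neighbours are put
back. So the maximum of \<open>card (V - A)\<close> does not increase in the induction. When all edges have been removed, \<open>J(D)\<close>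
is generated by the variables in \<open>D\<close>, and the projective dimension is at most \<open>card D\<close>.

Heights (\<open>prime_chain_length\<close>). Instead of the principal ideal theorem, the proof uses that elements chosen from the
successive differences of a chain of primes are algebraically independent over \<open>k\<close>, and that more than \<open>card V\<close>
elements of \<open>k[V]\<close> never are. A chain of primes below an ideal generated by variables is extended upwards by
adjoining the remaining variables.
\<close>

section \<open>Polynomials supported on a set of monomials\<close>

abbreviation "lkp \<equiv> Poly_Mapping.lookup"
abbreviation "mons \<equiv> Poly_Mapping.keys"

text \<open>The variable \<open>x\<close> as an exponent function.\<close>

definition mon1 :: "'v \<Rightarrow> 'v \<Rightarrow>\<^sub>0 nat" where "mon1 x = Poly_Mapping.single x 1"

lemma lookup_mon1 [simp]: "lkp (mon1 x) y = (if x = y then 1 else 0)"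
  by (simp add: mon1_def lookup_single)

lemma mons_mon1 [simp]: "mons (mon1 x) = {x}"
  by (simp add: mon1_def)

lemma mvar_eq: "mvar x = Poly_Mapping.single (mon1 x) 1"
  by (simp add: mvar_def mon1_def)

text \<open>The polynomials all of whose monomials satisfy \<open>Q\<close>. Polynomial subrings and monomial ideals are both of this form.\<close>

definition supported :: "(('v \<Rightarrow>\<^sub>0 nat) \<Rightarrow> bool) \<Rightarrow> ('v, 'k::field) mpoly set"
  where "supported Q = {p. \<forall>m \<in> mons p. Q m}"

lemma supportedI: "(\<And>m. lkp p m \<noteq> 0 \<Longrightarrow> Q m) \<Longrightarrow> p \<in> supported Q"
  by (auto simp: supported_def in_keys_iff)

lemma supportedD: "p \<in> supported Q \<Longrightarrow> lkp p m \<noteq> 0 \<Longrightarrow> Q m"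
  by (auto simp: supported_def in_keys_iff)

lemma supported_zero [simp]: "0 \<in> supported Q"
  by (rule supportedI) simp

lemma supported_add: "p \<in> supported Q \<Longrightarrow> q \<in> supported Q \<Longrightarrow> p + q \<in> supported Q"
  by (rule supportedI) (metis add.right_neutral lookup_add supportedD add.left_neutral)

lemma supported_uminus: "p \<in> supported Q \<Longrightarrow> - p \<in> supported Q"
  by (rule supportedI) (metis lookup_uminus neg_equal_0_iff_equal supportedD)

lemma supported_diff: "p \<in> supported Q \<Longrightarrow> q \<in> supported Q \<Longrightarrow> p - q \<in> supported Q"
  using supported_add[of p Q "- q"] supported_uminus[of q Q] by simp

lemma supported_mono: "p \<in> supported Q \<Longrightarrow> (\<And>m. Q m \<Longrightarrow> Q' m) \<Longrightarrow> p \<in> supported Q'"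
  by (auto simp: supported_def)

lemma supported_single: "(c \<noteq> 0 \<Longrightarrow> Q m) \<Longrightarrow> Poly_Mapping.single m c \<in> supported Q"
  by (auto simp: supported_def)

lemma supported_mult:
  assumes "p \<in> supported Q1" "q \<in> supported Q2" "\<And>a b. Q1 a \<Longrightarrow> Q2 b \<Longrightarrow> Q (a + b)"
  shows "p * q \<in> supported Q"
  using keys_mult[of p q] assms unfolding supported_def by fastforce

lemma supported_disjoint:
  assumes "p \<in> supported Q" "p \<in> supported (\<lambda>m. \<not> Q m)" shows "p = 0"
  by (rule poly_mapping_eqI) (metis assms lookup_zero supportedD)

lemma supported_sum: "(\<And>i. i \<in> A \<Longrightarrow> f i \<in> supported Q) \<Longrightarrow> sum f A \<in> supported Q"
  by (induction A rule: infinite_finite_induct) (auto intro: supported_add)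

lemma poly_sum_monomials:
  fixes p :: "('v, 'k::field) mpoly"
  assumes "finite A" "mons p \<subseteq> A"
  shows "p = (\<Sum>m\<in>A. Poly_Mapping.single m (lkp p m))"
proof (rule poly_mapping_eqI)
  fix m
  have "lkp (\<Sum>m\<in>A. Poly_Mapping.single m (lkp p m)) m = (\<Sum>i\<in>A. if m = i then lkp p i else 0)"
    unfolding lookup_sum by (rule sum.cong) (auto simp: lookup_single when_def)
  also have "\<dots> = lkp p m"
    using assms by (auto simp: in_keys_iff)
  finally show "lkp p m = lkp (\<Sum>m\<in>A. Poly_Mapping.single m (lkp p m)) m" by simp
qed

lemma mpoly_induct [case_names monomial add]:
  fixes p :: "('v, 'k::field) mpoly"
  assumes "\<And>m c. P (Poly_Mapping.single m c)" "\<And>p q. P p \<Longrightarrow> P q \<Longrightarrow> P (p + q)"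
  shows "P p"
proof -
  have "P (\<Sum>m\<in>A. Poly_Mapping.single m (lkp p m))" if "finite A" for A
    using that
  proof (induction A)
    case empty
    show ?case using assms(1)[of 0 0] by simp
  qed (simp add: assms)
  from this[of "mons p"] show ?thesis using poly_sum_monomials[of "mons p" p] by simp
qed

lemma supported_split:
  fixes p :: "('v, 'k::field) mpoly"
  assumes "p \<in> supported Q"
  obtains p1 p2 where "p = p1 + p2" "p1 \<in> supported (\<lambda>m. Q m \<and> D m)" "p2 \<in> supported (\<lambda>m. Q m \<and> \<not> D m)"
proof -
  let ?s = "\<lambda>m. Poly_Mapping.single m (lkp p m)"
  have "p = (\<Sum>m\<in>mons p. ?s m)" by (rule poly_sum_monomials) auto
  also have "\<dots> = (\<Sum>m\<in>{m\<in>mons p. D m}. ?s m) + (\<Sum>m\<in>{m\<in>mons p. \<not> D m}. ?s m)"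
    by (subst sum.union_disjoint[symmetric]) (auto intro: sum.cong)
  finally show ?thesis
    by (rule that) (intro supported_sum supported_single; use assms in \<open>auto simp: supported_def\<close>)+
qed

section \<open>Division by a variable\<close>

text \<open>The quotient of \<open>p\<close> by the variable \<open>x\<close>; the monomials of \<open>p\<close> without \<open>x\<close> are dropped. It is a left
  inverse of multiplication by \<open>x\<close> that commutes with multiplication by every other variable.\<close>

definition var_quot :: "'v \<Rightarrow> ('v, 'k::field) mpoly \<Rightarrow> ('v, 'k) mpoly"
  where "var_quot x p = Poly_Mapping.map_key (\<lambda>m. mon1 x + m) p"

lemma inj_mon_add: "inj (\<lambda>m. (a :: 'v \<Rightarrow>\<^sub>0 nat) + m)"
  by (rule injI) simp

lemma lookup_var_quot: "lkp (var_quot x p) m = lkp p (mon1 x + m)"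
  unfolding var_quot_def by (simp add: map_key.rep_eq[OF inj_mon_add])

lemma var_quot_zero [simp]: "var_quot x 0 = 0"
  by (rule poly_mapping_eqI) (simp add: lookup_var_quot)

lemma var_quot_add: "var_quot x (p + q) = var_quot x p + var_quot x q"
  by (rule poly_mapping_eqI) (simp add: lookup_var_quot lookup_add)

lemma var_quot_diff: "var_quot x (p - q) = var_quot x p - var_quot x q"
  by (rule poly_mapping_eqI) (simp add: lookup_var_quot lookup_minus)

lemma mon_decompose: "lkp m x \<noteq> 0 \<Longrightarrow> mon1 x + (m - mon1 x) = (m :: 'v \<Rightarrow>\<^sub>0 nat)"
  by (rule poly_mapping_eqI) (auto simp: lookup_add lookup_minus lookup_single when_def)

lemma var_quot_single:
  "var_quot x (Poly_Mapping.single m c) = (if lkp m x \<noteq> 0 then Poly_Mapping.single (m - mon1 x) c else 0)"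
proof (rule poly_mapping_eqI)
  fix n
  show "lkp (var_quot x (Poly_Mapping.single m c)) n =
    lkp (if lkp m x \<noteq> 0 then Poly_Mapping.single (m - mon1 x) c else 0) n"
  proof (cases "m = mon1 x + n")
    case True
    then have "lkp m x \<noteq> 0" by (simp add: lookup_add)
    with True show ?thesis by (simp add: lookup_var_quot)
  next
    case False
    then show ?thesis
      using mon_decompose[of m x] by (auto simp: lookup_var_quot lookup_single when_def)
  qed
qed

lemma mvar_mult_single: "mvar x * Poly_Mapping.single m c = Poly_Mapping.single (mon1 x + m) c"
  by (simp add: mvar_eq mult_single)

lemma var_quot_mvar_mult [simp]: "var_quot x (mvar x * p) = p"
proof (induction p rule: mpoly_induct)
  case (monomial m c)
  show ?case by (simp add: mvar_mult_single var_quot_single lookup_add)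
qed (simp add: distrib_left var_quot_add)

lemma var_quot_mvar_mult_other:
  assumes "x \<noteq> y" shows "var_quot x (mvar y * p) = mvar y * var_quot x p"
proof (induction p rule: mpoly_induct)
  case (monomial m c)
  have "mon1 y + m - mon1 x = mon1 y + (m - mon1 x)" if "lkp m x \<noteq> 0"
    using that assms by (intro poly_mapping_eqI) (auto simp: lookup_add lookup_minus lookup_single when_def)
  then show ?case using assms by (auto simp: mvar_mult_single var_quot_single lookup_add lookup_single)
qed (simp add: distrib_left var_quot_add)

lemma mvar_mult_cancel: "mvar x * p = mvar x * q \<Longrightarrow> p = q"
  by (metis var_quot_mvar_mult)

lemma lookup_mvar_mult:
  "lkp (mvar x * p) m = (if lkp m x \<noteq> 0 then lkp p (m - mon1 x) else 0)"
proof (cases "lkp m x \<noteq> 0")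
  case True
  then have "lkp (mvar x * p) m = lkp (var_quot x (mvar x * p)) (m - mon1 x)"
    by (simp add: lookup_var_quot mon_decompose del: var_quot_mvar_mult)
  with True show ?thesis by simp
next
  case False
  have "lkp (mvar x * p) m = 0"
  proof (induction p rule: mpoly_induct)
    case (monomial m' c)
    show ?case using False by (auto simp: mvar_mult_single lookup_single when_def lookup_add)
  qed (simp add: distrib_left lookup_add)
  with False show ?thesis by simp
qed

lemma var_quot_decompose:
  fixes p :: "('v, 'k::field) mpoly"
  assumes "p \<in> supported Q"
  obtains r where "p = mvar x * var_quot x p + r" "r \<in> supported (\<lambda>m. Q m \<and> lkp m x = 0)"
    "var_quot x p \<in> supported (\<lambda>m. Q (mon1 x + m))"
proof
  show "p = mvar x * var_quot x p + (p - mvar x * var_quot x p)" by simp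
  show "p - mvar x * var_quot x p \<in> supported (\<lambda>m. Q m \<and> lkp m x = 0)"
    using assms by (intro supportedI)
      (auto simp: lookup_minus lookup_mvar_mult lookup_var_quot mon_decompose dest: supportedD split: if_splits)
  show "var_quot x p \<in> supported (\<lambda>m. Q (mon1 x + m))"
    using assms by (intro supportedI) (auto simp: lookup_var_quot dest: supportedD)
qed

lemma supported_mvar_mult_iff:
  "mvar x * p \<in> supported Q \<longleftrightarrow> p \<in> supported (\<lambda>m. Q (mon1 x + m))"
proof
  assume "mvar x * p \<in> supported Q"
  then show "p \<in> supported (\<lambda>m. Q (mon1 x + m))"
    by (metis var_quot_decompose var_quot_mvar_mult)
next
  assume "p \<in> supported (\<lambda>m. Q (mon1 x + m))"
  then show "mvar x * p \<in> supported Q"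
    by (intro supportedI) (metis lookup_mvar_mult mon_decompose supportedD)
qed

section \<open>Polynomial rings and monomial ideals\<close>

text \<open>The carrier of \<open>k[V]\<close>.\<close>

definition polys :: "'v set \<Rightarrow> ('v, 'k::field) mpoly set"
  where "polys V = supported (\<lambda>m. mons m \<subseteq> V)"

lemma mons_add: "mons (a + b) = mons a \<union> mons (b :: 'v \<Rightarrow>\<^sub>0 nat)"
  by (auto simp: in_keys_iff lookup_add)

lemma polys_zero [simp]: "0 \<in> polys V"
  and polys_one [simp]: "1 \<in> polys V"
  and polys_add: "p \<in> polys V \<Longrightarrow> q \<in> polys V \<Longrightarrow> p + q \<in> polys V"
  and polys_uminus: "p \<in> polys V \<Longrightarrow> - p \<in> polys V"
  and polys_diff: "p \<in> polys V \<Longrightarrow> q \<in> polys V \<Longrightarrow> p - q \<in> polys V"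
  unfolding polys_def
  by (auto intro: supported_add supported_uminus supported_diff) (simp add: supported_def)

lemma polys_mult: "p \<in> polys V \<Longrightarrow> q \<in> polys V \<Longrightarrow> p * q \<in> polys V"
  unfolding polys_def by (erule (1) supported_mult) (simp add: mons_add)

lemma mvar_in_polys: "x \<in> V \<Longrightarrow> mvar x \<in> polys V"
  unfolding polys_def mvar_eq by (rule supported_single) simp

lemma var_quot_in_polys: "p \<in> polys V \<Longrightarrow> var_quot x p \<in> polys V"
  unfolding polys_def by (intro supportedI) (auto simp: lookup_var_quot mons_add dest!: supportedD)

text \<open>No order on the exponents is needed: remove all factors \<open>x\<close> from \<open>f\<close> and \<open>g\<close>; then the parts of \<open>f\<close> and \<open>g\<close> free of \<open>x\<close>
  are nonzero, and their product is the part of \<open>f * g\<close> free of \<open>x\<close>.\<close>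

lemma polys_no_zero_divisors:
  fixes f g :: "('v, 'k::field) mpoly"
  assumes "finite V" "f \<in> polys V" "g \<in> polys V" "f * g = 0"
  shows "f = 0 \<or> g = 0"
  using assms
proof (induction V arbitrary: f g rule: finite_induct)
  case empty
  then have "mons f \<subseteq> {0}" "mons g \<subseteq> {0}"
    by (auto simp: polys_def supported_def)
  then obtain c d where fg: "f = Poly_Mapping.single 0 c" "g = Poly_Mapping.single 0 d"
    using poly_sum_monomials[of "{0}" f] poly_sum_monomials[of "{0}" g] by simp
  then have "Poly_Mapping.single 0 (c * d) = (0 :: ('v, 'k) mpoly)"
    using \<open>f * g = 0\<close> by (simp add: mult_single)
  then have "c * d = 0" by (metis lookup_single_eq lookup_zero)
  then show ?case unfolding fg by (metis mult_eq_0_iff single_zero)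
next
  case (insert x V)
  define dg where "dg p = (\<Sum>m\<in>mons p. lkp m x)" for p :: "('v, 'k) mpoly"
  \<comment> \<open>dividing by \<open>x\<close> lowers this measure\<close>
  have dg: "dg p < dg (mvar x * p)" if "p \<noteq> 0" for p :: "('v, 'k) mpoly"
  proof -
    have keys: "mons (mvar x * p) = (\<lambda>m. mon1 x + m) ` mons p"
    proof (intro equalityI subsetI)
      fix m assume "m \<in> mons (mvar x * p)"
      then have "lkp m x \<noteq> 0" "m - mon1 x \<in> mons p"
        by (auto simp: in_keys_iff lookup_mvar_mult split: if_splits)
      then show "m \<in> (\<lambda>m. mon1 x + m) ` mons p" by (metis image_eqI mon_decompose)
    qed (auto simp: in_keys_iff lookup_mvar_mult lookup_add)
    have "dg (mvar x * p) = (\<Sum>m\<in>mons p. 1 + lkp m x)"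
      unfolding dg_def keys by (subst sum.reindex) (auto simp: lookup_add)
    also have "\<dots> = card (mons p) + dg p" unfolding dg_def sum.distrib by simp
    finally show ?thesis using that by (simp add: card_gt_0_iff)
  qed
  show ?case using insert.prems
  proof (induction "dg f + dg g" arbitrary: f g rule: less_induct)
    case less
    obtain f0 where f0: "f = mvar x * var_quot x f + f0" "f0 \<in> supported (\<lambda>m. mons m \<subseteq> insert x V \<and> lkp m x = 0)"
      using less.prems(1) unfolding polys_def by (rule var_quot_decompose)
    obtain g0 where g0: "g = mvar x * var_quot x g + g0" "g0 \<in> supported (\<lambda>m. mons m \<subseteq> insert x V \<and> lkp m x = 0)"
      using less.prems(2) unfolding polys_def by (rule var_quot_decompose)
    have V: "f0 \<in> polys V" "g0 \<in> polys V"
      using f0(2) g0(2) unfolding polys_def by (auto elim!: supported_mono simp: in_keys_iff)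
    have "f * g = mvar x * (var_quot x f * (mvar x * var_quot x g + g0) + f0 * var_quot x g) + f0 * g0"
      by (subst f0(1), subst g0(1)) (simp add: algebra_simps)
    then have "f0 * g0 = mvar x * - (var_quot x f * (mvar x * var_quot x g + g0) + f0 * var_quot x g)"
      using \<open>f * g = 0\<close> unfolding mult_minus_right by (metis add_eq_0_iff)
    moreover have "mvar x * h \<in> supported (\<lambda>m. \<not> lkp m x = 0)" for h :: "('v, 'k) mpoly"
      by (rule supportedI) (auto simp: lookup_mvar_mult split: if_splits)
    moreover have "f0 * g0 \<in> supported (\<lambda>m. lkp m x = 0)"
      using f0(2) g0(2) by (rule supported_mult) (simp add: lookup_add)
    ultimately have "f0 * g0 = 0" by (intro supported_disjoint[of _ "\<lambda>m. lkp m x = 0"]) simp_all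
    with insert.IH[OF V] consider "f0 = 0" | "g0 = 0" by blast
    then show ?case
    proof cases
      case 1
      show ?thesis
      proof (cases "f = 0")
        case False
        let ?f = "var_quot x f"
        have f: "f = mvar x * ?f" using f0(1) 1 by (metis add.right_neutral)
        with False have nz: "?f \<noteq> 0" by (metis mult_zero_right)
        have "mvar x * (?f * g) = mvar x * 0"
          using \<open>f * g = 0\<close> f by (metis mult.assoc mult_zero_right)
        then have "?f * g = 0" by (rule mvar_mult_cancel)
        moreover have "dg ?f < dg f" using dg[OF nz] f by metis
        ultimately show ?thesis
          using less.hyps[of ?f g] less.prems(1,2) nz var_quot_in_polys[of f "insert x V" x] by auto
      qed simp
    next
      case 2
      show ?thesis
      proof (cases "g = 0")
        case False
        let ?g = "var_quot x g"
        have g: "g = mvar x * ?g" using g0(1) 2 by (metis add.right_neutral)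
        with False have nz: "?g \<noteq> 0" by (metis mult_zero_right)
        have "mvar x * (f * ?g) = mvar x * 0"
          using \<open>f * g = 0\<close> g by (metis mult.left_commute mult_zero_right)
        then have "f * ?g = 0" by (rule mvar_mult_cancel)
        moreover have "dg ?g < dg g" using dg[OF nz] g by metis
        ultimately show ?thesis
          using less.hyps[of f ?g] less.prems(1,2) nz var_quot_in_polys[of g "insert x V" x] by auto
      qed simp
    qed
  qed
qed

lemma poly_ring_simps:
  "carrier (poly_ring k V) = polys V" "mult (poly_ring k V) = (*)" "one (poly_ring k V) = 1"
  "zero (poly_ring k V) = 0" "add (poly_ring k V) = (+)"
  by (simp_all add: poly_ring_def polys_def supported_def)

lemma cring_poly_ring: "cring (poly_ring k V)"
proof (rule cringI)
  let ?R = "poly_ring k V"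
  show "abelian_group ?R"
  proof (rule abelian_groupI)
    fix x assume "x \<in> carrier ?R"
    then show "\<exists>y\<in>carrier ?R. y \<oplus>\<^bsub>?R\<^esub> x = \<zero>\<^bsub>?R\<^esub>"
      by (intro bexI[of _ "- x"]) (auto simp: poly_ring_simps polys_uminus)
  qed (auto simp: poly_ring_simps polys_add algebra_simps)
  show "Group.comm_monoid ?R"
    by (rule comm_monoidI) (auto simp: poly_ring_simps polys_mult algebra_simps)
qed (auto simp: poly_ring_simps algebra_simps)

lemma ideal_poly_ringI:
  fixes I :: "('v, 'k::field) mpoly set"
  assumes "I \<subseteq> polys V" "0 \<in> I" "\<And>a b. a \<in> I \<Longrightarrow> b \<in> I \<Longrightarrow> a + b \<in> I"
    "\<And>a b. a \<in> I \<Longrightarrow> b \<in> polys V \<Longrightarrow> b * a \<in> I"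
  shows "ideal I (poly_ring k V)"
proof -
  interpret R: cring "poly_ring k V" by (rule cring_poly_ring)
  show ?thesis
  proof (rule idealI)
    show "subgroup I (add_monoid (poly_ring k V))"
    proof (rule R.add.subgroupI)
      fix a assume a: "a \<in> I"
      then have "- a \<in> I" using assms(4)[OF a, of "- 1"] by (simp add: polys_uminus)
      moreover have "\<ominus>\<^bsub>poly_ring k V\<^esub> a = - a"
        using a assms(1) by (intro R.minus_equality) (auto simp: poly_ring_simps polys_uminus)
      ultimately show "\<ominus>\<^bsub>poly_ring k V\<^esub> a \<in> I" by simp
    qed (use assms in \<open>auto simp: poly_ring_simps\<close>)
  next
    fix a x assume "a \<in> I" "x \<in> carrier (poly_ring k V)"
    then show "x \<otimes>\<^bsub>poly_ring k V\<^esub> a \<in> I" "a \<otimes>\<^bsub>poly_ring k V\<^esub> x \<in> I"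
      using assms(4)[of a x] by (simp_all add: poly_ring_simps mult.commute)
  qed (rule R.ring_axioms)
qed

text \<open>The span in \<open>k[V]\<close> of the monomials that satisfy \<open>Q\<close>. It is an ideal if \<open>Q\<close> is inherited by multiples.\<close>

definition mon_ideal :: "'v set \<Rightarrow> (('v \<Rightarrow>\<^sub>0 nat) \<Rightarrow> bool) \<Rightarrow> ('v, 'k::field) mpoly set"
  where "mon_ideal V Q = supported (\<lambda>m. mons m \<subseteq> V \<and> Q m)"

definition up_closed :: "(('v \<Rightarrow>\<^sub>0 nat) \<Rightarrow> bool) \<Rightarrow> bool"
  where "up_closed Q \<longleftrightarrow> (\<forall>a b. Q a \<longrightarrow> Q (a + b))"

lemma mon_ideal_subset: "mon_ideal V Q \<subseteq> polys V"
  by (auto simp: mon_ideal_def polys_def elim: supported_mono)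

lemma mon_ideal_zero [simp]: "0 \<in> mon_ideal V Q"
  and mon_ideal_add: "p \<in> mon_ideal V Q \<Longrightarrow> q \<in> mon_ideal V Q \<Longrightarrow> p + q \<in> mon_ideal V Q"
  by (auto simp: mon_ideal_def intro: supported_add)

lemma mon_ideal_mult:
  "up_closed Q \<Longrightarrow> p \<in> mon_ideal V Q \<Longrightarrow> r \<in> polys V \<Longrightarrow> r * p \<in> mon_ideal V Q"
  unfolding mon_ideal_def polys_def
  by (rule supported_mult[of r "\<lambda>m. mons m \<subseteq> V" p "\<lambda>m. mons m \<subseteq> V \<and> Q m"])
    (auto simp: mons_add up_closed_def, metis add.commute)

lemma ideal_mon_ideal: "up_closed Q \<Longrightarrow> ideal (mon_ideal V Q) (poly_ring k V)"
  by (rule ideal_poly_ringI) (auto simp: mon_ideal_subset mon_ideal_add mon_ideal_mult)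

text \<open>The monomial \<open>m\<close> is divisible by a variable in \<open>D\<close>.\<close>

definition meets :: "'v set \<Rightarrow> ('v \<Rightarrow>\<^sub>0 nat) \<Rightarrow> bool"
  where "meets D m \<longleftrightarrow> mons m \<inter> D \<noteq> {}"

text \<open>The ideal of \<open>k[V]\<close> generated by the variables in \<open>D \<inter> V\<close>.\<close>

abbreviation var_ideal :: "'v set \<Rightarrow> 'v set \<Rightarrow> ('v, 'k::field) mpoly set"
  where "var_ideal V D \<equiv> mon_ideal V (meets D)"

lemma up_closed_meets: "up_closed (meets D)"
  by (auto simp: up_closed_def meets_def mons_add)

text \<open>Modulo this ideal every polynomial has a unique representative free of the variables in \<open>D\<close>, and these
  representatives form a domain.\<close>

lemma primeideal_vars:
  assumes "finite V"
  shows "primeideal (var_ideal V D :: ('v, 'k::field) mpoly set) (poly_ring k V)"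
proof (rule primeidealI)
  show "ideal (var_ideal V D :: ('v, 'k) mpoly set) (poly_ring k V)"
    by (rule ideal_mon_ideal) (rule up_closed_meets)
  show "cring (poly_ring k V)" by (rule cring_poly_ring)
  have "1 \<in> polys V" "(1 :: ('v, 'k) mpoly) \<notin> mon_ideal V (meets D)"
    by (auto simp: mon_ideal_def supported_def meets_def)
  then show "carrier (poly_ring k V) \<noteq> (var_ideal V D :: ('v, 'k) mpoly set)"
    by (auto simp: poly_ring_simps)
next
  fix a b :: "('v, 'k) mpoly"
  let ?J = "var_ideal V D :: ('v, 'k) mpoly set"
  assume ab: "a \<in> carrier (poly_ring k V)" "b \<in> carrier (poly_ring k V)" "a \<otimes>\<^bsub>poly_ring k V\<^esub> b \<in> ?J"
  let ?K = "supported (\<lambda>m. mons m \<subseteq> V \<and> \<not> meets D m) :: ('v, 'k) mpoly set"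
  obtain a1 a2 where a: "a = a1 + a2" "a1 \<in> ?J" "a2 \<in> ?K"
    using ab(1) unfolding poly_ring_simps polys_def mon_ideal_def by (rule supported_split)
  obtain b1 b2 where b: "b = b1 + b2" "b1 \<in> ?J" "b2 \<in> ?K"
    using ab(2) unfolding poly_ring_simps polys_def mon_ideal_def by (rule supported_split)
  have K: "h \<in> polys V" if "h \<in> ?K" for h
    using that unfolding polys_def by (auto elim: supported_mono)
  have mult: "r * p \<in> ?J" if "p \<in> ?J" "r \<in> polys V" for p r
    using that by (intro mon_ideal_mult up_closed_meets)
  have uminus: "- p \<in> ?J" if "p \<in> ?J" for p
    using mult[OF that, of "- 1"] by (simp add: polys_uminus)
  have "a2 * b2 = a * b + - (b * a1) + - (a2 * b1)" (is "_ = ?rhs")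
    unfolding a(1) b(1) by (simp add: algebra_simps)
  also have "?rhs \<in> ?J"
    by (rule mon_ideal_add[OF mon_ideal_add[OF _ uminus[OF mult]] uminus[OF mult]])
      (use ab a(2,3) b(2) K in \<open>simp_all add: poly_ring_simps\<close>)
  finally have "a2 * b2 \<in> supported (meets D)"
    unfolding mon_ideal_def by (rule supported_mono) auto
  moreover have "a2 * b2 \<in> supported (\<lambda>m. \<not> meets D m)"
    using a(3) b(3) by (rule supported_mult) (auto simp: meets_def mons_add)
  ultimately have "a2 * b2 = 0" by (rule supported_disjoint)
  with polys_no_zero_divisors[OF \<open>finite V\<close>, of a2 b2] a(3) b(3) K have "a2 = 0 \<or> b2 = 0" by blast
  then show "a \<in> ?J \<or> b \<in> ?J" using a(1,2) b(1,2) by (metis add.right_neutral)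
qed

text \<open>The monomial \<open>m\<close> is divisible by all variables of some edge, that is, by a generator of the edge ideal.\<close>

definition has_edge :: "'v graph \<Rightarrow> ('v \<Rightarrow>\<^sub>0 nat) \<Rightarrow> bool"
  where "has_edge G m \<longleftrightarrow> (\<exists>e \<in> edges G. e \<subseteq> mons m)"

lemma edge_in_mon_ideal:
  assumes "finite_simple_graph G" "{u, v} \<in> edges G"
  shows "mvar u * mvar v \<in> (mon_ideal (verts G) (has_edge G) :: ('v, 'k::field) mpoly set)"
proof -
  have "{u, v} \<subseteq> verts G" using assms unfolding finite_simple_graph_def by blast
  then show ?thesis
    using assms(2) unfolding mon_ideal_def mvar_eq mult_single
    by (intro supported_single) (auto simp: mons_add has_edge_def insert_commute intro!: bexI[of _ "{u, v}"])
qed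

lemma edge_ideal_eq:
  assumes "finite_simple_graph G"
  shows "(edge_ideal k G :: ('v, 'k::field) mpoly set) = mon_ideal (verts G) (has_edge G)"
proof
  interpret R: cring "poly_ring k (verts G)" by (rule cring_poly_ring)
  let ?gens = "{mvar u * mvar v | u v. {u, v} \<in> edges G} :: ('v, 'k) mpoly set"
  have sub: "?gens \<subseteq> mon_ideal (verts G) (has_edge G)"
    using edge_in_mon_ideal[OF assms] by blast
  have up: "up_closed (has_edge G)" by (auto simp: up_closed_def has_edge_def mons_add)
  show "edge_ideal k G \<subseteq> (mon_ideal (verts G) (has_edge G) :: ('v, 'k) mpoly set)"
    unfolding edge_ideal_def by (rule R.genideal_minimal[OF ideal_mon_ideal[OF up] sub])
  show "mon_ideal (verts G) (has_edge G) \<subseteq> (edge_ideal k G :: ('v, 'k) mpoly set)"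
  proof
    fix p :: "('v, 'k) mpoly" assume p: "p \<in> mon_ideal (verts G) (has_edge G)"
    have carr: "?gens \<subseteq> carrier (poly_ring k (verts G))"
      using sub mon_ideal_subset unfolding poly_ring_simps by blast
    interpret I: ideal "edge_ideal k G :: ('v, 'k) mpoly set" "poly_ring k (verts G)"
      unfolding edge_ideal_def by (rule R.genideal_ideal[OF carr])
    have gens: "?gens \<subseteq> edge_ideal k G"
      unfolding edge_ideal_def by (rule R.genideal_self[OF carr])
    have mono: "Poly_Mapping.single m c \<in> (edge_ideal k G :: ('v, 'k) mpoly set)"
      if m: "mons m \<subseteq> verts G" "has_edge G m" for m and c :: 'k
    proof -
      obtain e where e: "e \<in> edges G" "e \<subseteq> mons m" using m(2) by (auto simp: has_edge_def)
      then obtain u v where uv: "e = {u, v}" "u \<noteq> v"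
        using assms by (metis card_2_iff finite_simple_graph_def)
      have "mon1 u + (mon1 v + (m - mon1 u - mon1 v)) = m"
        using e(2) uv by (intro poly_mapping_eqI)
          (auto simp: lookup_add lookup_minus lookup_single in_keys_iff when_def)
      then have eq: "Poly_Mapping.single m c = (mvar u * mvar v) * Poly_Mapping.single (m - mon1 u - mon1 v) c"
        by (metis mult.assoc mvar_mult_single)
      have "Poly_Mapping.single (m - mon1 u - mon1 v) c \<in> polys (verts G)"
        unfolding polys_def using m(1)
        by (intro supported_single) (auto simp: in_keys_iff lookup_minus)
      then show ?thesis
        using I.I_r_closed[of "mvar u * mvar v" "Poly_Mapping.single (m - mon1 u - mon1 v) c"] gens e(1) uv
        unfolding poly_ring_simps eq by blast
    qed
    have "(\<Sum>m\<in>A. Poly_Mapping.single m (lkp p m)) \<in> (edge_ideal k G :: ('v, 'k) mpoly set)"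
      if "finite A" "A \<subseteq> mons p" for A
      using that
    proof (induction A)
      case empty
      show ?case using I.zero_closed by (simp add: poly_ring_simps)
    next
      case (insert m A)
      then have "Poly_Mapping.single m (lkp p m) \<in> (edge_ideal k G :: ('v, 'k) mpoly set)"
        using p by (intro mono) (auto simp: mon_ideal_def supported_def)
      with insert show ?case using I.a_closed by (simp add: poly_ring_simps)
    qed
    from this[of "mons p"] show "p \<in> edge_ideal k G" using poly_sum_monomials[of "mons p" p] by simp
  qed
qed

section \<open>Projective dimension of subquotients of free modules\<close>

text \<open>Elements of the free modules of all finite ranks \<open>m\<close>, as sequences that vanish from \<open>m\<close> on. Thus all
  syzygy modules live in one type, as inductions over the length of a resolution require.\<close>

type_synonym 'r vector = "nat \<Rightarrow> 'r"

definition smul :: "'r \<Rightarrow> 'r::comm_ring_1 vector \<Rightarrow> 'r vector"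
  where "smul r v = (\<lambda>i. r * v i)"

lemma smul_apply: "smul r v i = r * v i"
  by (simp add: smul_def)

text \<open>As simplification rules, these equations would also be applied to unapplied functions and turn
  every sum of vectors into an abstraction.\<close>

declare plus_fun_apply [simp del] zero_fun_apply [simp del] minus_apply [simp del] uminus_apply [simp del]

lemmas vec_apply = plus_fun_apply zero_fun_apply minus_apply uminus_apply smul_apply

lemma smul_algebra:
  "smul r (u + v) = smul r u + smul r v" "smul (r + s) v = smul r v + smul s v"
  "smul (r * s) v = smul r (smul s v)" "smul 1 v = v" "smul r 0 = 0" "smul 0 v = 0"
  "smul (- 1) v = - v" "smul r (u - v) = smul r u - smul r v"
  by (simp_all add: fun_eq_iff vec_apply algebra_simps)

lemma smul_sum: "smul r (sum f I) = (\<Sum>i\<in>I. smul r (f i))"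
  by (induction I rule: infinite_finite_induct) (simp_all add: smul_algebra)

lemma sum_fun_apply: "sum f I x = (\<Sum>i\<in>I. f i x)"
  by (induction I rule: infinite_finite_induct) (simp_all add: vec_apply)

definition unit_vec :: "nat \<Rightarrow> 'r::comm_ring_1 vector"
  where "unit_vec i = (\<lambda>j. if j = i then 1 else 0)"

text \<open>Head and tail split vectors of length \<open>m + n\<close> into their first \<open>m\<close> entries and the others.\<close>

definition vec_head :: "nat \<Rightarrow> 'r::comm_ring_1 vector \<Rightarrow> 'r vector"
  where "vec_head m w = (\<lambda>i. if i < m then w i else 0)"

definition vec_tail :: "nat \<Rightarrow> 'r::comm_ring_1 vector \<Rightarrow> 'r vector"
  where "vec_tail m w = (\<lambda>i. w (i + m))"

definition vec_join :: "nat \<Rightarrow> 'r::comm_ring_1 vector \<Rightarrow> 'r vector \<Rightarrow> 'r vector"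
  where "vec_join m u v = (\<lambda>i. if i < m then u i else v (i - m))"

lemma head_tail_linear:
  "vec_head m (u + v) = vec_head m u + vec_head m v" "vec_head m (smul r v) = smul r (vec_head m v)"
  "vec_tail m (u + v) = vec_tail m u + vec_tail m v" "vec_tail m (smul r v) = smul r (vec_tail m v)"
  by (simp_all add: fun_eq_iff vec_apply vec_head_def vec_tail_def)

text \<open>A subring given by its underlying set. The ring \<open>k[V]\<close> is used in this form, since it is not a type.\<close>

locale subring_set =
  fixes S :: "'r::comm_ring_1 set"
  assumes zero_in [simp]: "0 \<in> S" and one_in [simp]: "1 \<in> S"
    and add_in: "a \<in> S \<Longrightarrow> b \<in> S \<Longrightarrow> a + b \<in> S"
    and mult_in: "a \<in> S \<Longrightarrow> b \<in> S \<Longrightarrow> a * b \<in> S"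
    and uminus_in: "a \<in> S \<Longrightarrow> - a \<in> S"
begin

text \<open>The free module \<open>S\<^sup>m\<close>.\<close>

definition vecs :: "nat \<Rightarrow> 'r vector set"
  where "vecs m = {v. (\<forall>i<m. v i \<in> S) \<and> (\<forall>i\<ge>m. v i = 0)}"

text \<open>Submodules and linear maps, with scalars from \<open>S\<close> only.\<close>

definition submod :: "'r vector set \<Rightarrow> bool"
  where "submod A \<longleftrightarrow> 0 \<in> A \<and> (\<forall>u\<in>A. \<forall>v\<in>A. u + v \<in> A) \<and> (\<forall>r\<in>S. \<forall>u\<in>A. smul r u \<in> A)"

definition linear_on :: "'r vector set \<Rightarrow> ('r vector \<Rightarrow> 'r vector) \<Rightarrow> bool"
  where "linear_on A f \<longleftrightarrow> (\<forall>u\<in>A. \<forall>v\<in>A. f (u + v) = f u + f v) \<and> (\<forall>r\<in>S. \<forall>u\<in>A. f (smul r u) = smul r (f u))"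

lemma submodD:
  assumes "submod A"
  shows "0 \<in> A" "u \<in> A \<Longrightarrow> v \<in> A \<Longrightarrow> u + v \<in> A" "r \<in> S \<Longrightarrow> u \<in> A \<Longrightarrow> smul r u \<in> A"
    "u \<in> A \<Longrightarrow> - u \<in> A" "u \<in> A \<Longrightarrow> v \<in> A \<Longrightarrow> u - v \<in> A"
proof -
  show A: "0 \<in> A" "u \<in> A \<Longrightarrow> v \<in> A \<Longrightarrow> u + v \<in> A" "r \<in> S \<Longrightarrow> u \<in> A \<Longrightarrow> smul r u \<in> A" for u v r
    using assms by (auto simp: submod_def)
  show B: "u \<in> A \<Longrightarrow> - u \<in> A" for u
    using A(3)[of "- 1" u] by (simp add: uminus_in smul_algebra)
  show "u \<in> A \<Longrightarrow> v \<in> A \<Longrightarrow> u - v \<in> A"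
    using A(2)[of u "- v"] B by simp
qed

lemma submod_sum: "submod A \<Longrightarrow> (\<And>i. i \<in> I \<Longrightarrow> f i \<in> A) \<Longrightarrow> sum f I \<in> A"
  by (induction I rule: infinite_finite_induct) (auto simp: submodD)

lemma submod_vecs: "submod (vecs m)"
  by (auto simp: submod_def vecs_def add_in mult_in vec_apply)

lemma submod_zero: "submod {0}"
  by (auto simp: submod_def smul_algebra)

lemma linear_onD:
  assumes "linear_on A f" "submod A"
  shows "u \<in> A \<Longrightarrow> v \<in> A \<Longrightarrow> f (u + v) = f u + f v" "r \<in> S \<Longrightarrow> u \<in> A \<Longrightarrow> f (smul r u) = smul r (f u)"
    "f 0 = 0" "u \<in> A \<Longrightarrow> f (- u) = - f u" "u \<in> A \<Longrightarrow> v \<in> A \<Longrightarrow> f (u - v) = f u - f v"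
proof -
  show A: "u \<in> A \<Longrightarrow> v \<in> A \<Longrightarrow> f (u + v) = f u + f v" "r \<in> S \<Longrightarrow> u \<in> A \<Longrightarrow> f (smul r u) = smul r (f u)" for u v r
    using assms(1) by (auto simp: linear_on_def)
  show "f 0 = 0" using A(2)[of 0 0] submodD(1)[OF assms(2)] by (simp add: smul_algebra)
  show B: "u \<in> A \<Longrightarrow> f (- u) = - f u" for u using A(2)[of "- 1" u] by (simp add: uminus_in smul_algebra)
  show "u \<in> A \<Longrightarrow> v \<in> A \<Longrightarrow> f (u - v) = f u - f v"
    using A(1)[of u "- v"] B[of v] submodD(4)[OF assms(2), of v] by simp
qed

lemma linear_on_sum:
  assumes "linear_on A f" "submod A" "\<And>i. i \<in> I \<Longrightarrow> g i \<in> A"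
  shows "f (sum g I) = (\<Sum>i\<in>I. f (g i))"
  using assms(3)
proof (induction I rule: infinite_finite_induct)
  case (insert i I)
  have "f (g i + sum g I) = f (g i) + f (sum g I)"
    using insert by (intro linear_onD(1)[OF assms(1,2)] submod_sum[OF assms(2)]) auto
  with insert show ?case by simp
qed (simp_all add: linear_onD(3)[OF assms(1,2)])

lemma linear_on_subset: "linear_on A f \<Longrightarrow> B \<subseteq> A \<Longrightarrow> linear_on B f"
  unfolding linear_on_def by blast

lemma submod_vimage:
  assumes "linear_on A f" "submod A" "submod B" shows "submod {v \<in> A. f v \<in> B}"
  using assms(2,3) linear_onD(1,2,3)[OF assms(1,2)] by (auto simp: submod_def)

lemma vec_eq_sum:
  assumes "v \<in> vecs m" shows "v = (\<Sum>i<m. smul (v i) (unit_vec i))"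
proof
  fix j
  have "(\<Sum>i<m. smul (v i) (unit_vec i)) j = (\<Sum>i<m. if i = j then v i else 0)"
    unfolding sum_fun_apply by (rule sum.cong) (auto simp: unit_vec_def vec_apply)
  also have "\<dots> = v j" using assms by (simp add: vecs_def)
  finally show "v j = (\<Sum>i<m. smul (v i) (unit_vec i)) j" by simp
qed

lemma vecs_coeff: "v \<in> vecs m \<Longrightarrow> i < m \<Longrightarrow> v i \<in> S"
  by (simp add: vecs_def)

lemma unit_vec_in: "i < m \<Longrightarrow> unit_vec i \<in> vecs m"
  by (auto simp: unit_vec_def vecs_def)

lemma linear_on_vecs_eq:
  assumes "linear_on (vecs m) f" "v \<in> vecs m"
  shows "f v = (\<Sum>i<m. smul (v i) (f (unit_vec i)))"
proof -
  have "f v = f (\<Sum>i<m. smul (v i) (unit_vec i))" using vec_eq_sum[OF assms(2)] by metis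
  also have "\<dots> = (\<Sum>i<m. f (smul (v i) (unit_vec i)))"
    using assms(2) unit_vec_in
    by (intro linear_on_sum[OF assms(1)] submod_vecs submodD(3)[OF submod_vecs]) (auto simp: vecs_coeff)
  also have "\<dots> = (\<Sum>i<m. smul (v i) (f (unit_vec i)))"
    using assms by (intro sum.cong linear_onD(2)[OF assms(1) submod_vecs]) (auto simp: unit_vec_in vecs_coeff)
  finally show ?thesis .
qed

text \<open>\<open>pd_less n A B\<close> says that \<open>A / (A \<inter> B)\<close> has a resolution by free modules of finite rank
  with at most \<open>n\<close> terms, so that its projective dimension is less than \<open>n\<close>. A submodule stands for
  its quotient by \<open>0\<close>, and \<open>n = 0\<close> means that the module vanishes. Here \<open>f\<close> is a surjection from
  a free module onto \<open>A\<close> modulo \<open>B\<close>.\<close>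

primrec pd_less :: "nat \<Rightarrow> 'r vector set \<Rightarrow> 'r vector set \<Rightarrow> bool" where
  "pd_less 0 A B \<longleftrightarrow> A \<subseteq> B"
| "pd_less (Suc n) A B \<longleftrightarrow> (\<exists>m f. linear_on (vecs m) f \<and> f ` vecs m \<subseteq> A \<and>
     (\<forall>a\<in>A. \<exists>v\<in>vecs m. a - f v \<in> B) \<and> pd_less n {v \<in> vecs m. f v \<in> B} {0})"

lemma vecs_0: "vecs 0 = {0}"
  by (auto simp: vecs_def fun_eq_iff vec_apply)

lemma pd_less_Suc: "submod A \<Longrightarrow> submod B \<Longrightarrow> pd_less n A B \<Longrightarrow> pd_less (Suc n) A B"
proof (induction n arbitrary: A B)
  case 0
  then show ?case
    by (auto simp: vecs_0 linear_on_def smul_algebra submodD intro!: exI[of _ 0] exI[of _ "\<lambda>_. 0"])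
next
  case (Suc n)
  then obtain m f where f: "linear_on (vecs m) f" "f ` vecs m \<subseteq> A" "\<forall>a\<in>A. \<exists>v\<in>vecs m. a - f v \<in> B"
    "pd_less n {v \<in> vecs m. f v \<in> B} {0}" by auto
  from Suc.IH[OF submod_vimage[OF f(1) submod_vecs Suc.prems(2)] submod_zero f(4)] f
  show ?case unfolding pd_less.simps(2)[of "Suc n" A B] by blast
qed

text \<open>Isomorphic subquotients: \<open>g\<close> induces a bijection from \<open>A / (A \<inter> B)\<close> to \<open>A2 / (A2 \<inter> B2)\<close>.\<close>

lemma pd_less_transport:
  assumes "submod A" "submod A2" "submod B2" "linear_on A g" "g ` A \<subseteq> A2"
    and "\<And>a. a \<in> A \<Longrightarrow> g a \<in> B2 \<longleftrightarrow> a \<in> B" "\<And>a. a \<in> A2 \<Longrightarrow> \<exists>b\<in>A. a - g b \<in> B2"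
    and "pd_less n A B"
  shows "pd_less n A2 B2"
proof (cases n)
  case 0
  have "a \<in> B2" if a: "a \<in> A2" for a
  proof -
    obtain b where b: "b \<in> A" "a - g b \<in> B2" using assms(7) a by blast
    then have "g b \<in> B2" using assms(6,8) 0 by auto
    with submodD(2)[OF assms(3) b(2)] have "a - g b + g b \<in> B2" by blast
    then show ?thesis by simp
  qed
  then show ?thesis using 0 by auto
next
  case (Suc k)
  then obtain m f where f: "linear_on (vecs m) f" "f ` vecs m \<subseteq> A" "\<forall>a\<in>A. \<exists>v\<in>vecs m. a - f v \<in> B"
    "pd_less k {v \<in> vecs m. f v \<in> B} {0}" using assms(8) by auto
  show ?thesis unfolding Suc pd_less.simps
  proof (intro exI conjI)
    show "linear_on (vecs m) (\<lambda>v. g (f v))"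
      using f(1,2) assms(4) by (auto simp: linear_on_def image_subset_iff)
    show "(\<lambda>v. g (f v)) ` vecs m \<subseteq> A2" using f(2) assms(5) by blast
    have "{v \<in> vecs m. g (f v) \<in> B2} = {v \<in> vecs m. f v \<in> B}" using f(2) assms(6) by auto
    then show "pd_less k {v \<in> vecs m. g (f v) \<in> B2} {0}" using f(4) by simp
    show "\<forall>a\<in>A2. \<exists>v\<in>vecs m. a - g (f v) \<in> B2"
    proof
      fix a assume "a \<in> A2"
      then obtain b where b: "b \<in> A" "a - g b \<in> B2" using assms(7) by blast
      then obtain v where v: "v \<in> vecs m" "b - f v \<in> B" using f(3) by blast
      have fv: "f v \<in> A" using f(2) v by auto
      have "g (b - f v) \<in> B2" using v b fv assms(6) submodD(5)[OF assms(1)] by simp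
      then have "g b - g (f v) \<in> B2" using linear_onD(5)[OF assms(4,1) b(1) fv] by simp
      then have "(a - g b) + (g b - g (f v)) \<in> B2" by (rule submodD(2)[OF assms(3) b(2)])
      then show "\<exists>v\<in>vecs m. a - g (f v) \<in> B2" using v by auto
    qed
  qed
qed

text \<open>The horseshoe lemma, for the exact sequence \<open>0 \<rightarrow> A1 / B \<rightarrow> A / B \<rightarrow> A2 / (A2 \<inter> B2) \<rightarrow> 0\<close> in which the
  second map is induced by \<open>p\<close> and \<open>A1\<close> is the preimage of \<open>B2\<close>. Covers of the outer modules
  combine to a cover of the middle one, and the three kernels form a sequence of the same kind.\<close>

lemma pd_less_extension:
  assumes "submod A" "submod B" "submod A2" "submod B2" "B \<subseteq> A"
    and "linear_on A p" "p ` A \<subseteq> A2" "p ` B \<subseteq> B2" "\<And>a. a \<in> A2 \<Longrightarrow> \<exists>b\<in>A. a - p b \<in> B2"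
    and "pd_less n {a \<in> A. p a \<in> B2} B" "pd_less n A2 B2"
  shows "pd_less n A B"
  using assms
proof (induction n arbitrary: A B A2 B2 p)
  case 0
  have "a \<in> B" if "a \<in> A" for a
    using 0(7,10,11) that unfolding pd_less.simps by blast
  then show ?case by auto
next
  case (Suc n)
  note prems = Suc.prems
  let ?A1 = "{a \<in> A. p a \<in> B2}"
  obtain m1 f1 where f1: "linear_on (vecs m1) f1" "f1 ` vecs m1 \<subseteq> ?A1"
      "\<forall>a\<in>?A1. \<exists>v\<in>vecs m1. a - f1 v \<in> B" "pd_less n {v \<in> vecs m1. f1 v \<in> B} {0}"
    using prems(10) by auto
  obtain m2 f2 where f2: "linear_on (vecs m2) f2" "f2 ` vecs m2 \<subseteq> A2"
      "\<forall>a\<in>A2. \<exists>v\<in>vecs m2. a - f2 v \<in> B2" "pd_less n {v \<in> vecs m2. f2 v \<in> B2} {0}"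
    using prems(11) by auto
  \<comment> \<open>a lift \<open>h\<close> of \<open>f2\<close> through \<open>p\<close>\<close>
  have "\<forall>i. \<exists>c. i < m2 \<longrightarrow> c \<in> A \<and> f2 (unit_vec i) - p c \<in> B2"
  proof
    fix i
    show "\<exists>c. i < m2 \<longrightarrow> c \<in> A \<and> f2 (unit_vec i) - p c \<in> B2"
      using prems(9)[of "f2 (unit_vec i)"] f2(2) unit_vec_in[of i m2] by blast
  qed
  then obtain c where c: "\<And>i. i < m2 \<Longrightarrow> c i \<in> A \<and> f2 (unit_vec i) - p (c i) \<in> B2" by metis
  define h where "h v = (\<Sum>i<m2. smul (v i) (c i))" for v
  have h_A: "h v \<in> A" if "v \<in> vecs m2" for v
    unfolding h_def using that c by (intro submod_sum submodD(3) prems(1)) (auto simp: vecs_def)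
  have h_add: "h (u + v) = h u + h v" and h_smul: "h (smul r v) = smul r (h v)" for u v r
    unfolding h_def by (simp_all add: vec_apply smul_algebra sum.distrib smul_sum)
  have h_lift: "f2 v - p (h v) \<in> B2" if v: "v \<in> vecs m2" for v
  proof -
    have "p (h v) = (\<Sum>i<m2. p (smul (v i) (c i)))"
      unfolding h_def using v c
      by (intro linear_on_sum[OF prems(6,1)] submodD(3) prems(1)) (auto simp: vecs_def)
    also have "\<dots> = (\<Sum>i<m2. smul (v i) (p (c i)))"
      using v c by (intro sum.cong linear_onD(2)[OF prems(6,1)]) (auto simp: vecs_def)
    finally have "f2 v - p (h v) = (\<Sum>i<m2. smul (v i) (f2 (unit_vec i) - p (c i)))"
      unfolding linear_on_vecs_eq[OF f2(1) v] by (simp add: smul_algebra sum_subtractf)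
    also have "\<dots> \<in> B2"
      using v c by (intro submod_sum submodD(3) prems(4)) (auto simp: vecs_def)
    finally show ?thesis .
  qed
  define f where "f w = f1 (vec_head m1 w) + h (vec_tail m1 w)" for w
  have ht: "vec_head m1 w \<in> vecs m1" "vec_tail m1 w \<in> vecs m2" if "w \<in> vecs (m1 + m2)" for w
    using that by (auto simp: vecs_def vec_head_def vec_tail_def)
  have join: "vec_join m1 u v \<in> vecs (m1 + m2)" "vec_head m1 (vec_join m1 u v) = u"
    "vec_tail m1 (vec_join m1 u v) = v" if "u \<in> vecs m1" "v \<in> vecs m2" for u v
    using that by (auto simp: vecs_def vec_head_def vec_tail_def vec_join_def fun_eq_iff)
  have f1_A: "f1 v \<in> A" "p (f1 v) \<in> B2" if "v \<in> vecs m1" for v using f1(2) that by auto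
  have lin: "linear_on (vecs (m1 + m2)) f"
    unfolding linear_on_def f_def head_tail_linear h_add h_smul
    using linear_onD(1,2)[OF f1(1) submod_vecs] ht by (auto simp: smul_algebra algebra_simps)
  have f_A: "f ` vecs (m1 + m2) \<subseteq> A"
    unfolding f_def using ht f1_A h_A submodD(2)[OF prems(1)] by blast
  let ?K = "{w \<in> vecs (m1 + m2). f w \<in> B}" and ?K2 = "{v \<in> vecs m2. f2 v \<in> B2}"
  have surj: "\<exists>w\<in>vecs (m1 + m2). vec_tail m1 w = v \<and> a - f w \<in> B"
    if a: "a \<in> A" "v \<in> vecs m2" "p a - f2 v \<in> B2" for a v
  proof -
    have "p (a - h v) = p a - p (h v)" using a h_A by (intro linear_onD(5)[OF prems(6,1)])
    also have "\<dots> = (p a - f2 v) + (f2 v - p (h v))" by simp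
    also have "\<dots> \<in> B2" by (rule submodD(2)[OF prems(4) a(3) h_lift[OF a(2)]])
    finally have "a - h v \<in> ?A1" using a h_A submodD(5)[OF prems(1)] by auto
    then obtain u where u: "u \<in> vecs m1" "a - h v - f1 u \<in> B" using f1(3) by blast
    then have "a - f (vec_join m1 u v) \<in> B"
      unfolding f_def using join[OF u(1) a(2)] by (simp add: algebra_simps)
    then show ?thesis using join[OF u(1) a(2)] by blast
  qed
  have "pd_less n ?K {0}"
  proof (rule Suc.IH[where p = "vec_tail m1" and ?A2.0 = ?K2 and ?B2.0 = "{0}"])
    show "submod ?K" "submod ?K2"
      by (intro submod_vimage lin f2(1) submod_vecs prems(2,4))+
    show "submod {0}" "submod {0}" by (rule submod_zero)+
    show "{0} \<subseteq> ?K"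
      using submodD(1)[OF submod_vecs] linear_onD(3)[OF lin submod_vecs] submodD(1)[OF prems(2)] by auto
    show "linear_on ?K (vec_tail m1)" by (simp add: linear_on_def head_tail_linear)
    show "vec_tail m1 ` {0} \<subseteq> {0}" by (auto simp: vec_tail_def fun_eq_iff vec_apply)
    show "vec_tail m1 ` ?K \<subseteq> ?K2"
    proof clarify
      fix w assume w: "w \<in> vecs (m1 + m2)" "f w \<in> B"
      let ?u = "vec_head m1 w" and ?v = "vec_tail m1 w"
      have "p (f w) = p (f1 ?u) + p (h ?v)"
        unfolding f_def using ht[OF w(1)] f1_A h_A by (intro linear_onD(1)[OF prems(6,1)])
      moreover have "p (f w) \<in> B2" using w(2) prems(8) by auto
      ultimately have "p (f w) - p (f1 ?u) + (f2 ?v - p (h ?v)) \<in> B2"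
        using submodD(2)[OF prems(4) submodD(5)[OF prems(4) _ f1_A(2)] h_lift] ht[OF w(1)] by blast
      then have "f2 ?v \<in> B2" using \<open>p (f w) = p (f1 ?u) + p (h ?v)\<close> by simp
      then show "?v \<in> vecs m2 \<and> f2 ?v \<in> B2" using ht[OF w(1)] by simp
    qed
    show "\<exists>b\<in>?K. a - vec_tail m1 b \<in> {0}" if a: "a \<in> ?K2" for a
    proof -
      have "p 0 - f2 a \<in> B2"
        using a linear_onD(3)[OF prems(6,1)] submodD(4)[OF prems(4)] by auto
      then obtain w where w: "w \<in> vecs (m1 + m2)" "vec_tail m1 w = a" "0 - f w \<in> B"
        using surj[of 0 a] a submodD(1)[OF prems(1)] by blast
      then have "f w \<in> B" using submodD(4)[OF prems(2), of "- f w"] by simp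
      with w show ?thesis by auto
    qed
    have "{a \<in> ?K. vec_tail m1 a \<in> {0}} = {v \<in> vecs m1. f1 v \<in> B}"
    proof (intro equalityI subsetI)
      fix w assume w: "w \<in> {a \<in> ?K. vec_tail m1 a \<in> {0}}"
      then have "w i = 0" if "i \<ge> m1" for i
        using that by (auto simp: vec_tail_def fun_eq_iff vec_apply le_iff_add add.commute)
      then have "vec_head m1 w = w" by (auto simp: vec_head_def fun_eq_iff)
      then show "w \<in> {v \<in> vecs m1. f1 v \<in> B}"
        using w ht(1)[of w] by (auto simp: f_def h_def smul_algebra vec_apply)
    next
      fix w assume w: "w \<in> {v \<in> vecs m1. f1 v \<in> B}"
      then have "vec_head m1 w = w" "vec_tail m1 w = 0"
        by (auto simp: vecs_def vec_head_def vec_tail_def fun_eq_iff vec_apply)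
      moreover have "w \<in> vecs (m1 + m2)"
        using w unfolding vecs_def by auto (metis not_le zero_in)
      ultimately show "w \<in> {a \<in> ?K. vec_tail m1 a \<in> {0}}"
        using w by (auto simp: f_def h_def smul_algebra vec_apply)
    qed
    then show "pd_less n {a \<in> ?K. vec_tail m1 a \<in> {0}} {0}" using f1(4) by simp
    show "pd_less n ?K2 {0}" by (rule f2(4))
  qed
  moreover have "\<exists>w\<in>vecs (m1 + m2). a - f w \<in> B" if a: "a \<in> A" for a
    using surj[OF a] f2(3) prems(7) a by blast
  ultimately show ?case unfolding pd_less.simps using lin f_A by blast
qed

text \<open>For \<open>0 \<rightarrow> A1 / B \<rightarrow> A / B \<rightarrow> A / A1 \<rightarrow> 0\<close>: the kernel of a cover of \<open>A / A1\<close> by a cover of \<open>A / B\<close> is an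
  extension of \<open>A1 / B\<close> by the kernel for \<open>A / B\<close>.\<close>

lemma pd_less_quotient:
  assumes "submod A" "submod A1" "submod B" "B \<subseteq> A1" "A1 \<subseteq> A"
    and "pd_less n A1 B" "pd_less (Suc n) A B"
  shows "pd_less (Suc n) A A1"
proof -
  obtain m f where f: "linear_on (vecs m) f" "f ` vecs m \<subseteq> A" "\<forall>a\<in>A. \<exists>v\<in>vecs m. a - f v \<in> B"
    "pd_less n {v \<in> vecs m. f v \<in> B} {0}" using assms(7) by auto
  let ?L = "{v \<in> vecs m. f v \<in> A1}"
  have "pd_less n ?L {0}"
  proof (rule pd_less_extension[where p = f and ?A2.0 = A1 and ?B2.0 = B])
    show "submod ?L" by (rule submod_vimage[OF f(1) submod_vecs assms(2)])
    show "submod {0}" by (rule submod_zero)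
    show "{0} \<subseteq> ?L" "f ` {0} \<subseteq> B"
      using submodD(1)[OF submod_vecs] linear_onD(3)[OF f(1) submod_vecs] submodD(1) assms(2,3) by auto
    show "linear_on ?L f" using f(1) by (rule linear_on_subset) auto
    have "{a \<in> ?L. f a \<in> B} = {v \<in> vecs m. f v \<in> B}" using assms(4) by auto
    then show "pd_less n {a \<in> ?L. f a \<in> B} {0}" using f(4) by simp
    show "\<exists>b\<in>?L. a - f b \<in> B" if a: "a \<in> A1" for a
    proof -
      obtain v where v: "v \<in> vecs m" "a - f v \<in> B" using f(3) a assms(5) by blast
      then have "a - f v \<in> A1" using assms(4) by blast
      then have "a - (a - f v) \<in> A1" by (rule submodD(5)[OF assms(2) a])
      moreover have "a - (a - f v) = f v" by simp
      ultimately have "f v \<in> A1" by metis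
      then show ?thesis using v by blast
    qed
  qed (use assms in auto)
  moreover have "\<forall>a\<in>A. \<exists>v\<in>vecs m. a - f v \<in> A1" using f(3) assms(4) by blast
  ultimately show ?thesis unfolding pd_less.simps by (intro exI[of _ m] exI[of _ f] conjI f(1,2))
qed

text \<open>Ideals of \<open>S\<close>; the copy of \<open>J\<close> inside the free module of rank one is \<open>vec1 J\<close> below.\<close>

definition ideal_set :: "'r set \<Rightarrow> bool"
  where "ideal_set J \<longleftrightarrow> J \<subseteq> S \<and> 0 \<in> J \<and> (\<forall>a\<in>J. \<forall>b\<in>J. a + b \<in> J) \<and> (\<forall>r\<in>S. \<forall>a\<in>J. r * a \<in> J)"

definition vec1 :: "'r set \<Rightarrow> 'r vector set"
  where "vec1 J = {v. v 0 \<in> J \<and> (\<forall>i>0. v i = 0)}"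

lemma vec1_S: "vec1 S = vecs 1"
  by (auto simp: vec1_def vecs_def)

lemma submod_vec1: "ideal_set J \<Longrightarrow> submod (vec1 J)"
  by (auto simp: submod_def vec1_def ideal_set_def vec_apply)

lemma ideal_set_S: "ideal_set S"
  by (auto simp: ideal_set_def add_in mult_in)

text \<open>Multiplication by \<open>x\<close> induces an isomorphism \<open>S / (J : x) \<cong> (J + (x)) / J\<close>; here \<open>J2\<close> is \<open>J + (x)\<close>.\<close>

lemma smul_vec1_transport:
  assumes "ideal_set J" "ideal_set J2" "J \<subseteq> J2" "x \<in> J2"
    and "\<And>a. a \<in> J2 \<Longrightarrow> \<exists>s\<in>S. a - x * s \<in> J" "pd_less n (vec1 S) (vec1 {s \<in> S. x * s \<in> J})"
  shows "pd_less n (vec1 J2) (vec1 J)"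
proof (rule pd_less_transport[where g = "smul x"])
  show "submod (vec1 S)" "submod (vec1 J2)" "submod (vec1 J)"
    using assms by (auto intro: submod_vec1 ideal_set_S)
  show "linear_on (vec1 S) (smul x)"
    by (auto simp: linear_on_def smul_algebra(1)) (auto simp: fun_eq_iff vec_apply)
  show "smul x ` vec1 S \<subseteq> vec1 J2"
    using assms(2,4) by (auto simp: vec1_def ideal_set_def mult.commute[of x] vec_apply)
  show "\<exists>b\<in>vec1 S. a - smul x b \<in> vec1 J" if "a \<in> vec1 J2" for a
  proof -
    have "a 0 \<in> J2" using that by (simp add: vec1_def)
    then obtain s where "s \<in> S" "a 0 - x * s \<in> J" using assms(5) by blast
    then show ?thesis using that
      by (intro bexI[of _ "\<lambda>i. if i = 0 then s else 0"]) (auto simp: vec1_def vec_apply)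
  qed
qed (use assms in \<open>auto simp: vec1_def vec_apply\<close>)

lemma vec1_mono: "I \<subseteq> J \<Longrightarrow> vec1 I \<subseteq> vec1 J"
  by (auto simp: vec1_def)

text \<open>The two consequences of the exact sequence \<open>0 \<rightarrow> S / (J : x) \<rightarrow> S / J \<rightarrow> S / (J + (x)) \<rightarrow> 0\<close> that are used:
  a bound for the middle term, and a bound for the last one.\<close>

lemma pd_less_colon:
  assumes "ideal_set J" "ideal_set J2" "J \<subseteq> J2" "x \<in> J2"
    and "\<And>a. a \<in> J2 \<Longrightarrow> \<exists>s\<in>S. a - x * s \<in> J"
    and "pd_less n (vec1 S) (vec1 {s \<in> S. x * s \<in> J})" "pd_less n (vec1 S) (vec1 J2)"
  shows "pd_less n (vec1 S) (vec1 J)"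
proof (rule pd_less_extension[where p = "\<lambda>v. v" and ?A2.0 = "vec1 S" and ?B2.0 = "vec1 J2"])
  have "J2 \<subseteq> S" using assms(2) by (simp add: ideal_set_def)
  then have "{a \<in> vec1 S. a \<in> vec1 J2} = vec1 J2" using vec1_mono by auto
  then show "pd_less n {a \<in> vec1 S. a \<in> vec1 J2} (vec1 J)"
    using smul_vec1_transport[OF assms(1-6)] by simp
  show "vec1 J \<subseteq> vec1 S" using assms(1) by (intro vec1_mono) (simp add: ideal_set_def)
  show "(\<lambda>v. v) ` vec1 J \<subseteq> vec1 J2" using vec1_mono[OF assms(3)] by simp
  show "\<exists>b\<in>vec1 S. a - b \<in> vec1 J2" if "a \<in> vec1 S" for a
    using that assms(2) by (intro bexI[of _ a]) (auto simp: vec1_def ideal_set_def vec_apply)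
qed (use assms in \<open>auto simp: linear_on_def intro: submod_vec1 ideal_set_S\<close>)

lemma pd_less_adjoin:
  assumes "ideal_set J" "ideal_set J2" "J \<subseteq> J2" "x \<in> J2"
    and "\<And>a. a \<in> J2 \<Longrightarrow> \<exists>s\<in>S. a - x * s \<in> J"
    and "pd_less n (vec1 S) (vec1 {s \<in> S. x * s \<in> J})" "pd_less (Suc n) (vec1 S) (vec1 J)"
  shows "pd_less (Suc n) (vec1 S) (vec1 J2)"
proof (rule pd_less_quotient[of _ _ "vec1 J"])
  show "vec1 J2 \<subseteq> vec1 S" using assms(2) by (intro vec1_mono) (simp add: ideal_set_def)
qed (use assms smul_vec1_transport[OF assms(1-6)] vec1_mono submod_vec1 ideal_set_S in auto)

lemma pd_less_free: "pd_less (Suc 0) (vec1 S) (vec1 {0})"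
  unfolding pd_less.simps
proof (intro exI conjI)
  show "linear_on (vecs 1) (\<lambda>v. v)" by (simp add: linear_on_def)
  show "(\<lambda>v. v) ` vecs 1 \<subseteq> vec1 S" by (simp add: vec1_S)
  show "\<forall>a\<in>vec1 S. \<exists>v\<in>vecs 1. a - v \<in> vec1 {0}"
    unfolding vec1_S by (intro ballI bexI) (auto simp: vec1_def vec_apply)
  show "{v \<in> vecs 1. v \<in> vec1 {0}} \<subseteq> {0}"
    by (auto simp: vec1_def fun_eq_iff vec_apply) (metis neq0_conv)
qed

end

section \<open>Koszul cochains\<close>

text \<open>The differential of the Koszul cochain complex of \<open>y 0, \<dots>, y (k - 1)\<close> with coefficients in \<open>N\<close>. A
  cochain assigns a value to each subset \<open>T\<close> of \<open>{0, \<dots>, k - 1}\<close>, all degrees \<open>card T\<close> together, and the values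
  elsewhere are irrelevant. The recursion presents the complex as the mapping cone of \<open>y k\<close>, so that
  no signs have to be computed.\<close>

fun koszul :: "('r, 'n, 'l) module_scheme \<Rightarrow> (nat \<Rightarrow> 'r) \<Rightarrow> nat \<Rightarrow> (nat set \<Rightarrow> 'n) \<Rightarrow> nat set \<Rightarrow> 'n" where
  "koszul N y 0 a T = \<zero>\<^bsub>N\<^esub>"
| "koszul N y (Suc k) a T =
    (if k \<in> T then (y k \<odot>\<^bsub>N\<^esub> a (T - {k})) \<ominus>\<^bsub>N\<^esub> koszul N y k (\<lambda>U. a (insert k U)) (T - {k})
     else koszul N y k a T)"

lemma koszul_cong: "(\<And>U. U \<subseteq> T \<Longrightarrow> a U = b U) \<Longrightarrow> koszul N y k a T = koszul N y k b T"
proof (induction k arbitrary: a b T)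
  case (Suc k)
  show ?case
  proof (cases "k \<in> T")
    case True
    have "koszul N y k (\<lambda>U. a (insert k U)) (T - {k}) = koszul N y k (\<lambda>U. b (insert k U)) (T - {k})"
      using True by (intro Suc.IH Suc.prems) auto
    then show ?thesis using True Suc.prems[of "T - {k}"] by simp
  next
    case False
    have "koszul N y k a T = koszul N y k b T" by (rule Suc.IH) (rule Suc.prems)
    with False show ?thesis by simp
  qed
qed simp

lemma mod_hom_add: "f \<in> mod_hom R M N \<Longrightarrow> x \<in> carrier M \<Longrightarrow> y \<in> carrier M \<Longrightarrow> f (x \<oplus>\<^bsub>M\<^esub> y) = f x \<oplus>\<^bsub>N\<^esub> f y"
  and mod_hom_smult: "f \<in> mod_hom R M N \<Longrightarrow> r \<in> carrier R \<Longrightarrow> x \<in> carrier M \<Longrightarrow> f (r \<odot>\<^bsub>M\<^esub> x) = r \<odot>\<^bsub>N\<^esub> f x"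
  and mod_hom_closed: "f \<in> mod_hom R M N \<Longrightarrow> x \<in> carrier M \<Longrightarrow> f x \<in> carrier N"
  by (auto simp: mod_hom_def)

lemma mod_hom_zero:
  assumes "Module.module R M" "Module.module R N" "f \<in> mod_hom R M N"
  shows "f \<zero>\<^bsub>M\<^esub> = \<zero>\<^bsub>N\<^esub>"
proof -
  interpret M: Module.module R M by fact
  interpret N: Module.module R N by fact
  have "f \<zero>\<^bsub>M\<^esub> = f (\<zero>\<^bsub>R\<^esub> \<odot>\<^bsub>M\<^esub> \<zero>\<^bsub>M\<^esub>)" by simp
  also have "\<dots> = \<zero>\<^bsub>R\<^esub> \<odot>\<^bsub>N\<^esub> f \<zero>\<^bsub>M\<^esub>"
    using assms(3) by (rule mod_hom_smult) auto
  also have "\<dots> = \<zero>\<^bsub>N\<^esub>" using mod_hom_closed[OF assms(3)] by simp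
  finally show ?thesis .
qed

lemma mod_hom_minus:
  assumes "Module.module R M" "Module.module R N" "f \<in> mod_hom R M N" "x \<in> carrier M" "y \<in> carrier M"
  shows "f (x \<ominus>\<^bsub>M\<^esub> y) = f x \<ominus>\<^bsub>N\<^esub> f y"
proof -
  interpret M: Module.module R M by fact
  interpret N: Module.module R N by fact
  have "f (x \<ominus>\<^bsub>M\<^esub> y) \<oplus>\<^bsub>N\<^esub> f y = f (x \<ominus>\<^bsub>M\<^esub> y \<oplus>\<^bsub>M\<^esub> y)"
    using assms by (intro mod_hom_add[symmetric]) auto
  also have "x \<ominus>\<^bsub>M\<^esub> y \<oplus>\<^bsub>M\<^esub> y = x"
    using assms by (simp add: a_minus_def M.a_assoc M.l_neg)
  finally have "f x \<ominus>\<^bsub>N\<^esub> f y = f (x \<ominus>\<^bsub>M\<^esub> y) \<oplus>\<^bsub>N\<^esub> f y \<ominus>\<^bsub>N\<^esub> f y" by simp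
  also have "\<dots> = f (x \<ominus>\<^bsub>M\<^esub> y)"
    using mod_hom_closed[OF assms(3)] assms(4,5) by (simp add: a_minus_def N.a_assoc N.r_neg)
  finally show ?thesis by simp
qed

context Module.module
begin

lemma zero_minus_zero [simp]: "\<zero>\<^bsub>M\<^esub> \<ominus>\<^bsub>M\<^esub> \<zero>\<^bsub>M\<^esub> = \<zero>\<^bsub>M\<^esub>"
  by (simp add: a_minus_def M.r_neg)

lemma minus_zero_right [simp]: "x \<in> carrier M \<Longrightarrow> x \<ominus>\<^bsub>M\<^esub> \<zero>\<^bsub>M\<^esub> = x"
  using M.minus_equality[of "\<zero>\<^bsub>M\<^esub>" "\<zero>\<^bsub>M\<^esub>"] by (simp add: a_minus_def)

lemma minus_self [simp]: "x \<in> carrier M \<Longrightarrow> x \<ominus>\<^bsub>M\<^esub> x = \<zero>\<^bsub>M\<^esub>"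
  by (simp add: a_minus_def M.r_neg)

lemma minus_eq_zeroD:
  assumes "x \<in> carrier M" "z \<in> carrier M" "x \<ominus>\<^bsub>M\<^esub> z = \<zero>\<^bsub>M\<^esub>" shows "x = z"
proof -
  have "x = (x \<ominus>\<^bsub>M\<^esub> z) \<oplus>\<^bsub>M\<^esub> z" using assms(1,2) by (simp add: a_minus_def M.a_assoc M.l_neg)
  then show ?thesis using assms by simp
qed

lemma koszul_closed:
  "(\<And>i. y i \<in> carrier R) \<Longrightarrow> (\<And>T. a T \<in> carrier M) \<Longrightarrow> koszul M y k a T \<in> carrier M"
  by (induction k arbitrary: a T) auto

lemma minus_minus_add:
  "a \<in> carrier M \<Longrightarrow> b \<in> carrier M \<Longrightarrow> c \<in> carrier M \<Longrightarrow> d \<in> carrier M \<Longrightarrow>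
    (a \<ominus>\<^bsub>M\<^esub> b) \<ominus>\<^bsub>M\<^esub> (c \<ominus>\<^bsub>M\<^esub> d) = (a \<ominus>\<^bsub>M\<^esub> c) \<ominus>\<^bsub>M\<^esub> (b \<ominus>\<^bsub>M\<^esub> d)"
  by (simp add: a_minus_def M.minus_add M.a_ac)

lemma smult_minus: "r \<in> carrier R \<Longrightarrow> a \<in> carrier M \<Longrightarrow> b \<in> carrier M \<Longrightarrow>
    r \<odot>\<^bsub>M\<^esub> (a \<ominus>\<^bsub>M\<^esub> b) = r \<odot>\<^bsub>M\<^esub> a \<ominus>\<^bsub>M\<^esub> r \<odot>\<^bsub>M\<^esub> b"
  by (simp add: a_minus_def smult_r_distr smult_r_minus)

lemma koszul_minus:
  assumes "\<And>i. y i \<in> carrier R" "\<And>T. a T \<in> carrier M" "\<And>T. b T \<in> carrier M"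
  shows "koszul M y k (\<lambda>T. a T \<ominus>\<^bsub>M\<^esub> b T) T = koszul M y k a T \<ominus>\<^bsub>M\<^esub> koszul M y k b T"
  using assms(2,3)
proof (induction k arbitrary: a b T)
  case 0
  show ?case by simp
next
  case (Suc k)
  show ?case
    using Suc.IH[of "\<lambda>U. a (insert k U)" "\<lambda>U. b (insert k U)" "T - {k}"] Suc.IH[of a b T] Suc.prems assms(1)
    by (auto simp: smult_minus koszul_closed intro!: minus_minus_add)
qed

text \<open>The differential commutes with additive maps that commute with \<open>y 0, \<dots>, y (k - 1)\<close>; the other scalars do
  not matter.\<close>

lemma koszul_map:
  assumes "\<And>T. a T \<in> carrier M" "Module.module R N" "\<And>i. y i \<in> carrier R"
    and "\<And>x. x \<in> carrier M \<Longrightarrow> f x \<in> carrier N"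
    and "\<And>x z. x \<in> carrier M \<Longrightarrow> z \<in> carrier M \<Longrightarrow> f (x \<ominus>\<^bsub>M\<^esub> z) = f x \<ominus>\<^bsub>N\<^esub> f z"
    and "\<And>i x. i < k \<Longrightarrow> x \<in> carrier M \<Longrightarrow> f (y i \<odot>\<^bsub>M\<^esub> x) = y i \<odot>\<^bsub>N\<^esub> f x"
  shows "f (koszul M y k a T) = koszul N y k (\<lambda>U. f (a U)) T"
proof -
  interpret N: Module.module R N by fact
  have "f (\<zero>\<^bsub>M\<^esub> \<ominus>\<^bsub>M\<^esub> \<zero>\<^bsub>M\<^esub>) = f \<zero>\<^bsub>M\<^esub> \<ominus>\<^bsub>N\<^esub> f \<zero>\<^bsub>M\<^esub>" by (rule assms(5)) auto
  then have zero: "f \<zero>\<^bsub>M\<^esub> = \<zero>\<^bsub>N\<^esub>" using assms(4)[of "\<zero>\<^bsub>M\<^esub>"] by (simp add: a_minus_def[of N] N.r_neg)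
  show ?thesis using assms(1,6)
  proof (induction k arbitrary: a T)
    case (Suc k)
    then show ?case
      using Suc.IH[of "\<lambda>U. a (insert k U)" "T - {k}"] Suc.IH[of a T]
      by (auto simp: assms(3,5) koszul_closed)
  qed (simp add: zero)
qed

lemma koszul_smult:
  assumes "\<And>i. y i \<in> carrier R" "\<And>T. a T \<in> carrier M" "r \<in> carrier R"
  shows "koszul M y k (\<lambda>T. r \<odot>\<^bsub>M\<^esub> a T) T = r \<odot>\<^bsub>M\<^esub> koszul M y k a T"
proof (rule koszul_map[symmetric])
  show "r \<odot>\<^bsub>M\<^esub> (y i \<odot>\<^bsub>M\<^esub> x) = y i \<odot>\<^bsub>M\<^esub> (r \<odot>\<^bsub>M\<^esub> x)" if "x \<in> carrier M" for i x
    using that assms by (simp add: smult_assoc1[symmetric] R.m_comm)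
  show "Module.module R M" by (rule module_axioms)
qed (use assms in \<open>auto simp: smult_minus\<close>)

text \<open>The differential raises degrees by one.\<close>

lemma koszul_support:
  assumes "finite T" "\<And>i. y i \<in> carrier R" "\<And>U. U \<subseteq> T \<Longrightarrow> card U + 1 = card T \<Longrightarrow> a U = \<zero>\<^bsub>M\<^esub>"
  shows "koszul M y k a T = \<zero>\<^bsub>M\<^esub>"
  using assms(1,3)
proof (induction k arbitrary: a T)
  case (Suc k)
  show ?case
  proof (cases "k \<in> T")
    case True
    have c: "card (T - {k}) + 1 = card T" using card_Suc_Diff1[OF Suc.prems(1) True] by simp
    have "koszul M y k (\<lambda>U. a (insert k U)) (T - {k}) = \<zero>\<^bsub>M\<^esub>"
    proof (rule Suc.IH)
      fix U assume U: "U \<subseteq> T - {k}" "card U + 1 = card (T - {k})"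
      then have "finite U" "k \<notin> U" using Suc.prems(1) by (auto intro: finite_subset)
      then show "a (insert k U) = \<zero>\<^bsub>M\<^esub>" using U c True by (intro Suc.prems(2)) auto
    qed (use Suc.prems in auto)
    then show ?thesis using Suc.prems(2)[of "T - {k}"] c assms(2) by auto
  qed (use Suc in auto)
qed simp

lemma koszul_koszul:
  assumes "\<And>i. y i \<in> carrier R" "\<And>T. a T \<in> carrier M"
  shows "koszul M y k (koszul M y k a) T = \<zero>\<^bsub>M\<^esub>"
  using assms(2)
proof (induction k arbitrary: a T)
  case (Suc k)
  show ?case
  proof (cases "k \<in> T")
    case True
    let ?b = "\<lambda>U. a (insert k U)"
    have "koszul M y k (\<lambda>U. koszul M y (Suc k) a (insert k U)) (T - {k}) =
      koszul M y k (\<lambda>U. y k \<odot>\<^bsub>M\<^esub> a U \<ominus>\<^bsub>M\<^esub> koszul M y k ?b U) (T - {k})"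
    proof (rule koszul_cong)
      fix U assume "U \<subseteq> T - {k}"
      then have "insert k U - {k} = U" by auto
      then show "koszul M y (Suc k) a (insert k U) = y k \<odot>\<^bsub>M\<^esub> a U \<ominus>\<^bsub>M\<^esub> koszul M y k ?b U" by simp
    qed
    also have "\<dots> = koszul M y k (\<lambda>U. y k \<odot>\<^bsub>M\<^esub> a U) (T - {k}) \<ominus>\<^bsub>M\<^esub> koszul M y k (koszul M y k ?b) (T - {k})"
      using assms(1) Suc.prems by (intro koszul_minus) (auto intro: koszul_closed)
    also have "\<dots> = y k \<odot>\<^bsub>M\<^esub> koszul M y k a (T - {k})"
      using assms(1) Suc.prems Suc.IH[of ?b] by (simp add: koszul_smult koszul_closed a_minus_def)
    finally show ?thesis using True assms(1) Suc.prems
      by (simp add: koszul_closed a_minus_def M.r_neg)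
  next
    case False
    then have "koszul M y k (koszul M y (Suc k) a) T = koszul M y k (koszul M y k a) T"
      by (intro koszul_cong) auto
    then show ?thesis using False Suc.IH[of a T] Suc.prems by (simp del: koszul.simps add: koszul.simps(2)[of M y k _ T])
  qed
qed simp

end

text \<open>The cochain \<open>b\<close> with values in \<open>A\<close> has differential \<open>a\<close> and lives in degrees below \<open>s - 1\<close>; for \<open>s = 0\<close> and
  \<open>s = 1\<close> this means that it vanishes.\<close>

abbreviation koszul_primitive ::
    "('r, 'n, 'l) module_scheme \<Rightarrow> 'n set \<Rightarrow> (nat \<Rightarrow> 'r) \<Rightarrow> nat \<Rightarrow> nat \<Rightarrow> (nat set \<Rightarrow> 'n) \<Rightarrow> (nat set \<Rightarrow> 'n) \<Rightarrow> bool"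
  where "koszul_primitive N A y c s a b \<equiv>
    (\<forall>T. b T \<in> A) \<and> (\<forall>T\<subseteq>{..<c}. s \<le> Suc (card T) \<longrightarrow> b T = \<zero>\<^bsub>N\<^esub>) \<and>
    (\<forall>T\<subseteq>{..<c}. a T = koszul N y c b T)"

text \<open>The Koszul cohomology with coefficients in the submodule \<open>A\<close> of \<open>N\<close> vanishes in all degrees below \<open>s\<close>.\<close>

definition koszul_exact :: "('r, 'n, 'l) module_scheme \<Rightarrow> 'n set \<Rightarrow> (nat \<Rightarrow> 'r) \<Rightarrow> nat \<Rightarrow> nat \<Rightarrow> bool"
  where "koszul_exact N A y c s \<longleftrightarrow>
    (\<forall>a. (\<forall>T. a T \<in> A) \<and> (\<forall>T\<subseteq>{..<c}. s \<le> card T \<longrightarrow> a T = \<zero>\<^bsub>N\<^esub>) \<and>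
        (\<forall>T\<subseteq>{..<c}. koszul N y c a T = \<zero>\<^bsub>N\<^esub>) \<longrightarrow>
      (\<exists>b. koszul_primitive N A y c s a b))"

lemma koszul_exactI:
  assumes "\<And>a. (\<And>T. a T \<in> A) \<Longrightarrow> (\<And>T. T \<subseteq> {..<c} \<Longrightarrow> s \<le> card T \<Longrightarrow> a T = \<zero>\<^bsub>N\<^esub>) \<Longrightarrow>
      (\<And>T. T \<subseteq> {..<c} \<Longrightarrow> koszul N y c a T = \<zero>\<^bsub>N\<^esub>) \<Longrightarrow>
      \<exists>b. koszul_primitive N A y c s a b"
  shows "koszul_exact N A y c s"
  unfolding koszul_exact_def using assms by blast

lemma koszul_exactD:
  assumes "koszul_exact N A y c s" "\<And>T. a T \<in> A" "\<And>T. T \<subseteq> {..<c} \<Longrightarrow> s \<le> card T \<Longrightarrow> a T = \<zero>\<^bsub>N\<^esub>"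
    "\<And>T. T \<subseteq> {..<c} \<Longrightarrow> koszul N y c a T = \<zero>\<^bsub>N\<^esub>"
  shows "\<exists>b. koszul_primitive N A y c s a b"
proof -
  have "(\<forall>T. a T \<in> A) \<and> (\<forall>T\<subseteq>{..<c}. s \<le> card T \<longrightarrow> a T = \<zero>\<^bsub>N\<^esub>) \<and>
        (\<forall>T\<subseteq>{..<c}. koszul N y c a T = \<zero>\<^bsub>N\<^esub>)"
    using assms(2-4) by simp
  with assms(1)[unfolded koszul_exact_def] show ?thesis by simp
qed

text \<open>Exactness in degrees below \<open>c\<close> when every \<open>y k\<close> has a left inverse \<open>q k\<close> that commutes with \<open>y 0, \<dots>, y (k - 1)\<close>.
  This is a regularity condition on \<open>y\<close>, and \<open>q k\<close> turns it into explicit primitives: a cocycle satisfies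
  \<open>y k * a = koszul b\<close>, where \<open>b\<close> is its part on the sets containing \<open>k\<close>, so \<open>a = koszul (q k b)\<close>,
  and \<open>b - y k * q k b\<close> is a cocycle of lower degree for one element less.\<close>

lemma koszul_exact_quotients:
  fixes M :: "('r, 'n, 'l) module_scheme"
  assumes "Module.module R M" and y: "\<And>i. y i \<in> carrier R"
    and q: "\<And>k x. x \<in> carrier M \<Longrightarrow> q k x \<in> carrier M"
      "\<And>k x z. x \<in> carrier M \<Longrightarrow> z \<in> carrier M \<Longrightarrow> q k (x \<ominus>\<^bsub>M\<^esub> z) = q k x \<ominus>\<^bsub>M\<^esub> q k z"
      "\<And>k x. k < c \<Longrightarrow> x \<in> carrier M \<Longrightarrow> q k (y k \<odot>\<^bsub>M\<^esub> x) = x"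
      "\<And>i k x. i < k \<Longrightarrow> k < c \<Longrightarrow> x \<in> carrier M \<Longrightarrow> q k (y i \<odot>\<^bsub>M\<^esub> x) = y i \<odot>\<^bsub>M\<^esub> q k x"
    and "s \<le> c"
  shows "koszul_exact M (carrier M) y c s"
proof -
  interpret Module.module R M by fact
  have "k \<le> c \<Longrightarrow> s \<le> k \<Longrightarrow> koszul_exact M (carrier M) y k s" for k
  proof (induction k arbitrary: s)
    case 0
    show ?case
    proof (rule koszul_exactI)
      fix a :: "nat set \<Rightarrow> 'n"
      assume a: "\<And>T. T \<subseteq> {..<0} \<Longrightarrow> s \<le> card T \<Longrightarrow> a T = \<zero>\<^bsub>M\<^esub>"
      show "\<exists>b. koszul_primitive M (carrier M) y 0 s a b"
        using a "0.prems" by (intro exI[of _ "\<lambda>_. \<zero>\<^bsub>M\<^esub>"]) auto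
    qed
  next
    case (Suc k)
    show ?case
    proof (rule koszul_exactI)
      fix a :: "nat set \<Rightarrow> 'n"
      assume a: "\<And>T. a T \<in> carrier M" "\<And>T. T \<subseteq> {..<Suc k} \<Longrightarrow> s \<le> card T \<Longrightarrow> a T = \<zero>\<^bsub>M\<^esub>"
        "\<And>T. T \<subseteq> {..<Suc k} \<Longrightarrow> koszul M y (Suc k) a T = \<zero>\<^bsub>M\<^esub>"
      define b where "b T = a (insert k T)" for T
      define a' where "a' T = q k (b T)" for T
      define e where "e T = b T \<ominus>\<^bsub>M\<^esub> y k \<odot>\<^bsub>M\<^esub> a' T" for T
      have clo: "b T \<in> carrier M" "a' T \<in> carrier M" "e T \<in> carrier M" for T
        unfolding e_def a'_def b_def using a(1) q(1) y by auto
      have "q k (\<zero>\<^bsub>M\<^esub> \<ominus>\<^bsub>M\<^esub> \<zero>\<^bsub>M\<^esub>) = q k \<zero>\<^bsub>M\<^esub> \<ominus>\<^bsub>M\<^esub> q k \<zero>\<^bsub>M\<^esub>" by (rule q(2)) auto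
      then have q0: "q k \<zero>\<^bsub>M\<^esub> = \<zero>\<^bsub>M\<^esub>" using q(1) by (simp add: a_minus_def[of M "q k _"] M.r_neg)
      have ya: "y k \<odot>\<^bsub>M\<^esub> a T = koszul M y k b T" if T: "T \<subseteq> {..<k}" for T
      proof -
        have "insert k T \<subseteq> {..<Suc k}" "insert k T - {k} = T" using T by auto
        then have "y k \<odot>\<^bsub>M\<^esub> a T \<ominus>\<^bsub>M\<^esub> koszul M y k b T = \<zero>\<^bsub>M\<^esub>"
          using a(3)[of "insert k T"] by (simp add: b_def[abs_def])
        moreover have "y k \<odot>\<^bsub>M\<^esub> a T \<in> carrier M" "koszul M y k b T \<in> carrier M"
          using a(1) clo y by (simp_all add: koszul_closed)
        ultimately show ?thesis by (rule minus_eq_zeroD[rotated -1])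
      qed
      have a': "a T = koszul M y k a' T" if T: "T \<subseteq> {..<k}" for T
      proof -
        have "a T = q k (y k \<odot>\<^bsub>M\<^esub> a T)" using q(3) a(1) Suc.prems by simp
        also have "\<dots> = q k (koszul M y k b T)" using ya[OF T] by simp
        also have "\<dots> = koszul M y k a' T"
          unfolding a'_def using q Suc.prems clo(1) y \<open>Module.module R M\<close> by (intro koszul_map) auto
        finally show ?thesis .
      qed
      have b0: "b T = \<zero>\<^bsub>M\<^esub>" if T: "T \<subseteq> {..<k}" "s \<le> Suc (card T)" for T
      proof -
        have "finite T" "k \<notin> T" using T(1) by (auto intro: finite_subset)
        then show ?thesis unfolding b_def using T by (intro a(2)) auto
      qed
      have "koszul_exact M (carrier M) y k (s - 1)" using Suc.prems by (intro Suc.IH) auto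
      moreover note clo(3)
      moreover have "e T = \<zero>\<^bsub>M\<^esub>" if "T \<subseteq> {..<k}" "s - 1 \<le> card T" for T
      proof -
        have "b T = \<zero>\<^bsub>M\<^esub>" using that by (intro b0) auto
        then show ?thesis unfolding e_def a'_def using q0 y by simp
      qed
      moreover have "koszul M y k e T = \<zero>\<^bsub>M\<^esub>" if T: "T \<subseteq> {..<k}" for T
      proof -
        have "koszul M y k e T = koszul M y k b T \<ominus>\<^bsub>M\<^esub> y k \<odot>\<^bsub>M\<^esub> koszul M y k a' T"
          unfolding e_def using y clo by (simp add: koszul_minus koszul_smult)
        also have "\<dots> = \<zero>\<^bsub>M\<^esub>" using ya[OF T] a'[OF T] y a(1) clo by (simp add: koszul_closed)
        finally show ?thesis .
      qed
      ultimately have "\<exists>e'. koszul_primitive M (carrier M) y k (s - 1) e e'"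
        by (rule koszul_exactD)
      then obtain e' where "koszul_primitive M (carrier M) y k (s - 1) e e'"
        by (elim exE)
      then have e': "\<And>T. e' T \<in> carrier M" "\<And>T. T \<subseteq> {..<k} \<Longrightarrow> s - 1 \<le> Suc (card T) \<Longrightarrow> e' T = \<zero>\<^bsub>M\<^esub>"
        "\<And>T. T \<subseteq> {..<k} \<Longrightarrow> e T = koszul M y k e' T"
        by simp_all
      define g where "g T = (if k \<in> T then \<zero>\<^bsub>M\<^esub> \<ominus>\<^bsub>M\<^esub> e' (T - {k}) else a' T)" for T
      show "\<exists>b. koszul_primitive M (carrier M) y (Suc k) s a b"
      proof (intro exI[of _ g] conjI allI impI)
        show "g T \<in> carrier M" for T unfolding g_def using e'(1) clo by auto
        fix T assume T: "T \<subseteq> {..<Suc k}"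
        then have T': "T - {k} \<subseteq> {..<k}" and fin: "finite T" by (auto intro: finite_subset simp: less_Suc_eq)
        {
          assume s: "s \<le> Suc (card T)"
          show "g T = \<zero>\<^bsub>M\<^esub>"
          proof (cases "k \<in> T")
            case True
            then have "card T = Suc (card (T - {k}))" using card_Suc_Diff1[OF fin] by simp
            then have "e' (T - {k}) = \<zero>\<^bsub>M\<^esub>" using T' s by (intro e'(2)) auto
            then show ?thesis using True by (simp add: g_def)
          next
            case False
            then have "b T = \<zero>\<^bsub>M\<^esub>" using T' s by (intro b0) auto
            then show ?thesis using False q0 by (simp add: g_def a'_def)
          qed
        }
        show "a T = koszul M y (Suc k) g T"
        proof (cases "k \<in> T")
          case True
          have "koszul M y k (\<lambda>U. g (insert k U)) (T - {k}) = koszul M y k (\<lambda>U. \<zero>\<^bsub>M\<^esub> \<ominus>\<^bsub>M\<^esub> e' U) (T - {k})"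
            by (rule koszul_cong) (auto simp: g_def insert_Diff_if subset_Diff_insert)
          also have "\<dots> = koszul M y k (\<lambda>U. \<zero>\<^bsub>M\<^esub>) (T - {k}) \<ominus>\<^bsub>M\<^esub> koszul M y k e' (T - {k})"
            using y e'(1) by (intro koszul_minus) auto
          also have "koszul M y k (\<lambda>U. \<zero>\<^bsub>M\<^esub>) (T - {k}) = \<zero>\<^bsub>M\<^esub>"
            using fin y by (intro koszul_support) auto
          also have "koszul M y k e' (T - {k}) = e (T - {k})" using e'(3)[OF T'] by simp
          finally have "koszul M y (Suc k) g T = y k \<odot>\<^bsub>M\<^esub> a' (T - {k}) \<ominus>\<^bsub>M\<^esub> (\<zero>\<^bsub>M\<^esub> \<ominus>\<^bsub>M\<^esub> e (T - {k}))"
            using True by (simp add: g_def)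
          also have "\<dots> = y k \<odot>\<^bsub>M\<^esub> a' (T - {k}) \<oplus>\<^bsub>M\<^esub> e (T - {k})"
            using clo y by (simp add: a_minus_def)
          also have "\<dots> = b (T - {k})"
            unfolding e_def using clo y by (simp add: a_minus_def M.a_lcomm M.r_neg)
          also have "\<dots> = a T" using True by (simp add: b_def insert_absorb)
          finally show ?thesis by simp
        next
          case False
          then have "koszul M y (Suc k) g T = koszul M y k a' T"
            by (auto intro!: koszul_cong simp: g_def)
          moreover have "T \<subseteq> {..<k}" using T' False by simp
          ultimately show ?thesis using a' by simp
        qed
      qed
    qed
  qed
  then show ?thesis using \<open>s \<le> c\<close> by simp
qed

lemma koszul_exact_retract:
  fixes M :: "('r, 'n, 'l) module_scheme"
  assumes "Module.module R M" "Module.module R N" and y: "\<And>i. y i \<in> carrier R"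
    and f: "f \<in> mod_hom R M N" and g: "g \<in> mod_hom R N M" "\<And>x. x \<in> carrier M \<Longrightarrow> g (f x) = x"
    and N: "koszul_exact N (carrier N) y c s"
  shows "koszul_exact M (carrier M) y c s"
proof (rule koszul_exactI)
  interpret M: Module.module R M by fact
  interpret N: Module.module R N by fact
  fix a :: "nat set \<Rightarrow> 'n"
  assume a: "\<And>T. a T \<in> carrier M" "\<And>T. T \<subseteq> {..<c} \<Longrightarrow> s \<le> card T \<Longrightarrow> a T = \<zero>\<^bsub>M\<^esub>"
    "\<And>T. T \<subseteq> {..<c} \<Longrightarrow> koszul M y c a T = \<zero>\<^bsub>M\<^esub>"
  note f0 = mod_hom_zero[OF assms(1,2) f] and g0 = mod_hom_zero[OF assms(2,1) g(1)]
  have comm: "koszul N y c (\<lambda>U. f (a U)) T = f (koszul M y c a T)" for T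
    using a(1) assms(2) y mod_hom_closed[OF f] mod_hom_minus[OF assms(1,2) f] mod_hom_smult[OF f y]
    by (intro M.koszul_map[symmetric]) auto
  have "f (a T) \<in> carrier N" for T by (rule mod_hom_closed[OF f a(1)])
  moreover have "f (a T) = \<zero>\<^bsub>N\<^esub>" if "T \<subseteq> {..<c}" "s \<le> card T" for T using a(2)[OF that] f0 by simp
  moreover have "koszul N y c (\<lambda>U. f (a U)) T = \<zero>\<^bsub>N\<^esub>" if "T \<subseteq> {..<c}" for T
    using a(3)[OF that] f0 comm by simp
  ultimately have "\<exists>b. koszul_primitive N (carrier N) y c s (\<lambda>T. f (a T)) b"
    by (rule koszul_exactD[OF N])
  then obtain b where "koszul_primitive N (carrier N) y c s (\<lambda>T. f (a T)) b"
    by (elim exE)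
  then have b: "\<And>T. b T \<in> carrier N" "\<And>T. T \<subseteq> {..<c} \<Longrightarrow> s \<le> Suc (card T) \<Longrightarrow> b T = \<zero>\<^bsub>N\<^esub>"
    "\<And>T. T \<subseteq> {..<c} \<Longrightarrow> f (a T) = koszul N y c b T"
    by simp_all
  show "\<exists>b. koszul_primitive M (carrier M) y c s a b"
  proof (intro exI[of _ "\<lambda>U. g (b U)"] conjI allI impI)
    fix T :: "nat set" assume T: "T \<subseteq> {..<c}"
    have "a T = g (koszul N y c b T)" using b(3)[OF T] g(2) a(1) by metis
    also have "\<dots> = koszul M y c (\<lambda>U. g (b U)) T"
      using b(1) assms(1) y mod_hom_closed[OF g(1)] mod_hom_minus[OF assms(2,1) g(1)] mod_hom_smult[OF g(1) y]
      by (intro N.koszul_map) auto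
    finally show "a T = koszul M y c (\<lambda>U. g (b U)) T" .
  qed (use b(1,2) g0 mod_hom_closed[OF g(1)] in auto)
qed

text \<open>Dimension shifting along \<open>0 \<rightarrow> ker f \<rightarrow> P \<rightarrow> f P \<rightarrow> 0\<close>.\<close>

lemma koszul_exact_image:
  fixes N :: "('r, 'n, 'l) module_scheme"
  assumes "Module.module R P" "Module.module R N" and y: "\<And>i. y i \<in> carrier R"
    and f: "f \<in> mod_hom R P N"
    and P: "koszul_exact P (carrier P) y c s" and K: "koszul_exact P (mod_ker P N f) y c (Suc s)"
  shows "koszul_exact N (f ` carrier P) y c s"
proof (rule koszul_exactI)
  interpret P: Module.module R P by fact
  interpret N: Module.module R N by fact
  fix a :: "nat set \<Rightarrow> 'n"
  assume a: "\<And>T. a T \<in> f ` carrier P" "\<And>T. T \<subseteq> {..<c} \<Longrightarrow> s \<le> card T \<Longrightarrow> a T = \<zero>\<^bsub>N\<^esub>"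
    "\<And>T. T \<subseteq> {..<c} \<Longrightarrow> koszul N y c a T = \<zero>\<^bsub>N\<^esub>"
  note f0 = mod_hom_zero[OF assms(1,2) f]
  have comm: "f (koszul P y c b T) = koszul N y c (\<lambda>U. f (b U)) T" if "\<And>T. b T \<in> carrier P" for b T
    using that assms(2) y mod_hom_closed[OF f] mod_hom_minus[OF assms(1,2) f] mod_hom_smult[OF f y]
    by (intro P.koszul_map) auto
  have "\<forall>T. \<exists>p. p \<in> carrier P \<and> f p = a T \<and> (a T = \<zero>\<^bsub>N\<^esub> \<longrightarrow> p = \<zero>\<^bsub>P\<^esub>)"
  proof
    fix T show "\<exists>p. p \<in> carrier P \<and> f p = a T \<and> (a T = \<zero>\<^bsub>N\<^esub> \<longrightarrow> p = \<zero>\<^bsub>P\<^esub>)"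
      using a(1)[of T] f0 by (cases "a T = \<zero>\<^bsub>N\<^esub>") auto
  qed
  then obtain l where l: "\<And>T. l T \<in> carrier P" "\<And>T. f (l T) = a T" "\<And>T. a T = \<zero>\<^bsub>N\<^esub> \<Longrightarrow> l T = \<zero>\<^bsub>P\<^esub>"
    by metis
  \<comment> \<open>the coboundary of the lift; elsewhere it need not lie in the kernel, so it is cut off\<close>
  define h where "h T = (if T \<subseteq> {..<c} then koszul P y c l T else \<zero>\<^bsub>P\<^esub>)" for T
  have "h T \<in> mod_ker P N f" for T
    using a(3) comm[of l T] l f0 y by (auto simp: h_def mod_ker_def P.koszul_closed)
  moreover have "h T = \<zero>\<^bsub>P\<^esub>" if "T \<subseteq> {..<c}" "Suc s \<le> card T" for T
  proof -
    have "l U = \<zero>\<^bsub>P\<^esub>" if "U \<subseteq> T" "card U + 1 = card T" for U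
      using that \<open>T \<subseteq> {..<c}\<close> \<open>Suc s \<le> card T\<close> by (intro l(3) a(2)) auto
    moreover have "finite T" using that(1) by (auto intro: finite_subset)
    ultimately show ?thesis using that y by (auto simp: h_def intro: P.koszul_support)
  qed
  moreover have "koszul P y c h T = \<zero>\<^bsub>P\<^esub>" if T: "T \<subseteq> {..<c}" for T
  proof -
    have "koszul P y c h T = koszul P y c (koszul P y c l) T"
      using T by (intro koszul_cong) (auto simp: h_def)
    then show ?thesis using P.koszul_koszul[OF y l(1)] by simp
  qed
  ultimately have "\<exists>b. koszul_primitive P (mod_ker P N f) y c (Suc s) h b"
    by (rule koszul_exactD[OF K])
  then obtain b where "koszul_primitive P (mod_ker P N f) y c (Suc s) h b"
    by (elim exE)
  then have b: "\<And>T. b T \<in> mod_ker P N f" "\<And>T. T \<subseteq> {..<c} \<Longrightarrow> Suc s \<le> Suc (card T) \<Longrightarrow> b T = \<zero>\<^bsub>P\<^esub>"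
    "\<And>T. T \<subseteq> {..<c} \<Longrightarrow> h T = koszul P y c b T"
    by simp_all
  have b': "b T \<in> carrier P" "f (b T) = \<zero>\<^bsub>N\<^esub>" for T using b(1)[of T] by (auto simp: mod_ker_def)
  let ?g = "\<lambda>T. l T \<ominus>\<^bsub>P\<^esub> b T"
  have "?g T \<in> carrier P" for T using l(1) b'(1) by simp
  moreover have "?g T = \<zero>\<^bsub>P\<^esub>" if "T \<subseteq> {..<c}" "s \<le> card T" for T
    using that l(3)[OF a(2)[OF that]] b(2)[of T] by simp
  moreover have "koszul P y c ?g T = \<zero>\<^bsub>P\<^esub>" if T: "T \<subseteq> {..<c}" for T
    using b(3)[OF T] T l(1) b' y by (simp add: h_def P.koszul_minus P.koszul_closed)
  ultimately have "\<exists>e. koszul_primitive P (carrier P) y c s ?g e"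
    by (rule koszul_exactD[OF P])
  then obtain e where "koszul_primitive P (carrier P) y c s ?g e"
    by (elim exE)
  then have e: "\<And>T. e T \<in> carrier P" "\<And>T. T \<subseteq> {..<c} \<Longrightarrow> s \<le> Suc (card T) \<Longrightarrow> e T = \<zero>\<^bsub>P\<^esub>"
    "\<And>T. T \<subseteq> {..<c} \<Longrightarrow> ?g T = koszul P y c e T"
    by simp_all
  show "\<exists>b. koszul_primitive N (f ` carrier P) y c s a b"
  proof (intro exI[of _ "\<lambda>U. f (e U)"] conjI allI impI)
    fix T :: "nat set" assume T: "T \<subseteq> {..<c}"
    have "a T = a T \<ominus>\<^bsub>N\<^esub> \<zero>\<^bsub>N\<^esub>" using a(1)[of T] mod_hom_closed[OF f] by auto
    also have "\<dots> = f (?g T)" using mod_hom_minus[OF assms(1,2) f l(1) b'(1), of T T] l(2) b'(2) by simp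
    also have "\<dots> = koszul N y c (\<lambda>U. f (e U)) T" using e(3)[OF T] comm[OF e(1)] by simp
    finally show "a T = koszul N y c (\<lambda>U. f (e U)) T" .
  qed (use e(1,2) f0 in auto)
qed

section \<open>A lower bound for the projective dimension\<close>

lemma free_module_carrier:
  "f \<in> carrier (free_module R B) \<longleftrightarrow>
    (\<forall>x\<in>B. f x \<in> carrier R) \<and> (\<forall>x. x \<notin> B \<longrightarrow> f x = \<zero>\<^bsub>R\<^esub>) \<and> finite {x. f x \<noteq> \<zero>\<^bsub>R\<^esub>}"
  by (simp add: free_module_def)

lemma free_module_ops:
  "f \<oplus>\<^bsub>free_module R B\<^esub> g = (\<lambda>x. f x \<oplus>\<^bsub>R\<^esub> g x)" "\<zero>\<^bsub>free_module R B\<^esub> = (\<lambda>x. \<zero>\<^bsub>R\<^esub>)"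
  "r \<odot>\<^bsub>free_module R B\<^esub> f = (\<lambda>x. r \<otimes>\<^bsub>R\<^esub> f x)"
  by (simp_all add: free_module_def)

lemma module_free_module:
  assumes "cring R" shows "Module.module R (free_module R B)"
proof -
  let ?F = "free_module R B"
  interpret R: cring R by fact
  have clo: "f x \<in> carrier R" if "f \<in> carrier ?F" for f x
    using that unfolding free_module_carrier by (cases "x \<in> B") auto
  have add: "f \<oplus>\<^bsub>?F\<^esub> g \<in> carrier ?F"
    if "f \<in> carrier ?F" "g \<in> carrier ?F" for f g
  proof -
    have "{x. f x \<oplus>\<^bsub>R\<^esub> g x \<noteq> \<zero>\<^bsub>R\<^esub>} \<subseteq> {x. f x \<noteq> \<zero>\<^bsub>R\<^esub>} \<union> {x. g x \<noteq> \<zero>\<^bsub>R\<^esub>}" by auto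
    then show ?thesis using that unfolding free_module_carrier free_module_ops
      by (auto intro: finite_subset)
  qed
  have smult: "r \<odot>\<^bsub>?F\<^esub> f \<in> carrier ?F"
    if "r \<in> carrier R" "f \<in> carrier ?F" for r f
  proof -
    have "{x. r \<otimes>\<^bsub>R\<^esub> f x \<noteq> \<zero>\<^bsub>R\<^esub>} \<subseteq> {x. f x \<noteq> \<zero>\<^bsub>R\<^esub>}" using that(1) by auto
    then show ?thesis using that unfolding free_module_carrier free_module_ops
      by (auto intro: finite_subset)
  qed
  show ?thesis
  proof (rule moduleI)
    show "abelian_group ?F"
    proof (rule abelian_groupI)
      fix f assume f: "f \<in> carrier ?F"
      have "\<ominus>\<^bsub>R\<^esub> \<one>\<^bsub>R\<^esub> \<odot>\<^bsub>?F\<^esub> f \<oplus>\<^bsub>?F\<^esub> f = \<zero>\<^bsub>?F\<^esub>"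
        unfolding free_module_ops using clo[OF f] by (simp add: R.l_minus R.l_neg)
      then show "\<exists>g\<in>carrier ?F. g \<oplus>\<^bsub>?F\<^esub> f = \<zero>\<^bsub>?F\<^esub>"
        using smult[OF _ f] by blast
    next
      show "\<zero>\<^bsub>?F\<^esub> \<in> carrier ?F"
        by (simp add: free_module_carrier free_module_ops)
    qed (use clo add in \<open>auto simp: free_module_ops R.a_ac\<close>)
  qed (use assms clo smult in \<open>auto simp: free_module_ops R.l_distr R.r_distr R.m_assoc\<close>)
qed

lemma submodule_closed:
  assumes "Module.module R M" "submodule A R M"
  shows "x \<in> A \<Longrightarrow> x \<in> carrier M" "x \<in> A \<Longrightarrow> y \<in> A \<Longrightarrow> x \<oplus>\<^bsub>M\<^esub> y \<in> A" "x \<in> A \<Longrightarrow> y \<in> A \<Longrightarrow> x \<ominus>\<^bsub>M\<^esub> y \<in> A"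
    "r \<in> carrier R \<Longrightarrow> x \<in> A \<Longrightarrow> r \<odot>\<^bsub>M\<^esub> x \<in> A"
  using Module.module.submoduleE[OF assms] by (auto simp: a_minus_def)

lemma projective_retract:
  fixes P :: "('r, 'p, 'l) module_scheme"
  assumes "projective_module R P"
  obtains B :: "'p set" and f g where "f \<in> mod_hom R P (free_module R B)" "g \<in> mod_hom R (free_module R B) P"
    "\<forall>x\<in>carrier P. g (f x) = x"
proof -
  obtain S :: "'p set" and A B \<phi> where P: "Module.module R P" and sub: "submodule A R (free_module R S)" "submodule B R (free_module R S)"
    and sum: "A <+>\<^bsub>free_module R S\<^esub> B = carrier (free_module R S)" and int: "A \<inter> B = {\<zero>\<^bsub>free_module R S\<^esub>}"
    and \<phi>: "\<phi> \<in> mod_hom R P ((free_module R S)\<lparr>carrier := A\<rparr>)" "bij_betw \<phi> (carrier P) A"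
    using assms unfolding projective_module_def Let_def by blast
  define F where "F = free_module R S"
  interpret P: Module.module R P by (rule P)
  interpret F: Module.module R F unfolding F_def using P.R.cring_axioms by (rule module_free_module)
  note sub = sub[folded F_def] and sum = sum[folded F_def] and int = int[folded F_def]
  note A = submodule_closed[OF F.module_axioms sub(1)] and B = submodule_closed[OF F.module_axioms sub(2)]
  define \<psi> where "\<psi> = inv_into (carrier P) \<phi>"
  have \<psi>: "\<psi> a \<in> carrier P" "\<phi> (\<psi> a) = a" if "a \<in> A" for a
    using bij_betw_inv_into_right[OF \<phi>(2) that] bij_betwE[OF bij_betw_inv_into[OF \<phi>(2)]] that
    by (auto simp: \<psi>_def)
  have \<psi>\<phi>: "\<psi> (\<phi> x) = x" if "x \<in> carrier P" for x
    unfolding \<psi>_def using bij_betw_inv_into_left[OF \<phi>(2) that] .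
  have \<phi>A: "\<phi> x \<in> A" if "x \<in> carrier P" for x using \<phi>(2) that by (auto simp: bij_betw_def)
  have \<phi>F: "\<phi> \<in> mod_hom R P F"
    using \<phi>(1) \<phi>A A(1) unfolding mod_hom_def F_def by auto
  define pr where "pr x = (SOME a. a \<in> A \<and> (\<exists>b\<in>B. x = a \<oplus>\<^bsub>F\<^esub> b))" for x
  have ex: "\<exists>a. a \<in> A \<and> (\<exists>b\<in>B. x = a \<oplus>\<^bsub>F\<^esub> b)" if "x \<in> carrier F" for x
    using that sum unfolding set_add_def'[of F A B] by blast
  have pr: "pr x \<in> A" "\<exists>b\<in>B. x = pr x \<oplus>\<^bsub>F\<^esub> b" if "x \<in> carrier F" for x
    using someI_ex[OF ex[OF that]] unfolding pr_def by auto
  have pr_eq: "pr (a \<oplus>\<^bsub>F\<^esub> b) = a" if ab: "a \<in> A" "b \<in> B" for a b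
  proof -
    have c: "a \<oplus>\<^bsub>F\<^esub> b \<in> carrier F" using A(1) B(1) ab by simp
    obtain b' where b': "b' \<in> B" "a \<oplus>\<^bsub>F\<^esub> b = pr (a \<oplus>\<^bsub>F\<^esub> b) \<oplus>\<^bsub>F\<^esub> b'" using pr(2)[OF c] by blast
    define a' where "a' = pr (a \<oplus>\<^bsub>F\<^esub> b)"
    have a': "a' \<in> A" "a \<oplus>\<^bsub>F\<^esub> b = a' \<oplus>\<^bsub>F\<^esub> b'" using pr(1)[OF c] b' by (auto simp: a'_def)
    have cl: "a \<in> carrier F" "b \<in> carrier F" "a' \<in> carrier F" "b' \<in> carrier F"
      using A(1) B(1) ab a' b' by auto
    have "a \<ominus>\<^bsub>F\<^esub> a' = (a \<oplus>\<^bsub>F\<^esub> b) \<ominus>\<^bsub>F\<^esub> a' \<ominus>\<^bsub>F\<^esub> b"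
      using cl by (simp add: a_minus_def F.M.a_assoc F.M.a_lcomm[of b "\<ominus>\<^bsub>F\<^esub> a'" "\<ominus>\<^bsub>F\<^esub> b"] F.M.r_neg)
    also have "\<dots> = b' \<ominus>\<^bsub>F\<^esub> b"
      unfolding a'(2) using cl
      by (simp add: a_minus_def F.M.a_assoc F.M.a_lcomm[of b' "\<ominus>\<^bsub>F\<^esub> a'"] F.M.r_neg2)
    finally have "a \<ominus>\<^bsub>F\<^esub> a' \<in> A \<inter> B" using A(3)[OF ab(1) a'(1)] B(3)[OF b'(1) ab(2)] by simp
    then have "a \<ominus>\<^bsub>F\<^esub> a' = \<zero>\<^bsub>F\<^esub>" using int by simp
    from F.minus_eq_zeroD[OF cl(1,3) this] show ?thesis by (simp add: a'_def)
  qed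
  have "(\<lambda>x. \<psi> (pr x)) \<in> mod_hom R F P"
    unfolding mod_hom_def mem_Collect_eq
  proof (intro conjI ballI)
    show "(\<lambda>x. \<psi> (pr x)) \<in> carrier F \<rightarrow> carrier P" using \<psi> pr by auto
    have inj: "inj_on \<phi> (carrier P)" using \<phi>(2) by (rule bij_betw_imp_inj_on)
    {
      fix x y assume x: "x \<in> carrier F" and y: "y \<in> carrier F"
      obtain b b' where b: "b \<in> B" "x = pr x \<oplus>\<^bsub>F\<^esub> b" and b': "b' \<in> B" "y = pr y \<oplus>\<^bsub>F\<^esub> b'"
        using pr(2) x y by metis
      have cl: "pr x \<in> carrier F" "pr y \<in> carrier F" "b \<in> carrier F" "b' \<in> carrier F"
        using A(1) B(1) b b' pr(1) x y by auto
      have "x \<oplus>\<^bsub>F\<^esub> y = (pr x \<oplus>\<^bsub>F\<^esub> b) \<oplus>\<^bsub>F\<^esub> (pr y \<oplus>\<^bsub>F\<^esub> b')" using b(2) b'(2) by simp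
      also have "\<dots> = (pr x \<oplus>\<^bsub>F\<^esub> pr y) \<oplus>\<^bsub>F\<^esub> (b \<oplus>\<^bsub>F\<^esub> b')" using cl by (simp add: F.M.a_ac)
      finally have "pr (x \<oplus>\<^bsub>F\<^esub> y) = pr x \<oplus>\<^bsub>F\<^esub> pr y"
        using pr_eq A(2) B(2) pr(1) x y b b' by simp
      moreover have "\<psi> (pr x \<oplus>\<^bsub>F\<^esub> pr y) = \<psi> (pr x) \<oplus>\<^bsub>P\<^esub> \<psi> (pr y)"
        using \<psi>\<phi>[of "\<psi> (pr x) \<oplus>\<^bsub>P\<^esub> \<psi> (pr y)"] \<psi>[OF pr(1)] x y mod_hom_add[OF \<phi>F] by simp
      ultimately show "\<psi> (pr (x \<oplus>\<^bsub>F\<^esub> y)) = \<psi> (pr x) \<oplus>\<^bsub>P\<^esub> \<psi> (pr y)" by simp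
    next
      fix r x assume r: "r \<in> carrier R" and x: "x \<in> carrier F"
      obtain b where b: "b \<in> B" "x = pr x \<oplus>\<^bsub>F\<^esub> b" using pr(2) x by metis
      have "r \<odot>\<^bsub>F\<^esub> x = r \<odot>\<^bsub>F\<^esub> (pr x \<oplus>\<^bsub>F\<^esub> b)" using b(2) by simp
      also have "\<dots> = r \<odot>\<^bsub>F\<^esub> pr x \<oplus>\<^bsub>F\<^esub> r \<odot>\<^bsub>F\<^esub> b"
        using A(1) B(1) b pr(1) x r by (intro F.smult_r_distr) auto
      finally have "pr (r \<odot>\<^bsub>F\<^esub> x) = r \<odot>\<^bsub>F\<^esub> pr x"
        using pr_eq A(4) B(4) pr(1) x b r by simp
      moreover have "\<psi> (r \<odot>\<^bsub>F\<^esub> pr x) = r \<odot>\<^bsub>P\<^esub> \<psi> (pr x)"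
        using \<psi>\<phi>[of "r \<odot>\<^bsub>P\<^esub> \<psi> (pr x)"] \<psi>[OF pr(1)] x r mod_hom_smult[OF \<phi>F] by simp
      ultimately show "\<psi> (pr (r \<odot>\<^bsub>F\<^esub> x)) = r \<odot>\<^bsub>P\<^esub> \<psi> (pr x)" by simp
    }
  qed
  moreover have "\<psi> (pr (\<phi> x)) = x" if "x \<in> carrier P" for x
  proof -
    have "\<zero>\<^bsub>F\<^esub> \<in> B" using int by auto
    then have "pr (\<phi> x) = \<phi> x" using pr_eq[OF \<phi>A[OF that], of "\<zero>\<^bsub>F\<^esub>"] A(1)[OF \<phi>A[OF that]] by simp
    then show ?thesis using \<psi>\<phi> that by simp
  qed
  ultimately show ?thesis using that[of \<phi> S "\<lambda>x. \<psi> (pr x)"] \<phi>F by (simp add: F_def)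
qed

lemma koszul_exact_free:
  fixes V :: "'v set" and k :: "'k::field itself"
  assumes "distinct xs" "set xs \<subseteq> V" "s \<le> length xs"
  shows "koszul_exact (free_module (poly_ring k V) B) (carrier (free_module (poly_ring k V) B))
    (\<lambda>i. if i < length xs then mvar (xs ! i) else 0) (length xs) s"
proof (rule koszul_exact_quotients[where q = "\<lambda>k f x. var_quot (xs ! k) (f x)"])
  let ?R = "poly_ring k V" and ?F = "free_module (poly_ring k V) B"
  show F: "Module.module ?R ?F" by (intro module_free_module cring_poly_ring)
  interpret Module.module ?R ?F by (rule F)
  have minus: "f \<ominus>\<^bsub>?F\<^esub> g = (\<lambda>x. f x - g x)" if fg: "f \<in> carrier ?F" "g \<in> carrier ?F" for f g
  proof -
    have "(\<lambda>x. - g x) = - 1 \<odot>\<^bsub>?F\<^esub> g" by (simp add: free_module_ops poly_ring_simps)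
    also have "\<dots> \<in> carrier ?F"
      using fg(2) by (intro smult_closed) (simp_all add: poly_ring_simps polys_uminus)
    finally have "\<ominus>\<^bsub>?F\<^esub> g = (\<lambda>x. - g x)"
      using fg(2) by (intro M.minus_equality) (simp_all add: free_module_ops poly_ring_simps)
    then show ?thesis by (simp add: a_minus_def free_module_ops poly_ring_simps)
  qed
  have q: "(\<lambda>x. var_quot (xs ! k) (f x)) \<in> carrier ?F" if "f \<in> carrier ?F" for k f
  proof -
    have "{x. var_quot (xs ! k) (f x) \<noteq> 0} \<subseteq> {x. f x \<noteq> 0}" by auto
    then show ?thesis using that unfolding free_module_carrier poly_ring_simps
      by (auto intro: finite_subset var_quot_in_polys)
  qed
  show "(\<lambda>x. var_quot (xs ! k) (f x)) \<in> carrier ?F" if "f \<in> carrier ?F" for k f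
    using that by (rule q)
  show "(\<lambda>x. var_quot (xs ! k) ((f \<ominus>\<^bsub>?F\<^esub> g) x)) =
      (\<lambda>x. var_quot (xs ! k) (f x)) \<ominus>\<^bsub>?F\<^esub> (\<lambda>x. var_quot (xs ! k) (g x))"
    if "f \<in> carrier ?F" "g \<in> carrier ?F" for k f g
    using that q by (simp add: minus var_quot_diff)
  show "(if i < length xs then mvar (xs ! i) else 0) \<in> carrier ?R" for i
    using assms(2) by (auto simp: poly_ring_simps intro!: mvar_in_polys)
qed (use assms in \<open>auto simp: free_module_ops poly_ring_simps var_quot_mvar_mult_other nth_eq_iff_index_eq\<close>)

lemma koszul_exact_projective:
  fixes V :: "'v set" and k :: "'k::field itself" and P :: "(('v, 'k) mpoly, 'p, 'l) module_scheme"
  assumes "projective_module (poly_ring k V) P" "distinct xs" "set xs \<subseteq> V" "s \<le> length xs"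
  shows "koszul_exact P (carrier P) (\<lambda>i. if i < length xs then mvar (xs ! i) else 0) (length xs) s"
proof -
  obtain B :: "'p set" and f g where fg: "f \<in> mod_hom (poly_ring k V) P (free_module (poly_ring k V) B)"
    "g \<in> mod_hom (poly_ring k V) (free_module (poly_ring k V) B) P" "\<forall>x\<in>carrier P. g (f x) = x"
    by (rule projective_retract[OF assms(1)])
  show ?thesis
  proof (rule koszul_exact_retract[OF _ _ _ fg(1,2) _ koszul_exact_free[OF assms(2-4)]])
    show "g (f x) = x" if "x \<in> carrier P" for x using fg(3) that by blast
    show "Module.module (poly_ring k V) P" using assms(1) by (simp add: projective_module_def)
    show "Module.module (poly_ring k V) (free_module (poly_ring k V) B)"
      by (intro module_free_module cring_poly_ring)
    show "(if i < length xs then mvar (xs ! i) else 0) \<in> carrier (poly_ring k V)" for i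
      using assms(3) by (auto simp: poly_ring_simps intro!: mvar_in_polys)
  qed
qed

text \<open>A nonzero element of \<open>M\<close> killed by \<open>c\<close> variables forces every projective resolution to have length at least \<open>c\<close>:
  it is a cocycle of degree zero, but for \<open>l < c\<close> exactness passes down from the last term of the resolution to \<open>M\<close>,
  losing one degree at every syzygy.\<close>

lemma projective_resolution_length:
  fixes V :: "'v set" and k :: "'k::field itself"
  assumes res: "projective_resolution (poly_ring k V) M P d e" "\<And>i. i > l \<Longrightarrow> carrier (P i) = {\<zero>\<^bsub>P i\<^esub>}"
    and M: "Module.module (poly_ring k V) M"
    and xs: "distinct xs" "set xs \<subseteq> V"
    and u: "u \<in> carrier M" "u \<noteq> \<zero>\<^bsub>M\<^esub>" "\<And>x. x \<in> set xs \<Longrightarrow> mvar x \<odot>\<^bsub>M\<^esub> u = \<zero>\<^bsub>M\<^esub>"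
  shows "length xs \<le> l"
proof (rule ccontr)
  assume "\<not> length xs \<le> l"
  let ?c = "length xs" and ?R = "poly_ring k V"
  define y where "y i = (if i < length xs then mvar (xs ! i) else 0 :: ('v, 'k) mpoly)" for i
  have "\<forall>i. projective_module ?R (P i)" and e: "e \<in> mod_hom ?R (P 0) M"
    and "\<forall>i. d i \<in> mod_hom ?R (P (Suc i)) (P i)" and e_surj: "e ` carrier (P 0) = carrier M"
    and d0: "d 0 ` carrier (P 1) = mod_ker (P 0) M e"
    and "\<forall>i. d (Suc i) ` carrier (P (Suc (Suc i))) = mod_ker (P (Suc i)) (P i) (d i)"
    using res(1) unfolding projective_resolution_def by - (elim conjE, assumption)+
  then have proj: "projective_module ?R (P i)" and d: "d i \<in> mod_hom ?R (P (Suc i)) (P i)"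
    and ker: "mod_ker (P (Suc i)) (P i) (d i) = d (Suc i) ` carrier (P (Suc (Suc i)))" for i
    by simp_all
  have P: "Module.module ?R (P i)" for i using proj[of i] by (simp add: projective_module_def)
  have exact: "koszul_exact (P i) (carrier (P i)) y ?c s" if "s \<le> ?c" for i s
    unfolding y_def by (rule koszul_exact_projective[OF proj xs that])
  have y: "y i \<in> carrier ?R" for i
    using xs(2) by (auto simp: y_def poly_ring_simps intro!: mvar_in_polys)
  have syz: "koszul_exact (P (l - j)) (d (l - j) ` carrier (P (Suc (l - j)))) y ?c s"
    if "j \<le> l" "s + j \<le> ?c + 1" for j s
    using that
  proof (induction j arbitrary: s)
    case 0
    have zero: "d l ` carrier (P (Suc l)) = {\<zero>\<^bsub>P l\<^esub>}"
      using res(2)[of "Suc l"] mod_hom_zero[OF P P d[of l]] by simp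
    interpret Pl: Module.module ?R "P l" by (rule P)
    have "koszul (P l) y ?c (\<lambda>_. \<zero>\<^bsub>P l\<^esub>) T = \<zero>\<^bsub>P l\<^esub>" if "T \<subseteq> {..<?c}" for T
      using finite_subset[OF that] by (intro Pl.koszul_support y) auto
    then show ?case unfolding zero minus_nat.diff_0
      by (intro koszul_exactI exI[of _ "\<lambda>_. \<zero>\<^bsub>P l\<^esub>"]) auto
  next
    case (Suc j)
    define i where "i = l - Suc j"
    have i: "l - j = Suc i" using Suc.prems by (simp add: i_def)
    have "koszul_exact (P (Suc i)) (d (Suc i) ` carrier (P (Suc (Suc i)))) y ?c (Suc s)"
      using Suc.IH[of "Suc s"] Suc.prems i by simp
    then have "koszul_exact (P i) (d i ` carrier (P (Suc i))) y ?c s"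
      using Suc.prems by (intro koszul_exact_image[OF P P y d exact]) (simp_all add: ker)
    then show ?case by (simp add: i_def)
  qed
  have "koszul_exact (P 0) (d 0 ` carrier (P (Suc 0))) y ?c (Suc 1)"
    using syz[of l "Suc 1"] \<open>\<not> length xs \<le> l\<close> by simp
  then have "koszul_exact M (e ` carrier (P 0)) y ?c 1"
    using d0 \<open>\<not> length xs \<le> l\<close> by (intro koszul_exact_image[OF P M y e exact]) auto
  then have M1: "koszul_exact M (carrier M) y ?c 1" using e_surj by simp
  interpret M: Module.module ?R M by (rule M)
  define a where "a T = (if T = {} then u else \<zero>\<^bsub>M\<^esub>)" for T :: "nat set"
  have "koszul M y c a T = \<zero>\<^bsub>M\<^esub>" if "c \<le> ?c" "T \<subseteq> {..<c}" for c T
    using that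
  proof (induction c arbitrary: T)
    case (Suc c)
    show ?case
    proof (cases "c \<in> T")
      case True
      have "koszul M y c (\<lambda>U. a (insert c U)) (T - {c}) = koszul M y c (\<lambda>U. \<zero>\<^bsub>M\<^esub>) (T - {c})"
        by (simp add: a_def)
      also have "\<dots> = \<zero>\<^bsub>M\<^esub>"
        using finite_subset[OF Suc.prems(2)] y by (intro M.koszul_support) auto
      finally have "koszul M y c (\<lambda>U. a (insert c U)) (T - {c}) = \<zero>\<^bsub>M\<^esub>" .
      moreover have "y c \<odot>\<^bsub>M\<^esub> u = \<zero>\<^bsub>M\<^esub>" using Suc.prems(1) u(3)[of "xs ! c"] by (simp add: y_def)
      then have "y c \<odot>\<^bsub>M\<^esub> a (T - {c}) = \<zero>\<^bsub>M\<^esub>" using y[of c] by (simp add: a_def)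
      ultimately show ?thesis using True by simp
    next
      case False
      then have "T \<subseteq> {..<c}" using Suc.prems(2) by (auto simp: lessThan_Suc)
      then show ?thesis using False Suc by simp
    qed
  qed simp
  then have "\<exists>b. koszul_primitive M (carrier M) y ?c 1 a b"
  proof (intro koszul_exactD[OF M1])
    show "a T \<in> carrier M" for T using u(1) by (simp add: a_def)
    show "a T = \<zero>\<^bsub>M\<^esub>" if "1 \<le> card T" for T using that by (auto simp: a_def)
  qed simp_all
  then obtain b where b: "\<And>T. T \<subseteq> {..<?c} \<Longrightarrow> b T = \<zero>\<^bsub>M\<^esub>" "a {} = koszul M y ?c b {}" by auto
  have "u = \<zero>\<^bsub>M\<^esub>"
    using b(2) M.koszul_support[of "{}" y b ?c] y by (simp add: a_def)
  then show False using u(2) by simp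
qed

lemma quotient_module_simps:
  "carrier (quotient_module R I) = carrier (R Quot I)" "\<zero>\<^bsub>quotient_module R I\<^esub> = \<zero>\<^bsub>R Quot I\<^esub>"
  "x \<oplus>\<^bsub>quotient_module R I\<^esub> y = x \<oplus>\<^bsub>R Quot I\<^esub> y" "r \<odot>\<^bsub>quotient_module R I\<^esub> x = (I +>\<^bsub>R\<^esub> r) \<otimes>\<^bsub>R Quot I\<^esub> x"
  by (simp_all add: quotient_module_def)

lemma module_quotient_module:
  assumes "cring R" "ideal I R" shows "Module.module R (quotient_module R I)"
proof -
  interpret ideal I R by fact
  interpret Q: cring "R Quot I" using assms(1) by (rule quotient_is_cring)
  note h = rcos_ring_hom
  show ?thesis
  proof (rule moduleI)
    show "abelian_group (quotient_module R I)"
    proof (rule abelian_groupI)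
      fix x assume "x \<in> carrier (quotient_module R I)"
      then show "\<exists>y\<in>carrier (quotient_module R I). y \<oplus>\<^bsub>quotient_module R I\<^esub> x = \<zero>\<^bsub>quotient_module R I\<^esub>"
        by (intro bexI[of _ "\<ominus>\<^bsub>R Quot I\<^esub> x"]) (auto simp: quotient_module_simps Q.l_neg)
    qed (auto simp: quotient_module_simps Q.a_ac)
  qed (use assms(1) in \<open>auto simp: quotient_module_simps ring_hom_add[OF h] ring_hom_mult[OF h] ring_hom_one[OF h]
      ring_hom_closed[OF h] Q.l_distr Q.r_distr Q.m_assoc\<close>)
qed

lemma (in ideal) rcos_zero_iff:
  "w \<in> carrier R \<Longrightarrow> I +> w = \<zero>\<^bsub>R Quot I\<^esub> \<longleftrightarrow> w \<in> I"
  using a_rcos_self[of w] a_rcos_const[of w] by (auto simp: FactRing_def)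

lemma projective_dimension_ge:
  fixes V :: "'v set" and k :: "'k::field itself"
  assumes "ideal I (poly_ring k V)" "w \<in> polys V" "w \<notin> I" "distinct xs" "set xs \<subseteq> V"
    "\<And>x. x \<in> set xs \<Longrightarrow> mvar x * w \<in> I"
  shows "enat (length xs) \<le> projective_dimension (poly_ring k V) (quotient_module (poly_ring k V) I)"
proof -
  let ?R = "poly_ring k V"
  interpret R: cring ?R by (rule cring_poly_ring)
  interpret ideal I ?R by fact
  have w: "I +>\<^bsub>?R\<^esub> w \<in> carrier (?R Quot I)"
    using ring_hom_closed[OF rcos_ring_hom] assms(2) by (simp add: poly_ring_simps)
  have x: "mvar x \<odot>\<^bsub>quotient_module ?R I\<^esub> (I +>\<^bsub>?R\<^esub> w) = \<zero>\<^bsub>quotient_module ?R I\<^esub>"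
    if x: "x \<in> set xs" for x
  proof -
    have c: "mvar x \<in> carrier ?R" "w \<in> carrier ?R"
      using x assms(2,5) by (auto simp: poly_ring_simps intro: mvar_in_polys)
    have "(I +>\<^bsub>?R\<^esub> mvar x) \<otimes>\<^bsub>?R Quot I\<^esub> (I +>\<^bsub>?R\<^esub> w) = I +>\<^bsub>?R\<^esub> (mvar x * w)"
      using ring_hom_mult[OF rcos_ring_hom c] by (simp add: poly_ring_simps)
    also have "\<dots> = \<zero>\<^bsub>?R Quot I\<^esub>"
      using c assms(6)[OF x] by (subst rcos_zero_iff) (auto simp: poly_ring_simps polys_mult)
    finally show ?thesis by (simp add: quotient_module_simps)
  qed
  show ?thesis unfolding projective_dimension_def
  proof (rule Inf_greatest, clarify)
    fix l and P :: "nat \<Rightarrow> (('v, 'k) mpoly, (('v, 'k) mpoly + ('v, 'k) mpoly set) list) module" and d e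
    assume res: "projective_resolution ?R (quotient_module ?R I) P d e" "\<forall>i>l. carrier (P i) = {\<zero>\<^bsub>P i\<^esub>}"
    have "length xs \<le> l"
      using res(2) w x assms(2,3,4,5) rcos_zero_iff[of w]
      by (intro projective_resolution_length[OF res(1) _ module_quotient_module[OF R.cring_axioms assms(1)],
            where u = "I +>\<^bsub>?R\<^esub> w"])
        (auto simp: quotient_module_simps poly_ring_simps)
    then show "enat (length xs) \<le> enat l" by simp
  qed
qed

section \<open>Projective resolutions from free ones\<close>

lemma subring_set_polys: "subring_set (polys V)"
  by unfold_locales (auto intro: polys_add polys_mult polys_uminus)

context subring_set
begin

text \<open>Here \<open>f\<close> augments the resolution \<open>\<dots> \<rightarrow> vecs (m 1) \<rightarrow> vecs (m 0) \<rightarrow> K\<close>, whose differentials are the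
  maps \<open>D i\<close>.\<close>

lemma pd_less_free_sequence:
  assumes "pd_less n K {0}" "submod K"
  obtains m D f where "linear_on (vecs (m 0)) f" "f ` vecs (m 0) = K"
    "{v \<in> vecs (m 0). f v = 0} = D 0 ` vecs (m 1)"
    "\<forall>i. linear_on (vecs (m (Suc i))) (D i)" "\<forall>i. D i ` vecs (m (Suc i)) \<subseteq> vecs (m i)"
    "\<forall>i. {v \<in> vecs (m (Suc i)). D i v = 0} = D (Suc i) ` vecs (m (Suc (Suc i)))"
    "\<forall>i\<ge>n. m i = 0"
  using assms
proof (induction n arbitrary: K thesis)
  case 0
  have "K = {0}" using submodD(1)[OF "0.prems"(3)] "0.prems"(2) by auto
  then show ?case
    by (intro "0.prems"(1)[of "\<lambda>_. 0" "\<lambda>_. 0" "\<lambda>_ _. 0"]) (auto simp: vecs_0 linear_on_def smul_algebra)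
next
  case (Suc n)
  obtain m0 f0 where f0: "linear_on (vecs m0) f0" "f0 ` vecs m0 \<subseteq> K" "\<forall>a\<in>K. \<exists>v\<in>vecs m0. a - f0 v \<in> {0}"
    "pd_less n {v \<in> vecs m0. f0 v \<in> {0}} {0}" using Suc.prems(2) by auto
  obtain m D f where D: "linear_on (vecs (m 0)) f" "f ` vecs (m 0) = {v \<in> vecs m0. f0 v \<in> {0}}"
    "{v \<in> vecs (m 0). f v = 0} = D 0 ` vecs (m 1)"
    "\<forall>i. linear_on (vecs (m (Suc i))) (D i)" "\<forall>i. D i ` vecs (m (Suc i)) \<subseteq> vecs (m i)"
    "\<forall>i. {v \<in> vecs (m (Suc i)). D i v = 0} = D (Suc i) ` vecs (m (Suc (Suc i)))"
    "\<forall>i\<ge>n. m i = 0"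
    by (rule Suc.IH[OF _ f0(4) submod_vimage[OF f0(1) submod_vecs submod_zero]])
  show ?case
  proof (rule Suc.prems(1)[of "case_nat m0 m" f0 "case_nat f D"])
    show "f0 ` vecs (case_nat m0 m 0) = K" using f0(2,3) by force
    show "{v \<in> vecs (case_nat m0 m 0). f0 v = 0} = case_nat f D 0 ` vecs (case_nat m0 m 1)"
      using D(2) by simp
    show "\<forall>i. linear_on (vecs (case_nat m0 m (Suc i))) (case_nat f D i)"
      using D(1,4) by (auto split: nat.split)
    show "\<forall>i. case_nat f D i ` vecs (case_nat m0 m (Suc i)) \<subseteq> vecs (case_nat m0 m i)"
      using D(2,5) by (simp split: nat.split)
    show "\<forall>i. {v \<in> vecs (case_nat m0 m (Suc i)). case_nat f D i v = 0} =
        case_nat f D (Suc i) ` vecs (case_nat m0 m (Suc (Suc i)))"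
      using D(3,6) by (simp split: nat.split)
    show "\<forall>i\<ge>Suc n. case_nat m0 m i = 0" using D(7) by (simp split: nat.split)
  qed (use f0(1) in simp)
qed

end

text \<open>The copy of \<open>S\<^sup>m\<close> whose elements are the lists of length \<open>m\<close>, in a type that can carry the terms of a
  resolution.\<close>

definition encode :: "nat \<Rightarrow> (nat \<Rightarrow> 'r) \<Rightarrow> ('r + 'm) list"
  where "encode m v = map (\<lambda>i. Inl (v i)) [0..<m]"

definition decode :: "nat \<Rightarrow> ('r + 'm) list \<Rightarrow> nat \<Rightarrow> 'r::zero"
  where "decode m w = (\<lambda>i. if i < m then projl (w ! i) else 0)"

definition list_module :: "'r::comm_ring_1 set \<Rightarrow> nat \<Rightarrow> ('r, ('r + 'm) list) module"
  where "list_module S m =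
    \<lparr>carrier = encode m ` subring_set.vecs S m, mult = (\<lambda>x y. x), one = [],
     zero = encode m 0, add = (\<lambda>x y. encode m (decode m x + decode m y)),
     smult = (\<lambda>r x. encode m (smul r (decode m x)))\<rparr>"

lemma list_module_simps:
  "carrier (list_module S m) = encode m ` subring_set.vecs S m" "\<zero>\<^bsub>list_module S m\<^esub> = encode m 0"
  "x \<oplus>\<^bsub>list_module S m\<^esub> y = encode m (decode m x + decode m y)"
  "r \<odot>\<^bsub>list_module S m\<^esub> x = encode m (smul r (decode m x))"
  by (simp_all add: list_module_def)

lemma (in subring_set) decode_encode: "v \<in> vecs m \<Longrightarrow> decode m (encode m v) = v"
  by (auto simp: decode_def encode_def vecs_def fun_eq_iff)

lemma module_list_module:
  "Module.module (poly_ring k V) (list_module (polys V) m :: (_, (('v, 'k::field) mpoly + 'm) list) module)"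
proof -
  interpret subring_set "polys V :: ('v, 'k) mpoly set" by (rule subring_set_polys)
  note vecs = submodD[OF submod_vecs]
  let ?M = "list_module (polys V) m :: (_, (('v, 'k) mpoly + 'm) list) module"
  show ?thesis
  proof (rule moduleI)
    show "cring (poly_ring k V)" by (rule cring_poly_ring)
    show "abelian_group ?M"
    proof (rule abelian_groupI)
      fix x :: "(('v, 'k) mpoly + 'm) list" assume "x \<in> carrier ?M"
      then obtain v where "v \<in> vecs m" "x = encode m v" by (auto simp: list_module_simps)
      then show "\<exists>y\<in>carrier ?M. y \<oplus>\<^bsub>?M\<^esub> x = \<zero>\<^bsub>?M\<^esub>"
        by (intro bexI[of _ "encode m (- v)"]) (auto simp: list_module_simps decode_encode vecs)
    qed (auto simp: list_module_simps decode_encode vecs add_ac)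
  qed (auto simp: list_module_simps poly_ring_simps decode_encode vecs smul_algebra)
qed

lemma projective_list_module:
  "projective_module (poly_ring k V) (list_module (polys V) m :: (_, (('v, 'k::field) mpoly + 'm) list) module)"
proof -
  interpret subring_set "polys V :: ('v, 'k) mpoly set" by (rule subring_set_polys)
  note vecs = submodD[OF submod_vecs]
  let ?R = "poly_ring k V"
  let ?M = "list_module (polys V) m :: (_, (('v, 'k) mpoly + 'm) list) module"
  \<comment> \<open>any \<open>m\<close> distinct lists can serve as a basis; these have different lengths\<close>
  define b where "b i = replicate i (Inl 0 :: ('v, 'k) mpoly + 'm)" for i :: nat
  define B where "B = b ` {..<m}"
  define F where "F = free_module ?R B"
  have length_b: "length (b i) = i" for i by (simp add: b_def)
  then have "b i = b j \<longleftrightarrow> i = j" for i j by metis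
  then have inB: "b i \<in> B \<longleftrightarrow> i < m" for i by (auto simp: B_def)
  have B_b: "z = b (length z)" and lenB: "length z < m" if "z \<in> B" for z
    using that by (auto simp: B_def length_b)
  have finB: "finite B" by (simp add: B_def)
  interpret F: Module.module ?R F
  proof -
    have "Module.module ?R (free_module ?R B)" for B :: "(('v, 'k) mpoly + 'm) list set"
      by (rule module_free_module[OF cring_poly_ring])
    then show "Module.module ?R F" by (simp add: F_def)
  qed
  define \<phi> :: "(('v, 'k) mpoly + 'm) list \<Rightarrow> (('v, 'k) mpoly + 'm) list \<Rightarrow> ('v, 'k) mpoly"
    where "\<phi> x z = (if z \<in> B then decode m x (length z) else 0)" for x z
  have \<phi>_hom: "\<phi> \<in> mod_hom ?R ?M F"
    unfolding mod_hom_def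
  proof (intro CollectI conjI ballI Pi_I)
    fix x assume "x \<in> carrier ?M"
    then obtain v where v: "v \<in> vecs m" "x = encode m v" by (auto simp: list_module_simps)
    have "finite {z. \<phi> x z \<noteq> 0}" by (rule finite_subset[OF _ finB]) (auto simp: \<phi>_def)
    then show "\<phi> x \<in> carrier F"
      using v lenB by (auto simp: F_def free_module_def poly_ring_simps \<phi>_def decode_encode vecs_coeff)
  next
    fix x y assume "x \<in> carrier ?M" "y \<in> carrier ?M"
    then show "\<phi> (x \<oplus>\<^bsub>?M\<^esub> y) = \<phi> x \<oplus>\<^bsub>F\<^esub> \<phi> y"
      by (auto simp: list_module_simps F_def free_module_def poly_ring_simps \<phi>_def decode_encode vecs fun_eq_iff vec_apply)
  next
    fix r x assume "r \<in> carrier ?R" "x \<in> carrier ?M"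
    then show "\<phi> (r \<odot>\<^bsub>?M\<^esub> x) = r \<odot>\<^bsub>F\<^esub> \<phi> x"
      by (auto simp: list_module_simps F_def free_module_def poly_ring_simps \<phi>_def decode_encode vecs fun_eq_iff vec_apply)
  qed
  have "bij_betw \<phi> (carrier ?M) (carrier F)"
  proof (rule bij_betw_byWitness[where f' = "\<lambda>g. encode m (\<lambda>i. if i < m then g (b i) else 0)"])
    show "\<forall>x\<in>carrier ?M. encode m (\<lambda>i. if i < m then \<phi> x (b i) else 0) = x"
    proof
      fix x assume "x \<in> carrier ?M"
      then obtain v where v: "v \<in> vecs m" "x = encode m v" by (auto simp: list_module_simps)
      have "(\<lambda>i. if i < m then \<phi> x (b i) else 0) = v"
        using v(1) by (auto simp: \<phi>_def inB length_b v(2) decode_encode vecs_def[of m] fun_eq_iff)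
      then show "encode m (\<lambda>i. if i < m then \<phi> x (b i) else 0) = x" using v(2) by simp
    qed
    have "\<phi> (encode m (\<lambda>i. if i < m then g (b i) else 0)) z = g z" if g: "g \<in> carrier F" for g z
    proof (cases "z \<in> B")
      case True
      then have "g (b (length z)) = g z" using B_b[OF True] by simp
      then show ?thesis using True lenB[OF True] by (simp add: \<phi>_def decode_def encode_def)
    next
      case False
      then show ?thesis using g by (simp add: \<phi>_def F_def free_module_def poly_ring_simps)
    qed
    then show "\<forall>g\<in>carrier F. \<phi> (encode m (\<lambda>i. if i < m then g (b i) else 0)) = g" by blast
    show "\<phi> ` carrier ?M \<subseteq> carrier F" using mod_hom_closed[OF \<phi>_hom] by blast
    have "(\<lambda>i. if i < m then g (b i) else 0) \<in> vecs m" if "g \<in> carrier F" for g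
      using that by (auto simp: vecs_def F_def free_module_def poly_ring_simps inB)
    then show "(\<lambda>g. encode m (\<lambda>i. if i < m then g (b i) else 0)) ` carrier F \<subseteq> carrier ?M"
      by (auto simp: list_module_simps)
  qed
  moreover have "submodule {\<zero>\<^bsub>F\<^esub>} ?R F" by (rule F.submoduleI) auto
  moreover have "carrier F <+>\<^bsub>F\<^esub> {\<zero>\<^bsub>F\<^esub>} = carrier F" by (auto simp: set_add_def')
  moreover have "carrier F \<inter> {\<zero>\<^bsub>F\<^esub>} = {\<zero>\<^bsub>F\<^esub>}" by auto
  moreover have "F\<lparr>carrier := carrier F\<rparr> = F" by simp
  ultimately show ?thesis
    unfolding projective_module_def Let_def using \<phi>_hom module_list_module F.carrier_is_submodule
    by (intro conjI exI[of _ B] exI[of _ "carrier F"] exI[of _ "{\<zero>\<^bsub>F\<^esub>}"] bexI[of _ \<phi>])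
      (simp_all add: F_def[symmetric])
qed

lemma mod_hom_list_module:
  assumes "subring_set.linear_on (polys V) (subring_set.vecs (polys V) m) f"
    "f ` subring_set.vecs (polys V) m \<subseteq> subring_set.vecs (polys V) m'"
  shows "encode m' \<circ> f \<circ> decode m \<in> mod_hom (poly_ring k V)
    (list_module (polys V) m :: (_, (('v, 'k::field) mpoly + 'm) list) module)
    (list_module (polys V) m' :: (_, (('v, 'k) mpoly + 'm) list) module)"
proof -
  interpret subring_set "polys V :: ('v, 'k) mpoly set" by (rule subring_set_polys)
  note lin = linear_onD[OF assms(1) submod_vecs]
  have f: "f v \<in> vecs m'" if "v \<in> vecs m" for v using assms(2) that by blast
  show ?thesis unfolding mod_hom_def
    by (auto simp: list_module_simps poly_ring_simps decode_encode f lin submodD[OF submod_vecs])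
qed

lemma projective_dimension_le:
  fixes V :: "'v set" and k :: "'k::field itself" and I :: "('v, 'k) mpoly set"
  assumes I: "ideal I (poly_ring k V)"
    and pd: "subring_set.pd_less (polys V) (Suc l) (subring_set.vec1 (polys V)) (subring_set.vec1 I)"
  shows "projective_dimension (poly_ring k V) (quotient_module (poly_ring k V) I) \<le> enat l"
proof -
  interpret subring_set "polys V :: ('v, 'k) mpoly set" by (rule subring_set_polys)
  interpret R: cring "poly_ring k V" by (rule cring_poly_ring)
  interpret I: ideal I "poly_ring k V" by (rule I)
  let ?R = "poly_ring k V"
  note hom = I.rcos_ring_hom
  have ideal: "ideal_set I"
    using I.Icarr I.zero_closed I.a_closed I.I_l_closed by (auto simp: ideal_set_def poly_ring_simps)
  obtain m0 f0 where f0: "linear_on (vecs m0) f0" "f0 ` vecs m0 \<subseteq> vec1 (polys V)"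
      "\<forall>a\<in>vec1 (polys V). \<exists>v\<in>vecs m0. a - f0 v \<in> vec1 I" "pd_less l {v \<in> vecs m0. f0 v \<in> vec1 I} {0}"
    using pd by auto
  obtain m D f where D: "linear_on (vecs (m 0)) f" "f ` vecs (m 0) = {v \<in> vecs m0. f0 v \<in> vec1 I}"
    "{v \<in> vecs (m 0). f v = 0} = D 0 ` vecs (m 1)"
    "\<forall>i. linear_on (vecs (m (Suc i))) (D i)" "\<forall>i. D i ` vecs (m (Suc i)) \<subseteq> vecs (m i)"
    "\<forall>i. {v \<in> vecs (m (Suc i)). D i v = 0} = D (Suc i) ` vecs (m (Suc (Suc i)))"
    "\<forall>i\<ge>l. m i = 0"
    by (rule pd_less_free_sequence[OF f0(4) submod_vimage[OF f0(1) submod_vecs submod_vec1[OF ideal]]])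
  define n where "n = case_nat m0 m"
  define E where "E = case_nat f D"
  have E: "linear_on (vecs (n (Suc i))) (E i)" "E i ` vecs (n (Suc i)) \<subseteq> vecs (n i)"
    "{v \<in> vecs (n (Suc i)). E i v = 0} = E (Suc i) ` vecs (n (Suc (Suc i)))" for i
    using D by (auto simp: n_def E_def split: nat.split)
  define P :: "nat \<Rightarrow> (('v, 'k) mpoly, (('v, 'k) mpoly + ('v, 'k) mpoly set) list) module"
    where "P i = list_module (polys V) (n i)" for i
  define d :: "nat \<Rightarrow> (('v, 'k) mpoly + ('v, 'k) mpoly set) list \<Rightarrow> (('v, 'k) mpoly + ('v, 'k) mpoly set) list"
    where "d i = encode (n i) \<circ> E i \<circ> decode (n (Suc i))" for i
  define e :: "(('v, 'k) mpoly + ('v, 'k) mpoly set) list \<Rightarrow> ('v, 'k) mpoly set"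
    where "e x = I +>\<^bsub>?R\<^esub> f0 (decode m0 x) 0" for x
  have f0_in: "f0 v 0 \<in> polys V" "f0 v \<in> vec1 I \<longleftrightarrow> f0 v 0 \<in> I" if "v \<in> vecs m0" for v
    using f0(2) that by (auto simp: vec1_def)
  have carrier_P: "carrier (P i) = encode (n i) ` vecs (n i)" for i
    by (simp add: P_def list_module_simps)
  have d_image: "d i ` carrier (P (Suc i)) = encode (n i) ` E i ` vecs (n (Suc i))" for i
    by (force simp: carrier_P d_def decode_encode)
  have "projective_resolution ?R (quotient_module ?R I) P d e"
    unfolding projective_resolution_def
  proof (intro conjI allI)
    show "projective_module ?R (P i)" for i unfolding P_def by (rule projective_list_module)
    show "d i \<in> mod_hom ?R (P (Suc i)) (P i)" for i
      unfolding P_def d_def using E(1,2) by (rule mod_hom_list_module)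
    show e: "e \<in> mod_hom ?R (P 0) (quotient_module ?R I)"
      unfolding mod_hom_def
    proof (intro CollectI conjI ballI Pi_I)
      fix x assume "x \<in> carrier (P 0)"
      then show "e x \<in> carrier (quotient_module ?R I)"
        by (auto simp: carrier_P n_def e_def decode_encode quotient_module_simps poly_ring_simps f0_in
            intro!: ring_hom_closed[OF hom])
    next
      fix x y assume "x \<in> carrier (P 0)" "y \<in> carrier (P 0)"
      then obtain u v where "u \<in> vecs m0" "v \<in> vecs m0" "x = encode m0 u" "y = encode m0 v"
        by (auto simp: carrier_P n_def)
      then show "e (x \<oplus>\<^bsub>P 0\<^esub> y) = e x \<oplus>\<^bsub>quotient_module ?R I\<^esub> e y"
        using ring_hom_add[OF hom, of "f0 u 0" "f0 v 0"] f0_in linear_onD(1)[OF f0(1) submod_vecs, of u v]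
        by (simp add: P_def n_def e_def list_module_simps decode_encode submodD[OF submod_vecs]
            quotient_module_simps poly_ring_simps vec_apply)
    next
      fix r x assume "r \<in> carrier ?R" "x \<in> carrier (P 0)"
      then obtain u where "r \<in> polys V" "u \<in> vecs m0" "x = encode m0 u"
        by (auto simp: carrier_P n_def poly_ring_simps)
      then show "e (r \<odot>\<^bsub>P 0\<^esub> x) = r \<odot>\<^bsub>quotient_module ?R I\<^esub> e x"
        using ring_hom_mult[OF hom, of r "f0 u 0"] f0_in linear_onD(2)[OF f0(1) submod_vecs, of r u]
        by (simp add: P_def n_def e_def list_module_simps decode_encode submodD[OF submod_vecs]
            quotient_module_simps poly_ring_simps vec_apply)
    qed
    show "e ` carrier (P 0) = carrier (quotient_module ?R I)"
    proof (intro equalityI subsetI)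
      fix C assume "C \<in> carrier (quotient_module ?R I)"
      then obtain r where r: "r \<in> polys V" "C = I +>\<^bsub>?R\<^esub> r"
        by (auto simp: quotient_module_simps FactRing_def A_RCOSETS_def' poly_ring_simps)
      have "(\<lambda>i. if i = 0 then r else 0) \<in> vec1 (polys V)" using r(1) by (simp add: vec1_def)
      then obtain v where v: "v \<in> vecs m0" "(\<lambda>i. if i = 0 then r else 0) - f0 v \<in> vec1 I" using f0(3) by blast
      then have diff: "r - f0 v 0 \<in> I" by (simp add: vec1_def vec_apply)
      have "I +>\<^bsub>?R\<^esub> r = (I +>\<^bsub>?R\<^esub> (r - f0 v 0)) \<oplus>\<^bsub>?R Quot I\<^esub> (I +>\<^bsub>?R\<^esub> f0 v 0)"
        using ring_hom_add[OF hom, of "r - f0 v 0" "f0 v 0"] r(1) f0_in(1)[OF v(1)]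
        by (simp add: poly_ring_simps polys_diff)
      also have "I +>\<^bsub>?R\<^esub> (r - f0 v 0) = \<zero>\<^bsub>?R Quot I\<^esub>"
        using diff r(1) f0_in(1)[OF v(1)] by (subst I.rcos_zero_iff) (auto simp: poly_ring_simps polys_diff)
      also have "\<zero>\<^bsub>?R Quot I\<^esub> \<oplus>\<^bsub>?R Quot I\<^esub> (I +>\<^bsub>?R\<^esub> f0 v 0) = I +>\<^bsub>?R\<^esub> f0 v 0"
        using ring.ring_simprules(8)[OF I.quotient_is_ring] ring_hom_closed[OF hom] f0_in(1)[OF v(1)]
        by (simp add: poly_ring_simps)
      finally have "C = e (encode m0 v)" using r(2) v(1) by (simp add: e_def decode_encode)
      then show "C \<in> e ` carrier (P 0)" using v(1) by (simp add: carrier_P n_def)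
    next
      fix C assume "C \<in> e ` carrier (P 0)"
      then show "C \<in> carrier (quotient_module ?R I)" using e by (auto dest: mod_hom_closed)
    qed
    have "mod_ker (P 0) (quotient_module ?R I) e = encode m0 ` {v \<in> vecs m0. f0 v \<in> vec1 I}"
    proof -
      have "e (encode m0 v) = \<zero>\<^bsub>?R Quot I\<^esub> \<longleftrightarrow> f0 v \<in> vec1 I" if "v \<in> vecs m0" for v
        using I.rcos_zero_iff[of "f0 v 0"] f0_in[OF that] that by (simp add: poly_ring_simps e_def decode_encode)
      moreover have "mod_ker (P 0) (quotient_module ?R I) e = {x \<in> encode m0 ` vecs m0. e x = \<zero>\<^bsub>?R Quot I\<^esub>}"
        by (simp add: mod_ker_def carrier_P n_def quotient_module_simps)
      ultimately show ?thesis by auto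
    qed
    then show "d 0 ` carrier (P 1) = mod_ker (P 0) (quotient_module ?R I) e"
      using d_image[of 0] D(2) by (simp add: n_def E_def)
    fix i
    have "mod_ker (P (Suc i)) (P i) (d i) = encode (n (Suc i)) ` {v \<in> vecs (n (Suc i)). E i v = 0}"
    proof -
      have "encode (n i) (E i v) = (encode (n i) 0 :: (('v, 'k) mpoly + ('v, 'k) mpoly set) list) \<longleftrightarrow> E i v = 0"
        if "v \<in> vecs (n (Suc i))" for v
        using decode_encode[of "E i v" "n i"] decode_encode[of 0 "n i"] E(2) that submodD(1)[OF submod_vecs]
        by (metis image_subset_iff)
      then show ?thesis
        by (auto simp: mod_ker_def carrier_P d_def decode_encode) (auto simp: P_def list_module_simps)
    qed
    then show "d (Suc i) ` carrier (P (Suc (Suc i))) = mod_ker (P (Suc i)) (P i) (d i)"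
      using d_image[of "Suc i"] E(3)[of i] by simp
  qed
  moreover have "\<forall>i>l. carrier (P i) = {\<zero>\<^bsub>P i\<^esub>}"
  proof (intro allI impI)
    fix i assume "i > l"
    then have "n i = 0" using D(7) by (auto simp: n_def split: nat.split)
    then show "carrier (P i) = {\<zero>\<^bsub>P i\<^esub>}" by (simp add: P_def list_module_simps vecs_0)
  qed
  ultimately show ?thesis unfolding projective_dimension_def by (intro Inf_lower) blast
qed

section \<open>An upper bound from shedding vertices\<close>

text \<open>The neighbourhood of \<open>x\<close>.\<close>

definition nbrs :: "'v graph \<Rightarrow> 'v \<Rightarrow> 'v set"
  where "nbrs G x = {y. {x, y} \<in> edges G}"

text \<open>\<open>A\<close> is a maximal independent set of the graph that remains after deleting the vertices in \<open>D\<close>.\<close>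

definition max_indep :: "'v graph \<Rightarrow> 'v set \<Rightarrow> 'v set \<Rightarrow> bool"
  where "max_indep G D A \<longleftrightarrow> A \<subseteq> verts G - D \<and> (\<forall>e\<in>edges G. \<not> e \<subseteq> A) \<and>
    (\<forall>z\<in>verts G - D - A. nbrs G z \<inter> A \<noteq> {})"

text \<open>The sum of the edge ideal and the ideal generated by the variables in \<open>D\<close>.\<close>

definition edge_var_ideal :: "'v graph \<Rightarrow> 'v set \<Rightarrow> ('v, 'k::field) mpoly set"
  where "edge_var_ideal G D = mon_ideal (verts G) (\<lambda>m. has_edge G m \<or> meets D m)"

lemma nbrs_sym: "y \<in> nbrs G x \<longleftrightarrow> x \<in> nbrs G y"
  by (simp add: nbrs_def insert_commute)

lemma edge_pair:
  assumes "finite_simple_graph G" "e \<in> edges G" "x \<in> e"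
  obtains y where "e = {x, y}" "y \<noteq> x" "y \<in> nbrs G x"
proof -
  have "card e = 2" using assms by (simp add: finite_simple_graph_def)
  then obtain u v where "e = {u, v}" "u \<noteq> v" by (auto simp: card_2_iff)
  then obtain y where "e = {x, y}" "y \<noteq> x" using assms(3) by auto
  with that assms(2) show ?thesis by (simp add: nbrs_def)
qed

lemma nbrs_verts:
  assumes "finite_simple_graph G" "y \<in> nbrs G x" shows "y \<in> verts G" "x \<in> verts G" "y \<noteq> x"
  using assms by (auto simp: finite_simple_graph_def nbrs_def dest!: bspec[of "edges G" _ "{x, y}"])

lemma up_closed_edge_var: "up_closed (\<lambda>m. has_edge G m \<or> meets D m)"
  by (auto simp: up_closed_def has_edge_def meets_def mons_add)

lemma ideal_set_mon_ideal: "up_closed Q \<Longrightarrow> subring_set.ideal_set (polys V) (mon_ideal V Q)"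
  unfolding subring_set.ideal_set_def[OF subring_set_polys]
  by (auto simp: mon_ideal_add mon_ideal_mult dest: mon_ideal_subset[THEN subsetD])

lemma ideal_set_edge_var: "subring_set.ideal_set (polys (verts G)) (edge_var_ideal G D)"
  unfolding edge_var_ideal_def by (rule ideal_set_mon_ideal[OF up_closed_edge_var])

lemma edge_var_ideal_colon:
  fixes G :: "'v graph"
  assumes G: "finite_simple_graph G" and x: "x \<in> verts G" "x \<notin> D"
  shows "{s \<in> polys (verts G). mvar x * s \<in> edge_var_ideal G D} = (edge_var_ideal G (D \<union> nbrs G x) :: ('v, 'k::field) mpoly set)"
proof -
  have "has_edge G (mon1 x + m) \<longleftrightarrow> has_edge G m \<or> meets (nbrs G x) m" for m
  proof
    assume "has_edge G (mon1 x + m)"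
    then obtain e where e: "e \<in> edges G" "e \<subseteq> insert x (mons m)" by (auto simp: has_edge_def mons_add)
    show "has_edge G m \<or> meets (nbrs G x) m"
    proof (cases "x \<in> e")
      case True
      then obtain y where "e = {x, y}" "y \<noteq> x" "y \<in> nbrs G x" using edge_pair[OF G e(1)] by blast
      then show ?thesis using e(2) by (auto simp: meets_def)
    qed (use e in \<open>auto simp: has_edge_def\<close>)
  next
    assume "has_edge G m \<or> meets (nbrs G x) m"
    then show "has_edge G (mon1 x + m)"
    proof
      assume "meets (nbrs G x) m"
      then obtain y where "y \<in> mons m" "{x, y} \<in> edges G" by (auto simp: meets_def nbrs_def)
      then show ?thesis unfolding has_edge_def mons_add by (intro bexI[of _ "{x, y}"]) auto
    qed (auto simp: has_edge_def mons_add)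
  qed
  moreover have "meets D (mon1 x + m) \<longleftrightarrow> meets D m" for m using x by (auto simp: meets_def mons_add)
  moreover have "meets (D \<union> N) m \<longleftrightarrow> meets D m \<or> meets N m" for N :: "'v set" and m
    by (auto simp: meets_def)
  ultimately show ?thesis
    using x(1) unfolding edge_var_ideal_def mon_ideal_def polys_def
    by (auto simp: supported_mvar_mult_iff mons_add elim: supported_mono)
qed

lemma edge_var_ideal_insert:
  assumes "x \<in> verts G"
  shows "edge_var_ideal G D \<subseteq> edge_var_ideal G (insert x D)" "mvar x \<in> edge_var_ideal G (insert x D)"
    "a \<in> edge_var_ideal G (insert x D) \<Longrightarrow> \<exists>s\<in>polys (verts G). a - mvar x * s \<in> edge_var_ideal G D"
proof -
  show "edge_var_ideal G D \<subseteq> edge_var_ideal G (insert x D)"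
    unfolding edge_var_ideal_def mon_ideal_def by (auto simp: meets_def elim!: supported_mono)
  show "mvar x \<in> edge_var_ideal G (insert x D)"
    using assms unfolding edge_var_ideal_def mon_ideal_def mvar_eq
    by (intro supported_single) (simp add: meets_def)
  assume a: "a \<in> edge_var_ideal G (insert x D)"
  obtain r where r: "a = mvar x * var_quot x a + r"
    "r \<in> supported (\<lambda>m. (mons m \<subseteq> verts G \<and> (has_edge G m \<or> meets (insert x D) m)) \<and> lkp m x = 0)"
    using a unfolding edge_var_ideal_def mon_ideal_def by (rule var_quot_decompose)
  have "r \<in> edge_var_ideal G D"
    unfolding edge_var_ideal_def mon_ideal_def
    by (rule supported_mono[OF r(2)]) (auto simp: meets_def in_keys_iff)
  moreover have "a - mvar x * var_quot x a = r" using r(1) by (metis add_diff_cancel_left')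
  moreover have "var_quot x a \<in> polys (verts G)"
    using a mon_ideal_subset by (intro var_quot_in_polys) (auto simp: edge_var_ideal_def)
  ultimately show "\<exists>s\<in>polys (verts G). a - mvar x * s \<in> edge_var_ideal G D" by metis
qed

text \<open>The quotient of \<open>k[V]\<close> by \<open>J\<close> has projective dimension less than \<open>n\<close>.\<close>

abbreviation quot_pd_less :: "'v set \<Rightarrow> nat \<Rightarrow> ('v, 'k::field) mpoly set \<Rightarrow> bool"
  where "quot_pd_less V n J \<equiv>
    subring_set.pd_less (polys V) n (subring_set.vec1 (polys V)) (subring_set.vec1 J)"

text \<open>Without edges, the ideal generated by \<open>D\<close> is its own colon ideal by a variable outside \<open>D\<close>.\<close>

lemma pd_less_vars:
  assumes "finite V" "D \<subseteq> V"
  shows "quot_pd_less V (Suc (card D)) (var_ideal V D :: ('v, 'k::field) mpoly set)"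
proof -
  interpret subring_set "polys V :: ('v, 'k) mpoly set" by (rule subring_set_polys)
  have G: "finite_simple_graph (V, {})" using assms by (simp add: finite_simple_graph_def)
  have eq: "var_ideal V D = (edge_var_ideal (V, {}) D :: ('v, 'k) mpoly set)" for D
    by (simp add: edge_var_ideal_def has_edge_def)
  note ideal = ideal_set_edge_var[of "(V, {})", unfolded fst_conv]
  have "finite D" using assms finite_subset by blast
  then show ?thesis using assms(2) unfolding eq
  proof (induction D)
    case empty
    have "edge_var_ideal (V, {}) {} = ({0} :: ('v, 'k) mpoly set)"
      by (auto simp: edge_var_ideal_def mon_ideal_def has_edge_def meets_def supported_def)
    then show ?case using pd_less_free by simp
  next
    case (insert x D)
    let ?J = "edge_var_ideal (V, {}) D :: ('v, 'k) mpoly set"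
    have IH: "pd_less (Suc (card D)) (vec1 (polys V)) (vec1 ?J)" using insert by simp
    have colon: "{s \<in> polys V. mvar x * s \<in> ?J} = ?J"
      using edge_var_ideal_colon[OF G, of x D] insert by (simp add: nbrs_def)
    have "pd_less (Suc (Suc (card D))) (vec1 (polys V)) (vec1 (edge_var_ideal (V, {}) (insert x D)))"
    proof (rule pd_less_adjoin)
      show "pd_less (Suc (card D)) (vec1 (polys V)) (vec1 {s \<in> polys V. mvar x * s \<in> ?J})"
        unfolding colon by (rule IH)
      show "pd_less (Suc (Suc (card D))) (vec1 (polys V)) (vec1 ?J)"
        by (rule pd_less_Suc[OF submod_vec1[OF ideal_set_S] submod_vec1[OF ideal] IH])
    qed (use edge_var_ideal_insert[where x = x and G = "(V, {})" and D = D] insert(4) ideal in auto)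
    then show ?case using insert by simp
  qed
qed

lemma (in subring_set) pd_less_mono:
  assumes "submod A" "submod B" "pd_less n A B" "n \<le> n'" shows "pd_less n' A B"
  using assms(4)
proof (induction n' rule: dec_induct)
  case base
  show ?case by (rule assms(3))
next
  case (step n')
  show ?case by (rule pd_less_Suc[OF assms(1,2) step.IH])
qed

text \<open>The vertices in \<open>X\<close> form a vertex cover, and each of them that is not isolated after deleting \<open>D\<close> has
  a remaining neighbour \<open>w\<close> outside \<open>X\<close> whose closed neighbourhood lies in its own. Both properties
  survive the deletion of such a vertex \<open>x\<close> and the deletion of its neighbours, and in both cases every maximal independent
  set of the smaller graph is one of the larger graph: after deleting \<open>x\<close> because it meets the closed
  neighbourhood of \<open>w\<close>, after deleting the neighbours because it contains \<open>x\<close>.\<close>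

lemma pd_less_shedding:
  fixes G :: "'v graph"
  assumes G: "finite_simple_graph G" and X: "X \<subseteq> verts G" "\<And>e. e \<in> edges G \<Longrightarrow> e \<inter> X \<noteq> {}"
    and "D \<subseteq> verts G"
    and "\<And>x. x \<in> X - D \<Longrightarrow> \<not> nbrs G x \<subseteq> D \<Longrightarrow>
      \<exists>w\<in>verts G - X - D. w \<in> nbrs G x \<and> nbrs G w \<subseteq> insert x (nbrs G x)"
    and "\<And>A. max_indep G D A \<Longrightarrow> card (verts G - A) \<le> b"
  shows "quot_pd_less (verts G) (Suc b) (edge_var_ideal G D :: ('v, 'k::field) mpoly set)"
  using assms(4-)
proof (induction "card (verts G - D)" arbitrary: D rule: less_induct)
  case (less D)
  interpret subring_set "polys (verts G) :: ('v, 'k) mpoly set" by (rule subring_set_polys)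
  have fin: "finite (verts G)" using G by (simp add: finite_simple_graph_def)
  show ?case
  proof (cases "\<exists>x\<in>X - D. \<not> nbrs G x \<subseteq> D")
    case False
    have meets: "meets D m" if m: "has_edge G m" for m
    proof -
      obtain e where e: "e \<in> edges G" "e \<subseteq> mons m" using m by (auto simp: has_edge_def)
      then obtain x where x: "x \<in> e" "x \<in> X" using X(2) by blast
      then obtain y where "e = {x, y}" "y \<in> nbrs G x" using edge_pair[OF G e(1) x(1)] by blast
      then show ?thesis using e(2) x False unfolding meets_def by blast
    qed
    then have "edge_var_ideal G D = (var_ideal (verts G) D :: ('v, 'k) mpoly set)"
      unfolding edge_var_ideal_def by (intro arg_cong[of _ _ "mon_ideal (verts G)"]) auto
    then have pd: "quot_pd_less (verts G) (Suc (card D)) (edge_var_ideal G D :: ('v, 'k) mpoly set)"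
      using pd_less_vars[OF fin less.prems(1)] by (simp only:)
    have "card D \<le> b"
    proof -
      have "\<not> e \<subseteq> verts G - D" if e: "e \<in> edges G" for e
      proof -
        obtain x where x: "x \<in> e" "x \<in> X" using X(2) e by blast
        then obtain y where "e = {x, y}" "y \<in> nbrs G x" using edge_pair[OF G e x(1)] by blast
        then show ?thesis using x False by blast
      qed
      then have "max_indep G D (verts G - D)" by (simp add: max_indep_def)
      moreover have "verts G - (verts G - D) = D" using less.prems(1) by blast
      ultimately show ?thesis using less.prems(3) by metis
    qed
    then show ?thesis
      by (intro pd_less_mono[OF submod_vec1[OF ideal_set_S] submod_vec1[OF ideal_set_edge_var] pd]) simp
  next
    case True
    then obtain x where x: "x \<in> X - D" "\<not> nbrs G x \<subseteq> D" by blast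
    have xV: "x \<in> verts G" "x \<notin> D" using x X(1) by auto
    obtain w where w: "w \<in> verts G - X - D" "w \<in> nbrs G x" "nbrs G w \<subseteq> insert x (nbrs G x)"
      using less.prems(2)[OF x] by blast
    have smaller: "card (verts G - D') < card (verts G - D)" if "D \<subset> D'" "D' \<subseteq> verts G" for D'
      using that fin by (intro psubset_card_mono) auto
    have ins: "quot_pd_less (verts G) (Suc b) (edge_var_ideal G (insert x D) :: ('v, 'k) mpoly set)"
    proof (rule less.hyps)
      show "card (verts G - insert x D) < card (verts G - D)"
        using xV less.prems(1) by (intro smaller) auto
      show "insert x D \<subseteq> verts G" using xV less.prems(1) by auto
      show "\<exists>w\<in>verts G - X - insert x D. w \<in> nbrs G x' \<and> nbrs G w \<subseteq> insert x' (nbrs G x')"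
        if "x' \<in> X - insert x D" "\<not> nbrs G x' \<subseteq> insert x D" for x'
        using less.prems(2)[of x'] that x(1) by blast
      show "card (verts G - A) \<le> b" if A: "max_indep G (insert x D) A" for A
      proof (rule less.prems(3))
        have "nbrs G x \<inter> A \<noteq> {}"
        proof (cases "w \<in> A")
          case False
          then have "w \<in> verts G - insert x D - A" using w x by auto
          then obtain a where "a \<in> A" "a \<in> nbrs G w" using A unfolding max_indep_def by blast
          then show ?thesis using A w(3) unfolding max_indep_def by blast
        qed (use w in blast)
        then show "max_indep G D A" using A unfolding max_indep_def by blast
      qed
    qed
    have nbrs: "quot_pd_less (verts G) (Suc b) (edge_var_ideal G (D \<union> nbrs G x) :: ('v, 'k) mpoly set)"
    proof (rule less.hyps)
      show sub: "D \<union> nbrs G x \<subseteq> verts G" using less.prems(1) nbrs_verts[OF G] by blast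
      show "card (verts G - (D \<union> nbrs G x)) < card (verts G - D)"
        using x(2) by (intro smaller sub) blast
      show "\<exists>w\<in>verts G - X - (D \<union> nbrs G x). w \<in> nbrs G x' \<and> nbrs G w \<subseteq> insert x' (nbrs G x')"
        if x': "x' \<in> X - (D \<union> nbrs G x)" "\<not> nbrs G x' \<subseteq> D \<union> nbrs G x" for x'
      proof -
        obtain w' where w': "w' \<in> verts G - X - D" "w' \<in> nbrs G x'" "nbrs G w' \<subseteq> insert x' (nbrs G x')"
          using less.prems(2)[of x'] x' by blast
        have "w' \<notin> nbrs G x"
        proof
          assume "w' \<in> nbrs G x"
          then have "x \<in> insert x' (nbrs G x')" using w'(3) nbrs_sym by fast
          then show False using x' nbrs_sym by fast
        qed
        with w' show ?thesis by blast
      qed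
      show "card (verts G - A) \<le> b" if A: "max_indep G (D \<union> nbrs G x) A" for A
      proof (rule less.prems(3))
        have "x \<notin> nbrs G x" using nbrs_verts(3)[OF G] by blast
        then have "x \<in> A" using A xV unfolding max_indep_def by blast
        then show "max_indep G D A" using A nbrs_sym[of _ G x] unfolding max_indep_def by blast
      qed
    qed
    note colon = edge_var_ideal_colon[OF G xV]
    show ?thesis
    proof (rule pd_less_colon)
      show "quot_pd_less (verts G) (Suc b) {s \<in> polys (verts G). mvar x * s \<in> (edge_var_ideal G D :: ('v, 'k) mpoly set)}"
        unfolding colon by (rule nbrs)
      show "quot_pd_less (verts G) (Suc b) (edge_var_ideal G (insert x D) :: ('v, 'k) mpoly set)"
        by (rule ins)
    qed (rule ideal_set_edge_var edge_var_ideal_insert[OF xV(1)]; assumption?)+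
  qed
qed

section \<open>Heights of ideals generated by variables\<close>

lemma exists_linear_dependence:
  fixes M :: "'e \<Rightarrow> 'b \<Rightarrow> 'k::field"
  assumes "finite B" "finite E" "card B < card E"
  shows "\<exists>c. (\<exists>e\<in>E. c e \<noteq> 0) \<and> (\<forall>b\<in>B. (\<Sum>e\<in>E. c e * M e b) = 0)"
  using assms
proof (induction B arbitrary: E M rule: finite_induct)
  case empty
  then obtain e where "e \<in> E" by fastforce
  then show ?case by (intro exI[of _ "\<lambda>_. 1"]) auto
next
  case (insert b B)
  show ?case
  proof (cases "\<exists>e\<in>E. M e b \<noteq> 0")
    case False
    obtain c where "\<exists>e\<in>E. c e \<noteq> 0" "\<forall>b\<in>B. (\<Sum>e\<in>E. c e * M e b) = 0"
      using insert.IH[of E M] insert.prems insert.hyps by auto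
    with False show ?thesis by (intro exI[of _ c]) auto
  next
    case True
    then obtain p where p: "p \<in> E" "M p b \<noteq> 0" by blast
    let ?E = "E - {p}"
    obtain c where c: "\<exists>e\<in>?E. c e \<noteq> 0" "\<forall>b'\<in>B. (\<Sum>e\<in>?E. c e * (M e b' - M e b / M p b * M p b')) = 0"
    proof -
      have "card B < card ?E" using insert.prems insert.hyps p by simp
      then show ?thesis
        using insert.IH[of ?E "\<lambda>e b'. M e b' - M e b / M p b * M p b'"] insert.prems(1) that by blast
    qed
    define c' where "c' e = (if e = p then - (\<Sum>e\<in>?E. c e * M e b) / M p b else c e)" for e
    have sum: "(\<Sum>e\<in>E. c' e * M e b') =
      (\<Sum>e\<in>?E. c e * M e b') - (\<Sum>e\<in>?E. c e * M e b) / M p b * M p b'" for b'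
    proof -
      have "(\<Sum>e\<in>?E. c' e * M e b') = (\<Sum>e\<in>?E. c e * M e b')"
        by (rule sum.cong) (auto simp: c'_def)
      then show ?thesis
        using sum.remove[OF insert.prems(1) p(1), of "\<lambda>e. c' e * M e b'"] by (simp add: c'_def)
    qed
    show ?thesis
    proof (intro exI[of _ c'] conjI ballI)
      show "\<exists>e\<in>E. c' e \<noteq> 0" using c(1) by (auto simp: c'_def)
      fix b' assume "b' \<in> insert b B"
      then show "(\<Sum>e\<in>E. c' e * M e b') = 0"
      proof
        assume "b' \<in> B"
        then have "0 = (\<Sum>e\<in>?E. c e * (M e b' - M e b / M p b * M p b'))" using c(2) by simp
        also have "\<dots> = (\<Sum>e\<in>?E. c e * M e b') - (\<Sum>e\<in>?E. c e * M e b) / M p b * M p b'"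
          by (simp add: algebra_simps sum_subtractf sum_distrib_left sum_divide_distrib)
        finally show ?thesis unfolding sum by simp
      qed (simp add: sum p(2))
    qed
  qed
qed

lemma primeideal_polysD:
  fixes q :: "('v, 'k::field) mpoly set" and k :: "'k itself"
  assumes "primeideal q (poly_ring k V)"
  shows "q \<subseteq> polys V" "0 \<in> q" "a \<in> q \<Longrightarrow> b \<in> q \<Longrightarrow> a + b \<in> q" "a \<in> q \<Longrightarrow> b \<in> q \<Longrightarrow> a - b \<in> q"
    "r \<in> polys V \<Longrightarrow> a \<in> q \<Longrightarrow> r * a \<in> q" "1 \<notin> q"
    "a \<in> polys V \<Longrightarrow> b \<in> polys V \<Longrightarrow> a * b \<in> q \<Longrightarrow> a \<in> q \<or> b \<in> q"
proof -
  interpret I: primeideal q "poly_ring k V" by fact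
  show sub: "q \<subseteq> polys V" using I.Icarr by (auto simp: poly_ring_simps)
  show "0 \<in> q" using additive_subgroup.zero_closed[OF I.additive_subgroup_axioms] by (simp add: poly_ring_simps)
  show add: "a \<in> q \<Longrightarrow> b \<in> q \<Longrightarrow> a + b \<in> q" for a b using additive_subgroup.a_closed[OF I.additive_subgroup_axioms] by (simp add: poly_ring_simps)
  show mult: "r \<in> polys V \<Longrightarrow> a \<in> q \<Longrightarrow> r * a \<in> q" for r a using I.I_l_closed by (simp add: poly_ring_simps)
  show "a \<in> q \<Longrightarrow> b \<in> q \<Longrightarrow> a - b \<in> q"
    using add[of a "- b"] mult[of "- 1" b] by (simp add: polys_uminus)
  show "a \<in> polys V \<Longrightarrow> b \<in> polys V \<Longrightarrow> a * b \<in> q \<Longrightarrow> a \<in> q \<or> b \<in> q"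
    using I.I_prime by (simp add: poly_ring_simps)
  show "1 \<notin> q"
  proof
    assume "1 \<in> q"
    then have "polys V \<subseteq> q" using mult[of _ 1] by auto
    then show False using sub I.I_notcarr by (auto simp: poly_ring_simps)
  qed
qed

text \<open>There is a chain of primes starting at \<open>q\<close> such that every element of the list lies in the next
  prime of the chain but not in the current one.\<close>

fun prime_chain :: "'k itself \<Rightarrow> 'v set \<Rightarrow> ('v, 'k::field) mpoly set \<Rightarrow> ('v, 'k) mpoly list \<Rightarrow> bool" where
  "prime_chain k V q [] \<longleftrightarrow> primeideal q (poly_ring k V)"
| "prime_chain k V q (a # as) \<longleftrightarrow> primeideal q (poly_ring k V) \<and> a \<in> polys V \<and> a \<notin> q \<and>
    (\<exists>q'. q \<subseteq> q' \<and> a \<in> q' \<and> prime_chain k V q' as)"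

text \<open>Monomials in a list of ring elements, and the exponent lists of length \<open>n\<close> with entries below \<open>N\<close>.\<close>

fun power_product :: "'a::comm_ring_1 list \<Rightarrow> nat list \<Rightarrow> 'a" where
  "power_product (a # as) (e # es) = a ^ e * power_product as es"
| "power_product _ _ = 1"

definition exponents :: "nat \<Rightarrow> nat \<Rightarrow> nat list set"
  where "exponents N n = {es. set es \<subseteq> {..<N} \<and> length es = n}"

lemma finite_exponents: "finite (exponents N n)" and card_exponents: "card (exponents N n) = N ^ n"
  unfolding exponents_def by (simp_all add: finite_lists_length_eq card_lists_length_eq)

lemma exponents_Suc: "exponents N (Suc n) = (\<lambda>(j, es). j # es) ` ({..<N} \<times> exponents N n)"
  by (auto simp: exponents_def length_Suc_conv image_iff)

lemma polys_sum: "(\<And>i. i \<in> A \<Longrightarrow> f i \<in> polys V) \<Longrightarrow> sum f A \<in> polys V"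
  unfolding polys_def by (rule supported_sum)

lemma polys_power: "p \<in> polys V \<Longrightarrow> p ^ n \<in> polys V"
  by (induction n) (auto intro: polys_mult)

lemma const_in_polys: "Poly_Mapping.single 0 c \<in> polys V"
  unfolding polys_def by (rule supported_single) simp

lemma power_product_in_polys: "set as \<subseteq> polys V \<Longrightarrow> power_product as es \<in> polys V"
  by (induction as es rule: power_product.induct) (auto intro: polys_mult polys_power)

lemma prime_chain_elements:
  "prime_chain k V q as \<Longrightarrow> set as \<subseteq> polys V" "prime_chain k V q as \<Longrightarrow> primeideal q (poly_ring k V)"
  by (induction as arbitrary: q) auto

text \<open>The elements of a prime chain are algebraically independent over \<open>k\<close>, even modulo the first prime. In a
  relation, write the terms as powers of the first element \<open>a\<close> times coefficients and divide by the least power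
  of \<open>a\<close> that occurs; then its coefficient lies in the next prime, where induction applies.\<close>

lemma prime_chain_independent:
  fixes V :: "'v set" and c :: "nat list \<Rightarrow> 'k::field"
  assumes "prime_chain k V q as"
    and "(\<Sum>es\<in>exponents N (length as). Poly_Mapping.single 0 (c es) * power_product as es) \<in> q"
    and "es \<in> exponents N (length as)"
  shows "c es = 0"
  using assms
proof (induction as arbitrary: q c es)
  case Nil
  then have prime: "primeideal q (poly_ring k V)" by simp
  have "exponents N 0 = {[]}" by (auto simp: exponents_def)
  then have c: "Poly_Mapping.single 0 (c []) \<in> q" "es = []" using Nil by auto
  show ?case
  proof (rule ccontr)
    assume "c es \<noteq> 0"
    then have "Poly_Mapping.single 0 (1 / c []) * Poly_Mapping.single 0 (c []) = (1 :: ('v, 'k) mpoly)"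
      using c(2) by (simp add: mult_single)
    then show False
      using primeideal_polysD(5)[OF prime const_in_polys c(1), of "1 / c []"] primeideal_polysD(6)[OF prime]
      by (simp only:)
  qed
next
  case (Cons a as)
  obtain q' where q': "q \<subseteq> q'" "a \<in> q'" "prime_chain k V q' as" and prime: "primeideal q (poly_ring k V)"
    and a: "a \<in> polys V" "a \<notin> q" using Cons.prems(1) by auto
  note P = primeideal_polysD[OF prime] and P' = primeideal_polysD[OF prime_chain_elements(2)[OF q'(3)]]
  let ?n = "length as"
  define g where "g j = (\<Sum>es\<in>exponents N ?n. Poly_Mapping.single 0 (c (j # es)) * power_product as es)" for j
  have g: "g j \<in> polys V" for j
    unfolding g_def by (intro polys_sum polys_mult const_in_polys power_product_in_polys prime_chain_elements(1)[OF q'(3)])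
  have "(\<Sum>es\<in>exponents N (length (a # as)). Poly_Mapping.single 0 (c es) * power_product (a # as) es) =
    (\<Sum>(j, es)\<in>{..<N} \<times> exponents N ?n. a ^ j * (Poly_Mapping.single 0 (c (j # es)) * power_product as es))"
    by (simp add: exponents_Suc sum.reindex inj_on_def case_prod_unfold mult.left_commute)
  also have "\<dots> = (\<Sum>j<N. a ^ j * g j)"
    unfolding g_def sum_distrib_left by (rule sum.cartesian_product[symmetric])
  finally have sum_q: "(\<Sum>j<N. a ^ j * g j) \<in> q" using Cons.prems(2) by simp
  have power: "h \<in> q" if "a ^ j * h \<in> q" "h \<in> polys V" for j h
    using that
  proof (induction j)
    case (Suc j)
    then have "a * (a ^ j * h) \<in> q" by (simp add: mult.assoc)
    then have "a ^ j * h \<in> q" using P(7) a Suc.prems(2) polys_mult polys_power by blast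
    with Suc show ?case by blast
  qed simp
  have zero: "\<forall>es\<in>exponents N ?n. c (j # es) = 0" if "j < N" for j
    using that
  proof (induction j rule: less_induct)
    case (less j)
    have g0: "g i = 0" if "i < j" for i
      using less.IH[OF that] less.prems that unfolding g_def by (intro sum.neutral) auto
    let ?h = "\<Sum>i\<in>{Suc j..<N}. a ^ (i - Suc j) * g i"
    have h: "?h \<in> polys V" by (intro polys_sum polys_mult polys_power a g)
    have "{..<N} = {..<j} \<union> {j} \<union> {Suc j..<N}" using less.prems by auto
    then have "(\<Sum>i<N. a ^ i * g i) = (\<Sum>i\<in>{..<j} \<union> {j} \<union> {Suc j..<N}. a ^ i * g i)" by simp
    also have "\<dots> = (\<Sum>i<j. a ^ i * g i) + a ^ j * g j + (\<Sum>i\<in>{Suc j..<N}. a ^ i * g i)"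
      by (subst sum.union_disjoint; force)+
    also have "(\<Sum>i<j. a ^ i * g i) = 0" by (intro sum.neutral) (simp add: g0)
    also have "(\<Sum>i\<in>{Suc j..<N}. a ^ i * g i) = a ^ j * (a * ?h)"
      unfolding sum_distrib_left
    proof (rule sum.cong)
      fix i assume "i \<in> {Suc j..<N}"
      then have "a ^ i = a ^ j * (a * a ^ (i - Suc j))"
        by (simp add: power_Suc[symmetric] power_add[symmetric] del: power_Suc)
      then show "a ^ i * g i = a ^ j * (a * (a ^ (i - Suc j) * g i))" by (simp add: mult.assoc)
    qed simp
    finally have "a ^ j * (g j + a * ?h) \<in> q" using sum_q by (simp add: distrib_left)
    then have "g j + a * ?h \<in> q'" using power q'(1) g h a by (blast intro: polys_add polys_mult)
    moreover have "a * ?h \<in> q'" using P'(5)[OF h q'(2)] by (simp add: mult.commute)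
    ultimately have "g j \<in> q'" using P'(4) by fastforce
    then show ?case using Cons.IH[OF q'(3), of "\<lambda>es. c (j # es)"] unfolding g_def by blast
  qed
  from Cons.prems(3) obtain j es' where "es = j # es'" "j < N" "es' \<in> exponents N ?n"
    by (auto simp: exponents_Suc)
  with zero show ?case by blast
qed

lemma lookup_const_mult: "lkp (Poly_Mapping.single 0 s * p) m = s * lkp (p :: ('v, 'k::field) mpoly) m"
  unfolding mult_map_scale_conv_mult[symmetric] by (simp add: map.rep_eq when_def)

text \<open>No variable has an exponent above \<open>d\<close>.\<close>

definition deg_bounded :: "nat \<Rightarrow> ('v \<Rightarrow>\<^sub>0 nat) \<Rightarrow> bool"
  where "deg_bounded d m \<longleftrightarrow> (\<forall>v. lkp m v \<le> d)"

lemma supported_deg_mono: "p \<in> supported (deg_bounded i) \<Longrightarrow> i \<le> j \<Longrightarrow> p \<in> supported (deg_bounded j)"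
  by (erule supported_mono) (meson deg_bounded_def order_trans)

lemma supported_deg_power_product:
  fixes as :: "('v, 'k::field) mpoly list"
  assumes "\<forall>a\<in>set as. a \<in> supported (deg_bounded d)" "set es \<subseteq> {..<N}"
  shows "power_product as es \<in> supported (deg_bounded (length as * N * d))"
  using assms
proof (induction as es rule: power_product.induct)
  case (1 a as e es)
  have "a ^ e \<in> supported (deg_bounded (e * d))"
  proof (induction e)
    case 0
    show ?case by (simp add: supported_def deg_bounded_def)
  next
    case (Suc e)
    have "a \<in> supported (deg_bounded d)" using 1 by simp
    then show ?case unfolding power_Suc
      using Suc by (rule supported_mult) (auto simp: deg_bounded_def lookup_add intro: add_mono)
  qed
  then have "a ^ e \<in> supported (deg_bounded (N * d))"
    by (rule supported_deg_mono) (use 1 in simp)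
  moreover have "power_product as es \<in> supported (deg_bounded (length as * N * d))" using 1 by simp
  ultimately show ?case unfolding power_product.simps
    by (rule supported_mult) (auto simp: deg_bounded_def lookup_add algebra_simps intro: add_mono)
qed (auto simp: supported_def deg_bounded_def)

lemma card_bounded_monomials:
  assumes "finite V"
  shows "finite {m. mons m \<subseteq> V \<and> deg_bounded d m}" "card {m. mons m \<subseteq> V \<and> deg_bounded d m} \<le> Suc d ^ card V"
proof -
  let ?B = "{m. mons m \<subseteq> V \<and> deg_bounded d m}" and ?f = "\<lambda>m. restrict (lkp m) V"
  have inj: "inj_on ?f ?B"
  proof (rule inj_onI)
    fix m m' assume m: "m \<in> ?B" "m' \<in> ?B" "?f m = ?f m'"
    have "lkp m v = lkp m' v" for v
    proof (cases "v \<in> V")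
      case True
      then show ?thesis using m(3) by (metis restrict_apply')
    next
      case False
      then have "v \<notin> mons m" "v \<notin> mons m'" using m by auto
      then show ?thesis by (simp add: in_keys_iff)
    qed
    then show "m = m'" by (rule poly_mapping_eqI)
  qed
  have sub: "?f ` ?B \<subseteq> PiE V (\<lambda>_. {..d})" by (auto simp: deg_bounded_def)
  have fin: "finite (PiE V (\<lambda>_. {..d}))" using assms by (intro finite_PiE) auto
  show "finite ?B" using finite_imageD[OF finite_subset[OF sub fin] inj] .
  have "card ?B = card (?f ` ?B)" using card_image[OF inj] by simp
  also have "\<dots> \<le> card (PiE V (\<lambda>_. {..d}))" by (rule card_mono[OF fin sub])
  also have "\<dots> = Suc d ^ card V" using assms by (simp add: card_PiE)
  finally show "card ?B \<le> Suc d ^ card V" .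
qed

text \<open>The dimension of \<open>k[V]\<close> is at most \<open>card V\<close>: among more than \<open>card V\<close> polynomials there is an algebraic
  relation, because the number of their power products grows faster than the number of monomials available.\<close>

lemma prime_chain_length:
  fixes k :: "'k::field itself" and V :: "'v set"
  assumes "finite V" "prime_chain k V q as"
  shows "length as \<le> card V"
proof (rule ccontr)
  assume contr: "\<not> length as \<le> card V"
  let ?n = "length as"
  have "\<exists>d. \<forall>a\<in>A. a \<in> supported (deg_bounded d)" if "finite A" for A :: "('v, 'k) mpoly set"
    using that
  proof (induction A)
    case (insert a A)
    then obtain d where d: "\<forall>a\<in>A. a \<in> supported (deg_bounded d)" by blast
    let ?d = "\<Sum>m\<in>mons a. \<Sum>v\<in>mons m. lkp m v"
    have "a \<in> supported (deg_bounded ?d)"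
    proof (rule supportedI, unfold deg_bounded_def, intro allI)
      fix m v assume m: "lkp a m \<noteq> 0"
      have "lkp m v \<le> (\<Sum>v\<in>mons m. lkp m v)"
        by (cases "v \<in> mons m") (auto intro: member_le_sum simp: in_keys_iff)
      also have "\<dots> \<le> ?d"
        using m by (intro member_le_sum[of m _ "\<lambda>m. \<Sum>v\<in>mons m. lkp m v"]) (auto simp: in_keys_iff)
      finally show "lkp m v \<le> ?d" .
    qed
    from this have "a \<in> supported (deg_bounded (d + ?d))" by (rule supported_deg_mono) simp
    moreover have "b \<in> supported (deg_bounded (d + ?d))" if "b \<in> A" for b
      using d that by (intro supported_deg_mono[of b d "d + ?d"]) auto
    ultimately show ?case by blast
  qed simp
  then obtain d where d: "\<forall>a\<in>set as. a \<in> supported (deg_bounded d)" by blast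
  \<comment> \<open>so many exponents that the power products outnumber the monomials that can occur in them\<close>
  define N where "N = Suc (Suc (?n * d) ^ card V)"
  let ?B = "{m. mons m \<subseteq> V \<and> deg_bounded (?n * N * d) m}"
  let ?E = "exponents N ?n"
  have "card ?B \<le> Suc (?n * N * d) ^ card V" by (rule card_bounded_monomials[OF assms(1)])
  also have "\<dots> \<le> (N * Suc (?n * d)) ^ card V"
    by (intro power_mono) (auto simp: N_def algebra_simps)
  also have "\<dots> = N ^ card V * Suc (?n * d) ^ card V" by (rule power_mult_distrib)
  also have "\<dots> < N ^ card V * N" by (simp add: N_def)
  also have "\<dots> = N ^ Suc (card V)" by simp
  also have "\<dots> \<le> N ^ ?n" using contr by (intro power_increasing) (auto simp: N_def)
  also have "\<dots> = card ?E" by (simp add: card_exponents)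
  finally have "card ?B < card ?E" .
  then obtain c where c: "\<exists>es\<in>?E. c es \<noteq> 0" "\<forall>m\<in>?B. (\<Sum>es\<in>?E. c es * lkp (power_product as es) m) = 0"
    using exists_linear_dependence[OF card_bounded_monomials(1)[OF assms(1)] finite_exponents,
        where M = "\<lambda>es m. lkp (power_product as es) m"] by blast
  have "(\<Sum>es\<in>?E. Poly_Mapping.single 0 (c es) * power_product as es) = 0"
  proof (rule poly_mapping_eqI)
    fix m
    have "(\<Sum>es\<in>?E. c es * lkp (power_product as es) m) = 0"
    proof (cases "m \<in> ?B")
      case False
      have "lkp (power_product as es) m = 0" if "es \<in> ?E" for es
      proof (rule ccontr)
        assume nz: "lkp (power_product as es) m \<noteq> 0"
        have "set es \<subseteq> {..<N}" using that by (simp add: exponents_def)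
        then have "deg_bounded (?n * N * d) m"
          using supportedD[OF supported_deg_power_product[OF d] nz] by simp
        moreover have "mons m \<subseteq> V"
          using supportedD[OF power_product_in_polys[OF prime_chain_elements(1)[OF assms(2)], unfolded polys_def] nz] .
        ultimately show False using False by simp
      qed
      then show ?thesis by simp
    qed (use c(2) in blast)
    then show "lkp (\<Sum>es\<in>?E. Poly_Mapping.single 0 (c es) * power_product as es) m = lkp 0 m"
      by (simp add: lookup_sum lookup_const_mult)
  qed
  then have "(\<Sum>es\<in>?E. Poly_Mapping.single 0 (c es) * power_product as es) \<in> q"
    using primeideal_polysD(2)[OF prime_chain_elements(2)[OF assms(2)]] by simp
  then have "\<forall>es\<in>?E. c es = 0" using prime_chain_independent[OF assms(2)] by blast
  with c(1) show False by blast
qed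

lemma mvar_in_var_ideal: "mvar x \<in> var_ideal V D \<longleftrightarrow> x \<in> V \<and> x \<in> D"
  by (simp add: mon_ideal_def supported_def meets_def mvar_eq)

lemma var_ideal_mono: "D \<subseteq> D' \<Longrightarrow> var_ideal V D \<subseteq> var_ideal V D'"
  unfolding mon_ideal_def by (auto simp: meets_def elim!: supported_mono)

lemma prime_chain_vars:
  fixes k :: "'k::field itself"
  assumes "finite V" "distinct xs" "set xs \<subseteq> V - D"
  shows "prime_chain k V (var_ideal V D) (map mvar xs)"
  using assms(2,3)
proof (induction xs arbitrary: D)
  case Nil
  show ?case using primeideal_vars[OF assms(1)] by simp
next
  case (Cons x xs)
  have "prime_chain k V (var_ideal V (insert x D)) (map mvar xs)" using Cons by (intro Cons.IH) auto
  then show ?case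
    using Cons.prems primeideal_vars[OF assms(1)] var_ideal_mono[of D "insert x D"]
    by (auto simp: mvar_in_var_ideal mvar_in_polys intro!: exI[of _ "var_ideal V (insert x D)"])
qed

lemma prime_chain_append:
  fixes k :: "'k::field itself"
  assumes "\<forall>i\<le>l. primeideal (q i) (poly_ring k V)" "\<forall>i<l. q i \<subset> q (Suc i)" "prime_chain k V (q l) as"
  shows "\<exists>bs. length bs = l \<and> prime_chain k V (q 0) (bs @ as)"
  using assms
proof (induction l arbitrary: as)
  case (Suc l)
  then obtain a where a: "a \<in> q (Suc l)" "a \<notin> q l" by blast
  have "primeideal (q (Suc l)) (poly_ring k V)" using Suc.prems(1) by blast
  then have "a \<in> polys V" using a(1) primeideal_polysD(1) by blast
  moreover have "q l \<subseteq> q (Suc l)" "primeideal (q l) (poly_ring k V)" using Suc.prems(1,2) by auto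
  ultimately have "prime_chain k V (q l) (a # as)"
    using a Suc.prems(3) by auto
  then obtain bs where "length bs = l" "prime_chain k V (q 0) (bs @ a # as)"
    using Suc.IH[of "a # as"] Suc.prems(1,2) by auto
  then show ?case by (intro exI[of _ "bs @ [a]"]) auto
qed simp

text \<open>A chain of primes below the ideal of \<open>D\<close> can be continued by adjoining the variables outside \<open>D\<close>, so it has length
  at most \<open>card V - card (V - D)\<close>.\<close>

lemma prime_height_vars:
  fixes k :: "'k::field itself"
  assumes "finite V" "D \<subseteq> V"
  shows "prime_height (poly_ring k V) (var_ideal V D) = enat (card D)"
proof (rule antisym)
  have fin: "finite D" "finite (V - D)" using assms finite_subset by auto
  show "prime_height (poly_ring k V) (var_ideal V D) \<le> enat (card D)"
    unfolding prime_height_def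
  proof (rule Sup_least, clarify)
    fix l and q :: "nat \<Rightarrow> ('a, 'k) mpoly set"
    assume q: "\<forall>i\<le>l. primeideal (q i) (poly_ring k V)" "\<forall>i<l. q i \<subset> q (Suc i)" "q l = var_ideal V D"
    obtain xs where xs: "set xs = V - D" "distinct xs" using finite_distinct_list[OF fin(2)] by blast
    have "prime_chain k V (q l) (map mvar xs)"
      unfolding q(3) using xs by (intro prime_chain_vars[OF assms(1)]) auto
    from prime_chain_append[OF q(1,2) this] obtain bs
      where "length bs = l" "prime_chain k V (q 0) (bs @ map mvar xs)" by blast
    then have "l + length xs \<le> card V" using prime_chain_length[OF assms(1)] by fastforce
    moreover have "length xs = card V - card D"
      using xs distinct_card[OF xs(2)] card_Diff_subset[OF fin(1) assms(2)] by simp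
    moreover have "card D \<le> card V" using assms by (intro card_mono)
    ultimately show "enat l \<le> enat (card D)" by simp
  qed
  obtain xs where xs: "set xs = D" "distinct xs" using finite_distinct_list[OF fin(1)] by blast
  define q where "q i = (var_ideal V (set (take i xs)) :: ('a, 'k) mpoly set)" for i
  have "\<forall>i\<le>card D. primeideal (q i) (poly_ring k V)"
    unfolding q_def using primeideal_vars[OF assms(1)] by blast
  moreover have "q i \<subset> q (Suc i)" if i: "i < card D" for i
  proof -
    have i': "i < length xs" using i xs distinct_card by fastforce
    have "xs ! i \<notin> set (take i xs)"
      using i' xs(2) by (auto simp: in_set_conv_nth nth_eq_iff_index_eq)
    moreover have "xs ! i \<in> V" using i' xs assms(2) nth_mem by blast
    ultimately have "mvar (xs ! i) \<in> q (Suc i)" "mvar (xs ! i) \<notin> q i"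
      using i' by (auto simp: q_def mvar_in_var_ideal take_Suc_conv_app_nth)
    moreover have "q i \<subseteq> q (Suc i)"
      unfolding q_def by (intro var_ideal_mono set_take_subset_set_take) simp
    ultimately show ?thesis by blast
  qed
  moreover have "q (card D) = var_ideal V D"
    using xs distinct_card[OF xs(2)] by (simp add: q_def)
  ultimately show "enat (card D) \<le> prime_height (poly_ring k V) (var_ideal V D)"
    unfolding prime_height_def by (intro Sup_upper) blast
qed

section \<open>Minimal primes and the theorem\<close>

lemma max_indep_nbr:
  assumes "max_indep G D A" "x \<in> verts G - D - A"
  obtains y where "y \<in> A" "{x, y} \<in> edges G"
proof -
  have "nbrs G x \<inter> A \<noteq> {}" using assms by (simp add: max_indep_def)
  then obtain y where "y \<in> nbrs G x" "y \<in> A" by blast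
  then show ?thesis by (intro that) (simp_all add: nbrs_def)
qed

lemma var_ideal_least:
  fixes k :: "'k::field itself" and J :: "('v, 'k) mpoly set"
  assumes "finite D" "D \<subseteq> V" "ideal J (poly_ring k V)" "\<And>x. x \<in> D \<Longrightarrow> mvar x \<in> J"
  shows "var_ideal V D \<subseteq> J"
  using assms(1,2,4)
proof (induction D)
  case empty
  interpret ideal J "poly_ring k V" by fact
  have "var_ideal V {} = ({0} :: ('v, 'k) mpoly set)"
    by (auto simp: mon_ideal_def meets_def supported_def)
  then show ?case
    using additive_subgroup.zero_closed[OF additive_subgroup_axioms] by (simp add: poly_ring_simps)
next
  case (insert x D)
  interpret ideal J "poly_ring k V" by fact
  show ?case
  proof
    fix a :: "('v, 'k) mpoly" assume a: "a \<in> var_ideal V (insert x D)"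
    obtain r where r: "a = mvar x * var_quot x a + r"
      "r \<in> supported (\<lambda>m. (mons m \<subseteq> V \<and> meets (insert x D) m) \<and> lkp m x = 0)"
      using a unfolding mon_ideal_def by (rule var_quot_decompose)
    have "r \<in> var_ideal V D"
      unfolding mon_ideal_def by (rule supported_mono[OF r(2)]) (auto simp: meets_def in_keys_iff)
    then have "r \<in> J" using insert by auto
    moreover have "var_quot x a \<in> polys V"
      using a mon_ideal_subset by (intro var_quot_in_polys) auto
    then have "mvar x * var_quot x a \<in> J"
      using I_r_closed[of "mvar x" "var_quot x a"] insert.prems by (simp add: poly_ring_simps)
    ultimately have "mvar x * var_quot x a + r \<in> J"
      using additive_subgroup.a_closed[OF additive_subgroup_axioms] by (simp add: poly_ring_simps)
    then show "a \<in> J" using r(1) by simp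
  qed
qed

lemma edge_ideal_subset_var_ideal:
  fixes k :: "'k::field itself" and G :: "'v graph"
  assumes "finite_simple_graph G" "\<And>e. e \<in> edges G \<Longrightarrow> e \<inter> D \<noteq> {}"
  shows "(edge_ideal k G :: ('v, 'k) mpoly set) \<subseteq> var_ideal (verts G) D"
  unfolding edge_ideal_eq[OF assms(1)] mon_ideal_def
  using assms(2) by (auto elim!: supported_mono simp: has_edge_def meets_def)

lemma edge_in_edge_ideal:
  fixes k :: "'k::field itself" and G :: "'v graph"
  assumes "finite_simple_graph G" "{u, v} \<in> edges G"
  shows "mvar u * mvar v \<in> (edge_ideal k G :: ('v, 'k) mpoly set)"
  unfolding edge_ideal_eq[OF assms(1)] by (rule edge_in_mon_ideal[OF assms])

lemma minimal_primes_edge_ideal: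
  fixes k :: "'k::field itself" and G :: "'v graph"
  assumes G: "finite_simple_graph G"
  shows "minimal_primes (poly_ring k (verts G)) (edge_ideal k G) =
    (\<lambda>A. var_ideal (verts G) (verts G - A)) ` {A. max_indep G {} A}"
    (is "?M = ?N")
proof (intro equalityI subsetI)
  let ?V = "verts G" and ?R = "poly_ring k (verts G)"
  let ?I = "edge_ideal k G :: ('v, 'k) mpoly set"
  have fin: "finite ?V" using G by (simp add: finite_simple_graph_def)
  have prime: "primeideal (var_ideal ?V D :: ('v, 'k) mpoly set) ?R" for D by (rule primeideal_vars[OF fin])
  have prod: "mvar u \<in> p \<or> mvar v \<in> p" if "primeideal p ?R" "?I \<subseteq> p" "{u, v} \<in> edges G" for p u v
  proof -
    have "mvar u * mvar v \<in> p" using edge_in_edge_ideal[OF G that(3)] that(2) by blast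
    moreover have uv: "u \<in> ?V" "v \<in> ?V" using G that(3) unfolding finite_simple_graph_def by blast+
    ultimately show ?thesis
      using primeideal_polysD(7)[OF that(1) mvar_in_polys[OF uv(1)] mvar_in_polys[OF uv(2)]] by simp
  qed
  {
    fix p assume "p \<in> ?M"
    then have p: "primeideal p ?R" "?I \<subseteq> p" "\<And>q. primeideal q ?R \<Longrightarrow> ?I \<subseteq> q \<Longrightarrow> q \<subseteq> p \<Longrightarrow> q = p"
      by (simp_all add: minimal_primes_def)
    define C where "C = {x \<in> ?V. mvar x \<in> p}"
    have C: "C \<subseteq> ?V" "finite C" using fin by (auto simp: C_def)
    have le: "var_ideal ?V D \<subseteq> p" if "D \<subseteq> C" for D
      using C that by (intro var_ideal_least[OF _ _ primeideal.axioms(1)[OF p(1)]])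
        (auto simp: C_def intro: finite_subset)
    have cover: "e \<inter> C \<noteq> {}" if e: "e \<in> edges G" for e
    proof -
      obtain u v where uv: "e = {u, v}" using G e by (metis card_2_iff finite_simple_graph_def)
      have "e \<subseteq> ?V" using G e by (simp add: finite_simple_graph_def)
      then show ?thesis using prod[OF p(1,2)] e uv by (auto simp: C_def)
    qed
    have p_eq: "p = var_ideal ?V C"
      using p(3)[OF prime edge_ideal_subset_var_ideal[OF G cover] le] by simp
    have "max_indep G {} (?V - C)"
      unfolding max_indep_def
    proof (intro conjI ballI)
      show "\<not> e \<subseteq> ?V - C" if "e \<in> edges G" for e using cover[OF that] by blast
      show "nbrs G z \<inter> (?V - C) \<noteq> {}" if "z \<in> ?V - {} - (?V - C)" for z
      proof
        assume nz: "nbrs G z \<inter> (?V - C) = {}"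
        have z: "z \<in> C" using that by blast
        have "e \<inter> (C - {z}) \<noteq> {}" if e: "e \<in> edges G" for e
        proof (cases "z \<in> e")
          case True
          then obtain y where y: "e = {z, y}" "y \<noteq> z" "y \<in> nbrs G z" using edge_pair[OF G e] by blast
          then have "y \<in> ?V" using nbrs_verts[OF G] by blast
          then show ?thesis using y nz by blast
        qed (use cover[OF e] in blast)
        then have "var_ideal ?V (C - {z}) = p"
          using edge_ideal_subset_var_ideal[OF G, of "C - {z}"] by (intro p(3) prime le) auto
        moreover have "mvar z \<in> p" using z by (simp add: C_def)
        ultimately have "mvar z \<in> (var_ideal ?V (C - {z}) :: ('v, 'k) mpoly set)" by simp
        then show False by (simp add: mvar_in_var_ideal)
      qed
    qed auto
    moreover have "?V - (?V - C) = C" using C by blast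
    ultimately show "p \<in> ?N" using p_eq by (intro image_eqI[of _ _ "?V - C"]) simp_all
  next
    fix p assume "p \<in> ?N"
    then obtain A where A: "max_indep G {} A" and p: "p = var_ideal ?V (?V - A)" by blast
    have "primeideal p ?R" unfolding p by (rule prime)
    moreover have "?I \<subseteq> p" unfolding p
    proof (rule edge_ideal_subset_var_ideal[OF G])
      fix e assume e: "e \<in> edges G"
      then have "\<not> e \<subseteq> A" "e \<subseteq> ?V" using A G by (auto simp: max_indep_def finite_simple_graph_def)
      then show "e \<inter> (?V - A) \<noteq> {}" by blast
    qed
    moreover have "q = p" if q: "primeideal q ?R" "?I \<subseteq> q" "q \<subseteq> p" for q
    proof
      show "p \<subseteq> q" unfolding p
      proof (rule var_ideal_least[OF _ _ primeideal.axioms(1)[OF q(1)]])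
        fix x assume x: "x \<in> ?V - A"
        then obtain y where y: "y \<in> A" "{x, y} \<in> edges G" using max_indep_nbr[OF A] by blast
        have "mvar y \<notin> p" using y(1) by (simp add: p mvar_in_var_ideal)
        then show "mvar x \<in> q" using prod[OF q(1,2) y(2)] q(3) by blast
      qed (use fin in auto)
    qed (rule q(3))
    ultimately show "p \<in> ?M" unfolding minimal_primes_def by blast
  }
qed

lemma bight_edge_ideal:
  fixes k :: "'k::field itself" and G :: "'v graph"
  assumes "finite_simple_graph G"
  shows "bight (poly_ring k (verts G)) (edge_ideal k G) =
    (SUP A\<in>{A. max_indep G {} A}. enat (card (verts G - A)))"
proof -
  have "finite (verts G)" using assms by (simp add: finite_simple_graph_def)
  then show ?thesis
    unfolding bight_def minimal_primes_edge_ideal[OF assms] image_image by (simp add: prime_height_vars)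
qed

text \<open>The product of the variables in \<open>A\<close> is not in the edge ideal, but becomes so when multiplied by any variable
  outside \<open>A\<close>.\<close>

lemma projective_dimension_edge_ideal_ge:
  fixes k :: "'k::field itself" and G :: "'v graph"
  assumes G: "finite_simple_graph G" and A: "max_indep G {} A"
  shows "enat (card (verts G - A)) \<le>
    projective_dimension (poly_ring k (verts G)) (quotient_module (poly_ring k (verts G)) (edge_ideal k G))"
proof -
  let ?V = "verts G" and ?R = "poly_ring k (verts G)" and ?I = "edge_ideal k G :: ('v, 'k) mpoly set"
  have fin: "finite ?V" using G by (simp add: finite_simple_graph_def)
  have A': "A \<subseteq> ?V" "finite A" using A fin by (auto simp: max_indep_def intro: finite_subset)
  obtain xs where xs: "set xs = ?V - A" "distinct xs" using finite_distinct_list[of "?V - A"] fin by auto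
  define a where "a = (\<Sum>x\<in>A. mon1 x)"
  have "lkp a v = (if v \<in> A then 1 else 0)" for v
    unfolding a_def lookup_sum using A'(2) by simp
  then have a: "mons a = A" by (auto simp: in_keys_iff split: if_splits)
  let ?w = "Poly_Mapping.single a 1 :: ('v, 'k) mpoly"
  have "up_closed (has_edge G)" by (auto simp: up_closed_def has_edge_def mons_add)
  then have "ideal ?I ?R" unfolding edge_ideal_eq[OF G] by (rule ideal_mon_ideal)
  moreover have "?w \<in> polys ?V" unfolding polys_def using a A' by (intro supported_single) simp
  moreover have "?w \<notin> ?I"
    using A a unfolding edge_ideal_eq[OF G] mon_ideal_def
    by (auto simp: supported_def has_edge_def max_indep_def)
  moreover have "mvar x * ?w \<in> ?I" if x: "x \<in> set xs" for x
  proof -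
    obtain y where y: "y \<in> A" "{x, y} \<in> edges G"
      using x xs max_indep_nbr[OF A, of x] by blast
    have "has_edge G (mon1 x + a)"
      unfolding has_edge_def using y a by (intro bexI[of _ "{x, y}"]) (auto simp: mons_add)
    moreover have "mons (mon1 x + a) \<subseteq> ?V" using x xs(1) A' a by (auto simp: mons_add)
    ultimately show ?thesis
      unfolding edge_ideal_eq[OF G] mon_ideal_def mvar_mult_single by (intro supported_single) simp
  qed
  ultimately have "enat (length xs) \<le> projective_dimension ?R (quotient_module ?R ?I)"
    using xs by (intro projective_dimension_ge) auto
  then show ?thesis using xs distinct_card[OF xs(2)] by simp
qed

lemma exists_max_indep:
  fixes G :: "'v graph"
  assumes G: "finite_simple_graph G"
  shows "\<exists>A. max_indep G {} A"
proof -
  define indep where "indep = {A. A \<subseteq> verts G \<and> (\<forall>e\<in>edges G. \<not> e \<subseteq> A)}"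
  have "finite (Pow (verts G))" using G by (simp add: finite_simple_graph_def)
  moreover have "indep \<subseteq> Pow (verts G)" by (auto simp: indep_def)
  ultimately have "finite indep" by (rule finite_subset[rotated])
  moreover have "{} \<in> indep" using G by (fastforce simp: indep_def finite_simple_graph_def)
  ultimately obtain A where A: "A \<in> indep" "\<forall>B\<in>indep. A \<subseteq> B \<longrightarrow> A = B"
    using finite_has_maximal[of indep] by blast
  have "nbrs G z \<inter> A \<noteq> {}" if z: "z \<in> verts G - A" for z
  proof
    assume nz: "nbrs G z \<inter> A = {}"
    have "\<not> e \<subseteq> insert z A" if e: "e \<in> edges G" for e
    proof (cases "z \<in> e")
      case True
      then obtain y where "e = {z, y}" "y \<noteq> z" "y \<in> nbrs G z" using edge_pair[OF G e] by blast
      then show ?thesis using nz by blast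
    next
      case False
      then show ?thesis using A(1) e by (auto simp: indep_def)
    qed
    then have "insert z A \<in> indep" using A(1) z by (simp add: indep_def)
    then show False using A(2) z by blast
  qed
  then show ?thesis using A(1) by (auto simp: max_indep_def indep_def)
qed

text \<open>The property of multi-clique-whiskered graphs that matters: the vertices in \<open>X\<close> cover all edges, and each has a
  neighbour outside \<open>X\<close> whose closed neighbourhood is contained in its own.\<close>

theorem projective_dimension_eq_bight:
  fixes k :: "'k::field itself" and G :: "'v graph"
  assumes G: "finite_simple_graph G" and X: "X \<subseteq> verts G" "\<And>e. e \<in> edges G \<Longrightarrow> e \<inter> X \<noteq> {}"
    and simplicial: "\<And>x. x \<in> X \<Longrightarrow> \<exists>w\<in>verts G - X. w \<in> nbrs G x \<and> nbrs G w \<subseteq> insert x (nbrs G x)"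
  shows "projective_dimension (poly_ring k (verts G)) (quotient_module (poly_ring k (verts G)) (edge_ideal k G)) =
    bight (poly_ring k (verts G)) (edge_ideal k G)"
proof (rule antisym)
  let ?V = "verts G" and ?R = "poly_ring k (verts G)" and ?I = "edge_ideal k G :: ('v, 'k) mpoly set"
  let ?pd = "projective_dimension ?R (quotient_module ?R ?I)"
  have fin: "finite {A. max_indep G {} A}"
  proof (rule finite_subset)
    show "{A. max_indep G {} A} \<subseteq> Pow ?V" by (auto simp: max_indep_def)
    show "finite (Pow ?V)" using G by (simp add: finite_simple_graph_def)
  qed
  define b where "b = Max ((\<lambda>A. card (?V - A)) ` {A. max_indep G {} A})"
  have b: "card (?V - A) \<le> b" if "max_indep G {} A" for A
    unfolding b_def using fin that by (intro Max_ge) auto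
  have I: "?I = edge_var_ideal G {}"
    unfolding edge_ideal_eq[OF G] edge_var_ideal_def by (simp add: meets_def)
  have "quot_pd_less ?V (Suc b) (edge_var_ideal G {} :: ('v, 'k) mpoly set)"
    using b simplicial by (intro pd_less_shedding[OF G X]) auto
  moreover have "ideal ?I ?R"
    unfolding I edge_var_ideal_def by (rule ideal_mon_ideal[OF up_closed_edge_var])
  ultimately have "?pd \<le> enat b"
    unfolding I[symmetric] by (intro projective_dimension_le)
  also have "enat b \<le> bight ?R ?I"
  proof -
    have "b \<in> (\<lambda>A. card (?V - A)) ` {A. max_indep G {} A}"
      unfolding b_def using fin exists_max_indep[OF G] by (intro Max_in) auto
    then obtain A where "max_indep G {} A" "b = card (?V - A)" by blast
    then show ?thesis unfolding bight_edge_ideal[OF G] by (auto intro: SUP_upper)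
  qed
  finally show "?pd \<le> bight ?R ?I" .
  show "bight ?R ?I \<le> ?pd"
    unfolding bight_edge_ideal[OF G] by (rule SUP_least) (auto intro: projective_dimension_edge_ideal_ge[OF G])
qed

text \<open>Here \<open>X\<close> consists of the old vertices. The neighbours of \<open>w\<^sub>i\<^sub>,\<^sub>1\<close> form the clique \<open>W i\<close>, so they are neighbours of
  every vertex \<open>x\<close> in this clique, except for \<open>x\<close> itself.\<close>

theorem corollary5p3:
  fixes G :: "'v graph" and r :: nat and W :: "nat \<Rightarrow> 'v set" and n :: "nat \<Rightarrow> nat"
    and k :: "'k::field itself"
  assumes "finite_simple_graph G"
    and "clique_partition G r W"
    and "\<forall>i\<in>{1..r}. n i > 0"
  shows "let \<Gamma> = multi_clique_whiskered G r W n; S = poly_ring k (verts \<Gamma>); I = edge_ideal k \<Gamma>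
    in projective_dimension S (quotient_module S I) = bight S I"
proof -
  define \<Gamma> where "\<Gamma> = multi_clique_whiskered G r W n"
  have V: "verts \<Gamma> = Inl ` verts G \<union> {Inr (i, j) | i j. i \<in> {1..r} \<and> j \<in> {1..n i}}"
    and E: "edges \<Gamma> = (`) Inl ` edges G \<union> {{Inl x, Inr (i, j)} | x i j. i \<in> {1..r} \<and> x \<in> W i \<and> j \<in> {1..n i}}"
    by (simp_all add: \<Gamma>_def multi_clique_whiskered_def)
  have W: "W i \<subseteq> verts G" "x \<in> W i \<Longrightarrow> y \<in> W i \<Longrightarrow> x \<noteq> y \<Longrightarrow> {x, y} \<in> edges G" if "i \<in> {1..r}" for i x y
    using assms(2) that by (auto simp: clique_partition_def clique_def)
  have G: "finite (verts G)" "e \<in> edges G \<Longrightarrow> e \<subseteq> verts G" "e \<in> edges G \<Longrightarrow> card e = 2" for e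
    using assms(1) by (auto simp: finite_simple_graph_def)
  have simple: "finite_simple_graph \<Gamma>"
    unfolding finite_simple_graph_def
  proof (intro conjI ballI)
    have "{Inr (i, j) | i j. i \<in> {1..r} \<and> j \<in> {1..n i}} = Inr ` (SIGMA i:{1..r}. {1..n i})"
      by auto
    moreover have "finite (SIGMA i:{1..r}. {1..n i})" by simp
    ultimately show "finite (verts \<Gamma>)" unfolding V using G(1) by (metis finite_UnI finite_imageI)
    fix e assume "e \<in> edges \<Gamma>"
    then consider e' where "e' \<in> edges G" "e = Inl ` e'"
      | x i j where "i \<in> {1..r}" "x \<in> W i" "j \<in> {1..n i}" "e = {Inl x, Inr (i, j)}"
      unfolding E by blast
    then show "e \<subseteq> verts \<Gamma>" "card e = 2"
    proof (atomize (full), cases)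
      case 1
      then show "e \<subseteq> verts \<Gamma> \<and> card e = 2" using G(2,3)[OF 1(1)] by (auto simp: V card_image)
    next
      case 2
      then show "e \<subseteq> verts \<Gamma> \<and> card e = 2" using W(1)[OF 2(1)] by (auto simp: V)
    qed
  qed
  have "projective_dimension (poly_ring k (verts \<Gamma>)) (quotient_module (poly_ring k (verts \<Gamma>)) (edge_ideal k \<Gamma>)) =
    bight (poly_ring k (verts \<Gamma>)) (edge_ideal k \<Gamma>)"
  proof (rule projective_dimension_eq_bight[OF simple])
    show "Inl ` verts G \<subseteq> verts \<Gamma>" by (simp add: V)
    show "e \<inter> Inl ` verts G \<noteq> {}" if "e \<in> edges \<Gamma>" for e
    proof -
      from that consider e' where "e' \<in> edges G" "e = Inl ` e'" | x i j where "i \<in> {1..r}" "x \<in> W i" "e = {Inl x, Inr (i, j)}"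
        unfolding E by blast
      then show ?thesis
      proof cases
        case 1
        then have "e' \<noteq> {}" "e' \<subseteq> verts G" using G(2,3)[of e'] by auto
        then show ?thesis using 1 by auto
      next
        case 2
        then show ?thesis using W(1)[OF 2(1)] by auto
      qed
    qed
    fix v :: "'v + nat \<times> nat" assume "v \<in> Inl ` verts G"
    then obtain x where x: "v = Inl x" "x \<in> verts G" by blast
    then have "x \<in> (\<Union>i\<in>{1..r}. W i)" using assms(2) by (simp add: clique_partition_def)
    then obtain i where i: "i \<in> {1..r}" "x \<in> W i" by blast
    then have n: "1 \<in> {1..n i}" using assms(3) by fastforce
    have "Inr (i, 1) \<in> nbrs \<Gamma> v"
      unfolding nbrs_def E x(1) using i n by blast
    moreover have "nbrs \<Gamma> (Inr (i, 1)) \<subseteq> insert v (nbrs \<Gamma> v)"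
    proof
      fix u assume "u \<in> nbrs \<Gamma> (Inr (i, 1))"
      then obtain y where y: "u = Inl y" "y \<in> W i" by (auto simp: nbrs_def E doubleton_eq_iff)
      have "{Inl x, Inl y} = Inl ` {x, y}" by simp
      then show "u \<in> insert v (nbrs \<Gamma> v)"
        using W(2)[OF i(1) i(2) y(2)] x(1) y(1) unfolding nbrs_def E by blast
    qed
    moreover have "Inr (i, 1) \<in> verts \<Gamma> - Inl ` verts G" using i n by (auto simp: V)
    ultimately show "\<exists>w\<in>verts \<Gamma> - Inl ` verts G. w \<in> nbrs \<Gamma> v \<and> nbrs \<Gamma> w \<subseteq> insert v (nbrs \<Gamma> v)"
      by blast
  qed
  then show ?thesis by (simp add: \<Gamma>_def Let_def)
qed

end
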